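(* Let $r>0$, let $A_r=\{z\in\mathbb{C}:e^{-r}<|z|<e^r\}$, let $a\in(e^{-r},e^r)$ be real, and let $T_{A_r}$ be the exit time from $A_r$ of a planar Brownian motion started at $a$. Put $t=\tan\big(\frac{\pi\ln a}{4r}\big)$ and, for $\theta\in\mathbb{R}$ and $k\in\mathbb{Z}$, $u_k=\frac{\theta+2\pi k}{r}$. Then the density of $B_{T_{A_r}}$ with respect to arclength on the boundary circles is $$\rho^a_{T_{A_r}}(e^{\pm r}e^{i\theta})=\frac{1}{re^{\pm r}}\sum_{k=-\infty}^\infty\frac{\operatorname{sech}(\frac\pi2u_k)\,(1-t^2)}{4\left(\Big(1\mp t\,\frac{1-\tanh^2(\frac\pi4u_k)}{1+\tanh^2(\frac\pi4u_k)}\Big)^2+\Big(t\,\frac{2\tanh(\frac\pi4u_k)}{1+\tanh^2(\frac\pi4u_k)}\Big)^2\right)}.$$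
   Context: For a domain $U$, $T_U=\inf\{t\ge0:B_t\notin U\}$, and $\rho^a_{T_U}$ denotes the density of $B_{T_U}$ with respect to arclength on the boundary when $B_0=a$. $\operatorname{sech}=1/\cosh$. The upper signs refer to the outer circle $|z|=e^r$, the lower signs to the inner circle $|z|=e^{-r}$. *)

theory Defs
  imports "HOL-Probability.Probability" "HOL-Complex_Analysis.Complex_Analysis"
begin

definition sech :: "real \<Rightarrow> real" where
  "sech x = 1 / cosh x"

definition annulus :: "real \<Rightarrow> complex set" where
  "annulus r = {z. exp (- r) < norm z \<and> norm z < exp r}"

text \<open>
  Only the values of the process at times \<open>t \<ge> 0\<close> are relevant. The increment over \<open>[s, t]\<close> has
  independent real and imaginary parts, each normal with mean \<open>0\<close> and variance \<open>t - s\<close>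
  (the second parameter of \<^const>\<open>normal_density\<close> is the standard deviation); on \<^typ>\<open>complex\<close>,
  \<^const>\<open>lborel\<close> is planar Lebesgue measure.
\<close>
locale planar_brownian_motion = prob_space M for M :: "'a measure" +
  fixes B :: "real \<Rightarrow> 'a \<Rightarrow> complex" and a :: complex
  assumes random_variable: "\<And>t. 0 \<le> t \<Longrightarrow> B t \<in> borel_measurable M"
    and start: "AE \<omega> in M. B 0 \<omega> = a"
    and indep_increments:
      "\<And>(\<tau> :: nat \<Rightarrow> real) n. 0 \<le> \<tau> 0 \<Longrightarrow> (\<And>i. i < n \<Longrightarrow> \<tau> i < \<tau> (Suc i)) \<Longrightarrow>
         indep_vars (\<lambda>_. borel) (\<lambda>i \<omega>. B (\<tau> (Suc i)) \<omega> - B (\<tau> i) \<omega>) {..<n}"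
    and normal_increments:
      "\<And>s t. 0 \<le> s \<Longrightarrow> s < t \<Longrightarrow>
         distributed M lborel (\<lambda>\<omega>. B t \<omega> - B s \<omega>)
           (\<lambda>z. ennreal (normal_density 0 (sqrt (t - s)) (Re z) * normal_density 0 (sqrt (t - s)) (Im z)))"
    and continuous_paths: "\<And>\<omega>. \<omega> \<in> space M \<Longrightarrow> continuous_on {0..} (\<lambda>t. B t \<omega>)"

text \<open>The exit time takes values in \<open>[0, \<infinity>]\<close>; it is \<open>\<infinity>\<close> when the path never leaves \<open>U\<close>.\<close>
definition exit_time :: "(real \<Rightarrow> 'a \<Rightarrow> complex) \<Rightarrow> complex set \<Rightarrow> 'a \<Rightarrow> ennreal" where
  "exit_time B U \<omega> = Inf {ennreal t |t. 0 \<le> t \<and> B t \<omega> \<notin> U}"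

text \<open>
  Where the exit time is infinite this takes the junk value \<open>B 0 \<omega>\<close>. For a path starting in the
  open set \<open>U\<close> this is not a boundary point, so a density carried by the boundary
  (\<open>has_exit_density\<close> below) entails that the exit time is almost surely finite.
\<close>
definition exit_point :: "(real \<Rightarrow> 'a \<Rightarrow> complex) \<Rightarrow> complex set \<Rightarrow> 'a \<Rightarrow> complex" where
  "exit_point B U \<omega> = B (enn2real (exit_time B U \<omega>)) \<omega>"

text \<open>
  Arclength measure on the union of the curves in a finite set \<open>\<Gamma>\<close> of paths
  (piecewise \<open>C\<^sup>1\<close>, injective up to end points, and pairwise disjoint).
\<close>
definition arclength :: "(real \<Rightarrow> complex) set \<Rightarrow> complex measure" where
  "arclength \<Gamma> = measure_of UNIV (sets borel)
     (\<lambda>S. \<Sum>\<gamma>\<in>\<Gamma>. \<integral>\<^sup>+t\<in>{0..1}. ennreal (norm (vector_derivative \<gamma> (at t))) * indicator S (\<gamma> t) \<partial>lborel)"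

lemma space_arclength [simp]: "space (arclength \<Gamma>) = UNIV"
  by (simp add: arclength_def space_measure_of_conv)

lemma sets_arclength [simp, measurable_cong]: "sets (arclength \<Gamma>) = sets borel"
  using sets.sigma_sets_eq[of "borel :: complex measure"]
  by (simp add: arclength_def sets_measure_of_conv)

lemma emeasure_arclength:
  assumes fin: "finite \<Gamma>"
    and [measurable]: "\<And>\<gamma>. \<gamma> \<in> \<Gamma> \<Longrightarrow> \<gamma> \<in> borel_measurable borel"
      "\<And>\<gamma>. \<gamma> \<in> \<Gamma> \<Longrightarrow> (\<lambda>t. vector_derivative \<gamma> (at t)) \<in> borel_measurable borel"
    and S: "S \<in> sets borel"
  shows "emeasure (arclength \<Gamma>) S =
    (\<Sum>\<gamma>\<in>\<Gamma>. \<integral>\<^sup>+t\<in>{0..1}. ennreal (norm (vector_derivative \<gamma> (at t))) * indicator S (\<gamma> t) \<partial>lborel)"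
proof -
  let ?f = "\<lambda>\<gamma> S. \<integral>\<^sup>+t\<in>{0..1}. ennreal (norm (vector_derivative \<gamma> (at t))) * indicator S (\<gamma> t) \<partial>lborel"
  have "countably_additive (sets borel) (\<lambda>S. \<Sum>\<gamma>\<in>\<Gamma>. ?f \<gamma> S)"
  proof (rule countably_additiveI)
    fix A :: "nat \<Rightarrow> complex set"
    assume A: "range A \<subseteq> sets borel" and disj: "disjoint_family A"
    have [measurable]: "\<And>i. A i \<in> sets borel" using A by auto
    have "?f \<gamma> (\<Union>i. A i) = (\<Sum>i. ?f \<gamma> (A i))" if \<gamma>: "\<gamma> \<in> \<Gamma>" for \<gamma>
    proof -
      note [measurable] = assms(2,3)[OF \<gamma>]
      have "?f \<gamma> (\<Union>i. A i) = (\<integral>\<^sup>+t. (\<Sum>i. ennreal (norm (vector_derivative \<gamma> (at t))) *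
               indicator (A i) (\<gamma> t) * indicator {0..1} t) \<partial>lborel)"
        by (intro nn_integral_cong)
           (simp add: suminf_indicator[OF disj, symmetric] ennreal_suminf_cmult ennreal_suminf_multc)
      also have "\<dots> = (\<Sum>i. ?f \<gamma> (A i))"
        by (rule nn_integral_suminf) measurable
      finally show ?thesis .
    qed
    then show "(\<Sum>i. \<Sum>\<gamma>\<in>\<Gamma>. ?f \<gamma> (A i)) = (\<Sum>\<gamma>\<in>\<Gamma>. ?f \<gamma> (\<Union>i. A i))"
      by (simp add: suminf_sum)
  qed
  then show ?thesis
    unfolding arclength_def
    using S sets.sigma_algebra_axioms[of "borel :: complex measure"]
    by (intro emeasure_measure_of_sigma) (auto simp: positive_def)
qed

lemma emeasure_arclength_circlepaths:
  assumes "finite R" "S \<in> sets borel"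
  shows "emeasure (arclength (circlepath 0 ` R)) S =
    (\<Sum>\<gamma>\<in>circlepath 0 ` R.
       \<integral>\<^sup>+t\<in>{0..1}. ennreal (norm (vector_derivative \<gamma> (at t))) * indicator S (\<gamma> t) \<partial>lborel)"
  using assms
  by (intro emeasure_arclength)
     (auto simp: vector_derivative_circlepath,
      auto simp: circlepath intro!: borel_measurable_continuous_onI continuous_intros)

lemma frontier_annulus:
  assumes "0 < r"
  shows "frontier (annulus r) =
    path_image (circlepath 0 (exp r)) \<union> path_image (circlepath 0 (exp (- r)))"
proof -
  have eq: "annulus r = ball 0 (exp r) - cball 0 (exp (- r))"
    by (auto simp: annulus_def)
  have "open (annulus r)"
    unfolding eq by (intro open_Diff) auto
  then have int: "interior (annulus r) = annulus r"
    by (rule interior_open)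
  have "closure (annulus r) = {z. exp (- r) \<le> norm z \<and> norm z \<le> exp r}" (is "_ = ?C")
  proof
    have "closed ?C"
      by (intro closed_Collect_conj closed_Collect_le continuous_intros)
    then show "closure (annulus r) \<subseteq> ?C"
      by (rule closure_minimal[rotated]) (auto simp: annulus_def)
  next
    show "?C \<subseteq> closure (annulus r)"
    proof
      fix z assume z: "z \<in> ?C"
      define p where "p n = exp (of_real ((1 - 1 / real (n + 2)) * ln (norm z))) * sgn z" for n
      have nz: "z \<noteq> 0" using z by auto
      then have l: "- r \<le> ln (norm z)" "ln (norm z) \<le> r"
        using z ln_le_cancel_iff[of "exp (- r)" "norm z"] ln_le_cancel_iff[of "norm z" "exp r"]
        by auto
      have "\<bar>(1 - 1 / real (n + 2)) * ln (norm z)\<bar> < r" for n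
      proof -
        have "\<bar>(1 - 1 / real (n + 2)) * ln (norm z)\<bar> = (1 - 1 / real (n + 2)) * \<bar>ln (norm z)\<bar>"
          by (simp add: abs_mult)
        also have "\<dots> \<le> (1 - 1 / real (n + 2)) * r"
          using l by (intro mult_left_mono) auto
        also have "\<dots> < 1 * r"
          using assms by (intro mult_strict_right_mono) auto
        finally show ?thesis by simp
      qed
      then have "p n \<in> annulus r" for n
        using nz by (auto simp: p_def annulus_def norm_mult norm_sgn abs_less_iff minus_less_iff)
      moreover have "p \<longlonglongrightarrow> exp (of_real ((1 - 0) * ln (norm z))) * sgn z"
        unfolding p_def
        by (intro tendsto_intros LIMSEQ_ignore_initial_segment[OF lim_1_over_n])
      moreover have "exp (of_real ((1 - 0) * ln (norm z))) * sgn z = z"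
        using nz by (simp add: exp_of_real sgn_eq)
      ultimately show "z \<in> closure (annulus r)"
        by (auto simp: closure_sequential)
    qed
  qed
  with int assms show ?thesis
    by (auto simp: frontier_def annulus_def path_image_circlepath_nonneg)
qed

text \<open>
  The function \<open>\<rho>\<close> is a version of the density of the exit point from \<open>U\<close> with respect to
  arclength on the boundary of \<open>U\<close>, where \<open>\<Gamma>\<close> is a set of paths parametrising that boundary.
\<close>
definition has_exit_density ::
  "'a measure \<Rightarrow> (real \<Rightarrow> 'a \<Rightarrow> complex) \<Rightarrow> complex set \<Rightarrow> (real \<Rightarrow> complex) set \<Rightarrow> (complex \<Rightarrow> real) \<Rightarrow> bool"
where
  "has_exit_density M B U \<Gamma> \<rho> \<longleftrightarrow>
     (\<forall>z. 0 \<le> \<rho> z) \<and> distributed M (arclength \<Gamma>) (exit_point B U) (\<lambda>z. ennreal (\<rho> z))"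

end

theory Submission
  imports Defs "HOL-Real_Asymp.Real_Asymp"
begin

text \<open>
  The exponential map is a covering of the annulus by the strip \<open>\<bar>Re w\<bar> < r\<close>, so the exit distribution
  is the image of harmonic measure of the strip: the sum over \<open>k\<close> collects the points
  \<open>\<plusminus> r + \<i> (\<theta> + 2 \<pi> k)\<close> above a boundary point, and each term is the Poisson kernel of the strip in
  half-angle form (\<open>strip_kernel_half_angle\<close>). The argument does not lift the Brownian path. It shows that
  the distribution of the exit point and the image measure have the same integrals of sufficiently
  many harmonic functions.

  The harmonic functions are the real parts of \<open>c z\<^sup>n\<close>, with \<open>n\<close> any integer, and \<open>ln \<bar>z\<bar>\<close>. Together they
  agree on the two boundary circles with all polynomials in \<open>Re z\<close> and \<open>Im z\<close>, because a function of the
  modulus takes only two values there (\<open>monomial_on_two_circles\<close>); by the theorem of Stone and Weierstrass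
  they determine a measure on the boundary (\<open>measure_eq\<close>).

  For the exit point \<open>X\<close> such a function satisfies \<open>E h(X) = h(a)\<close> (\<open>optional_stopping\<close>). Along a time grid of
  mesh \<open>\<delta>\<close>, a step changes the expectation of \<open>h\<close> by \<open>O(\<delta>\<^sup>2)\<close> only: a Gaussian increment \<open>G\<close> has
  \<open>E G = E G\<^sup>2 = E G\<^sup>3 = 0\<close>, which annihilates the Taylor polynomial of degree \<open>3\<close> (\<open>gauss_increment_bound\<close>).
  Up to a fixed time there are \<open>O(1/\<delta>)\<close> steps, so the total error vanishes with \<open>\<delta>\<close>
  (\<open>grid_expectation\<close>). Stopping at the first grid time outside a closed set and exhausting the annulus by
  closed sets approximates the exit (\<open>grid_time_limit\<close>, \<open>exit_time_exhaustion\<close>).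

  For the image measure the same identity is the Poisson formula for the strip, applied to \<open>c exp (n w)\<close> and to
  \<open>w\<close> (\<open>poisson_formula\<close>). It follows from the residue theorem on a tall rectangle, because the kernel is, up to
  constants, the boundary value of \<open>cos \<phi> / (sin (\<pi> w / 2 r) - sin \<phi>)\<close> with \<open>\<phi> = \<pi> x / 2 r\<close>, whose only pole in the
  strip is the simple pole at \<open>x = ln a\<close>.
\<close>

section \<open>Exit times of a path and dyadic stopping\<close>

text \<open>The horizon \<open>t\<close> keeps the number of grid points finite.\<close>
definition grid_index :: "(real \<Rightarrow> complex) \<Rightarrow> complex set \<Rightarrow> nat \<Rightarrow> nat \<Rightarrow> nat" where
  "grid_index w C t m = (LEAST k. t * 2 ^ m \<le> k \<or> w (real k / 2 ^ m) \<notin> C)"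

definition grid_time :: "(real \<Rightarrow> complex) \<Rightarrow> complex set \<Rightarrow> nat \<Rightarrow> nat \<Rightarrow> real" where
  "grid_time w C t m = real (grid_index w C t m) / 2 ^ m"

lemma grid_index_properties:
  "grid_index w C t m \<le> t * 2 ^ m"
  "k < grid_index w C t m \<Longrightarrow> w (real k / 2 ^ m) \<in> C"
  "grid_index w C t m < t * 2 ^ m \<Longrightarrow> w (real (grid_index w C t m) / 2 ^ m) \<notin> C"
proof -
  let ?P = "\<lambda>k. t * 2 ^ m \<le> k \<or> w (real k / 2 ^ m) \<notin> C"
  have P: "?P (grid_index w C t m)"
    unfolding grid_index_def by (rule LeastI[of ?P "t * 2 ^ m"]) simp
  show "grid_index w C t m \<le> t * 2 ^ m"
    unfolding grid_index_def by (rule Least_le) simp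
  show "w (real k / 2 ^ m) \<in> C" if "k < grid_index w C t m"
    using not_less_Least[of k ?P] that unfolding grid_index_def by auto
  show "w (real (grid_index w C t m) / 2 ^ m) \<notin> C" if "grid_index w C t m < t * 2 ^ m"
    using P that by auto
qed

text \<open>The dyadic grids are nested.\<close>
lemma grid_time_antimono: "grid_time w C t (Suc m) \<le> grid_time w C t m"
proof -
  let ?k = "grid_index w C t m"
  have eq: "real (2 * ?k) / 2 ^ Suc m = real ?k / 2 ^ m" by simp
  have "?k = t * 2 ^ m \<or> w (real ?k / 2 ^ m) \<notin> C"
    using grid_index_properties(1,3)[of w C t m] by linarith
  then have "t * 2 ^ Suc m \<le> 2 * ?k \<or> w (real (2 * ?k) / 2 ^ Suc m) \<notin> C"
    unfolding eq by auto
  then have "grid_index w C t (Suc m) \<le> 2 * ?k"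
    unfolding grid_index_def[of w C t "Suc m"] by (intro Least_le)
  then have "real (grid_index w C t (Suc m)) \<le> 2 * real ?k"
    by (metis of_nat_le_iff of_nat_mult of_nat_numeral)
  then show ?thesis by (simp add: grid_time_def field_simps)
qed

lemma grid_time_bounds: "0 \<le> grid_time w C t m" "grid_time w C t m \<le> real t"
proof -
  have "real (grid_index w C t m) \<le> real (t * 2 ^ m)"
    using grid_index_properties(1) of_nat_le_iff by blast
  then show "grid_time w C t m \<le> real t"
    by (simp add: grid_time_def divide_simps)
qed (simp add: grid_time_def)

lemma dyadic_ceiling_tendsto:
  assumes "0 \<le> s"
  shows "(\<lambda>m. real (nat \<lceil>s * 2 ^ m\<rceil>) / 2 ^ m) \<longlonglongrightarrow> s"
proof (rule tendsto_sandwich[of "\<lambda>_. s" _ _ "\<lambda>m. s + (1/2) ^ m"])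
  show "\<forall>\<^sub>F m in sequentially. s \<le> real (nat \<lceil>s * 2 ^ m\<rceil>) / 2 ^ m"
    by (intro always_eventually allI) (simp add: field_simps real_nat_ceiling_ge)
  have "real (nat \<lceil>s * 2 ^ m\<rceil>) \<le> s * 2 ^ m + 1" for m
    using assms by (simp add: of_nat_nat)
  then show "\<forall>\<^sub>F m in sequentially. real (nat \<lceil>s * 2 ^ m\<rceil>) / 2 ^ m \<le> s + (1/2) ^ m"
    by (intro always_eventually allI) (simp add: field_simps power_divide)
  have "(\<lambda>m. s + (1/2) ^ m) \<longlonglongrightarrow> s + 0"
    by (intro tendsto_intros LIMSEQ_realpow_zero) auto
  then show "(\<lambda>m. s + (1/2) ^ m) \<longlonglongrightarrow> s" by simp
qed auto

text \<open>
  Stopping at the first dyadic time of level \<open>m\<close> at which the path is outside a closed set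
  overestimates the true exit time, and the overestimate disappears as the grid is refined:
  the complement being open, a path that is outside once is outside at a nearby dyadic time.
\<close>
lemma grid_time_limit:
  assumes w: "continuous_on {0..} w" and C: "closed C"
  obtains \<sigma> where "grid_time w C t \<longlonglongrightarrow> \<sigma>" "0 \<le> \<sigma>" "\<sigma> \<le> real t"
    "\<And>s. 0 \<le> s \<Longrightarrow> s < \<sigma> \<Longrightarrow> w s \<in> C" "\<sigma> < real t \<Longrightarrow> w \<sigma> \<notin> interior C"
    "(\<lambda>m. w (grid_time w C t m)) \<longlonglongrightarrow> w \<sigma>"
proof -
  let ?g = "grid_time w C t"
  have dec: "decseq ?g" by (intro decseq_SucI grid_time_antimono)
  obtain \<sigma> where lim: "?g \<longlonglongrightarrow> \<sigma>" and ge: "\<And>i. \<sigma> \<le> ?g i"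
    using decseq_convergent[OF dec, of 0] grid_time_bounds(1) by auto
  have s0: "0 \<le> \<sigma>"
    by (rule LIMSEQ_le_const[OF lim]) (auto simp: grid_time_bounds)
  have st: "\<sigma> \<le> real t"
    using ge[of 0] grid_time_bounds(2)[of w C t 0] by linarith
  have wl: "(\<lambda>m. w (u m)) \<longlonglongrightarrow> w s" if "u \<longlonglongrightarrow> s" "0 \<le> s" "\<And>m. 0 \<le> u m" for u s
    by (rule continuous_on_tendsto_compose[OF w that(1)]) (use that in auto)
  have in_C: "w s \<in> C" if s: "0 \<le> s" "s < \<sigma>" for s
  proof -
    let ?d = "\<lambda>m. real (nat \<lceil>s * 2 ^ m\<rceil>) / 2 ^ m"
    have d: "?d \<longlonglongrightarrow> s" by (rule dyadic_ceiling_tendsto) fact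
    have "\<forall>\<^sub>F m in sequentially. ?d m < \<sigma>"
      using order_tendstoD(2)[OF d] s by blast
    then have ev: "\<forall>\<^sub>F m in sequentially. w (?d m) \<in> C"
    proof eventually_elim
      case (elim m)
      then have "?d m < ?g m" using ge[of m] by linarith
      then show ?case
        unfolding grid_time_def by (intro grid_index_properties(2)[where t=t]) (simp add: divide_simps)
    qed
    have "0 \<le> ?d m" for m by (intro divide_nonneg_nonneg of_nat_0_le_iff) simp
    then show ?thesis
      using Lim_in_closed_set[OF C ev _ wl[OF d]] s by simp
  qed
  have out: "w \<sigma> \<notin> interior C" if "\<sigma> < real t"
  proof -
    have "\<forall>\<^sub>F m in sequentially. ?g m < real t"
      using order_tendstoD(2)[OF lim] that by blast
    then have ev: "\<forall>\<^sub>F m in sequentially. w (?g m) \<in> - interior C"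
    proof eventually_elim
      case (elim m)
      then have "real (grid_index w C t m) < real (t * 2 ^ m)"
        by (simp add: grid_time_def divide_simps)
      then have "w (?g m) \<notin> C"
        unfolding grid_time_def using grid_index_properties(3) of_nat_less_iff by blast
      then show ?case using interior_subset by auto
    qed
    have "w \<sigma> \<in> - interior C"
      by (rule Lim_in_closed_set[OF _ ev _ wl[OF lim]]) (use s0 grid_time_bounds in auto)
    then show ?thesis by auto
  qed
  show thesis
    by (rule that[OF lim s0 st in_C out wl[OF lim]]) (use s0 grid_time_bounds in auto)
qed

lemma exit_time_le: "0 \<le> s \<Longrightarrow> B s \<omega> \<notin> U \<Longrightarrow> exit_time B U \<omega> \<le> ennreal s"
  unfolding exit_time_def by (intro Inf_lower) auto

lemma le_exit_time: "(\<And>s. 0 \<le> s \<Longrightarrow> B s \<omega> \<notin> U \<Longrightarrow> u \<le> ennreal s) \<Longrightarrow> u \<le> exit_time B U \<omega>"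
  unfolding exit_time_def by (intro Inf_greatest) auto

text \<open>
  The exit times \<open>\<sigma>\<^sub>n\<close> from the closed sets increase. Their limit cannot precede the exit from \<open>U\<close>,
  because the exit positions avoid the interior of any fixed \<open>C j\<close> from some index on, and so does
  the limit position.
\<close>
lemma exit_time_exhaustion:
  assumes w: "continuous_on {0..} (\<lambda>s. B s \<omega>)"
    and C: "\<And>n. closed (C n)" "\<And>n. C n \<subseteq> interior (C (Suc n))" "(\<Union>n. C n) = U"
    and \<sigma>: "\<And>n. grid_time (\<lambda>s. B s \<omega>) (C n) t \<longlonglongrightarrow> \<sigma> n"
  shows "\<exists>\<tau>. \<sigma> \<longlonglongrightarrow> \<tau> \<and> (\<lambda>n. B (\<sigma> n) \<omega>) \<longlonglongrightarrow> B \<tau> \<omega> \<and>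
    0 \<le> \<tau> \<and> ennreal \<tau> = min (ennreal (real t)) (exit_time B U \<omega>)"
proof -
  let ?w = "\<lambda>s. B s \<omega>"
  have \<sigma>p: "0 \<le> \<sigma> n \<and> \<sigma> n \<le> real t \<and> (\<forall>s. 0 \<le> s \<longrightarrow> s < \<sigma> n \<longrightarrow> ?w s \<in> C n) \<and>
      (\<sigma> n < real t \<longrightarrow> ?w (\<sigma> n) \<notin> interior (C n))" for n
  proof -
    obtain \<sigma>' where g: "grid_time ?w (C n) t \<longlonglongrightarrow> \<sigma>'" and r: "0 \<le> \<sigma>'" "\<sigma>' \<le> real t"
      "\<And>s. 0 \<le> s \<Longrightarrow> s < \<sigma>' \<Longrightarrow> ?w s \<in> C n" "\<sigma>' < real t \<Longrightarrow> ?w \<sigma>' \<notin> interior (C n)"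
      using grid_time_limit[OF w C(1)] by metis
    have "\<sigma>' = \<sigma> n" using LIMSEQ_unique[OF g \<sigma>] .
    with r show ?thesis by auto
  qed
  have "\<sigma> n \<le> \<sigma> (Suc n)" for n
  proof (rule ccontr)
    assume "\<not> ?thesis"
    then have lt: "\<sigma> (Suc n) < \<sigma> n" by simp
    then have "?w (\<sigma> (Suc n)) \<in> interior (C (Suc n))" using \<sigma>p[of n] \<sigma>p[of "Suc n"] C(2)[of n] by blast
    moreover have "\<sigma> (Suc n) < real t" using lt \<sigma>p[of n] by linarith
    ultimately show False using \<sigma>p[of "Suc n"] by blast
  qed
  then have inc: "incseq \<sigma>" by (rule incseq_SucI)
  obtain \<tau> where lim: "\<sigma> \<longlonglongrightarrow> \<tau>" and le: "\<And>n. \<sigma> n \<le> \<tau>"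
    using incseq_convergent[OF inc, of "real t"] \<sigma>p by auto
  have \<tau>0: "0 \<le> \<tau>" using le[of 0] \<sigma>p[of 0] by linarith
  have \<tau>t: "\<tau> \<le> real t" by (rule LIMSEQ_le_const2[OF lim]) (use \<sigma>p in auto)
  have wlim: "(\<lambda>n. ?w (\<sigma> n)) \<longlonglongrightarrow> ?w \<tau>"
    by (rule continuous_on_tendsto_compose[OF w lim]) (use \<tau>0 \<sigma>p in auto)
  have inU: "?w s \<in> U" if "0 \<le> s" "s < \<tau>" for s
  proof -
    have "\<forall>\<^sub>F n in sequentially. s < \<sigma> n" using order_tendstoD(1)[OF lim] that by blast
    then obtain n where "s < \<sigma> n" by (auto simp: eventually_sequentially)
    then show ?thesis using \<sigma>p[of n] that C(3) by blast
  qed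
  have mono: "interior (C j) \<subseteq> interior (C n)" if "j \<le> n" for j n
    using that
  proof (induction n rule: dec_induct)
    case (step n)
    then show ?case using C(2)[of n] interior_subset by blast
  qed auto
  have out: "?w \<tau> \<notin> U" if "\<tau> < real t"
  proof
    assume "?w \<tau> \<in> U"
    then obtain j where j: "?w \<tau> \<in> interior (C j)" using C(2,3) by blast
    have "\<forall>\<^sub>F n in sequentially. ?w (\<sigma> n) \<in> - interior (C j)"
      using eventually_ge_at_top[of j]
    proof eventually_elim
      case (elim n)
      have "\<sigma> n < real t" using le[of n] that by linarith
      then show ?case using \<sigma>p[of n] mono[OF elim] by blast
    qed
    then have "?w \<tau> \<in> - interior (C j)"
      by (rule Lim_in_closed_set[rotated]) (use wlim in auto)
    then show False using j by auto
  qed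
  have "ennreal \<tau> \<le> exit_time B U \<omega>"
    using inU by (intro le_exit_time) (metis ennreal_leI not_less)
  moreover have "exit_time B U \<omega> \<le> ennreal \<tau>" if "\<tau> < real t"
    using out[OF that] \<tau>0 by (intro exit_time_le)
  ultimately have "ennreal \<tau> = min (ennreal (real t)) (exit_time B U \<omega>)"
    using \<tau>t by (cases "\<tau> < real t") (auto simp: min_def antisym ennreal_leI)
  with lim wlim \<tau>0 show ?thesis by blast
qed

text \<open>Following the path up to \<open>min t T\<close>, the exit point is the position at all late times \<open>t\<close>.\<close>
lemma exit_point_eventually:
  assumes "exit_time B U \<omega> < \<infinity>"
    and "\<And>t::nat. 0 \<le> \<tau> t \<and> ennreal (\<tau> t) = min (ennreal (real t)) (exit_time B U \<omega>)"
  shows "\<forall>\<^sub>F t in sequentially. B (\<tau> t) \<omega> = exit_point B U \<omega>"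
proof -
  obtain T where T: "exit_time B U \<omega> = ennreal T" "0 \<le> T"
    using assms(1) by (cases "exit_time B U \<omega>") auto
  have "\<forall>\<^sub>F t in sequentially. T \<le> real t"
    using filterlim_real_sequentially by (auto simp: filterlim_at_top)
  then show ?thesis
  proof eventually_elim
    case (elim t)
    then have "ennreal (\<tau> t) = ennreal T"
      using assms(2)[of t] T by (simp add: min_def ennreal_le_iff antisym)
    then have "\<tau> t = T" using assms(2)[of t] T ennreal_inj[of "\<tau> t" T] by metis
    then show ?case using T by (simp add: exit_point_def)
  qed
qed

text \<open>The set of times outside \<open>U\<close> is closed, so the infimum defining the exit time is attained.\<close>
lemma exit_point_notin:
  assumes w: "continuous_on {0..} (\<lambda>s. B s \<omega>)" and U: "open U" and fin: "exit_time B U \<omega> < \<infinity>"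
  shows "exit_point B U \<omega> \<notin> U"
proof -
  let ?S = "{s \<in> {0..}. B s \<omega> \<in> - U}"
  obtain T where T: "exit_time B U \<omega> = ennreal T" "0 \<le> T"
    using fin by (cases "exit_time B U \<omega>") auto
  have closed: "closed ?S"
    using continuous_closed_preimage[OF w, of "-U"] U by (simp add: closed_Compl vimage_def Int_def)
  have ge: "T \<le> s" if "s \<in> ?S" for s
    using exit_time_le[of s B \<omega> U] that T by (auto simp: ennreal_le_iff2)
  have ne: "?S \<noteq> {}"
  proof
    assume "?S = {}"
    then have "exit_time B U \<omega> = Inf {}"
      unfolding exit_time_def by (intro arg_cong[where f=Inf]) auto
    then show False using fin by simp
  qed
  have bdd: "bdd_below ?S" using ge by (auto simp: bdd_below_def)
  have mem: "Inf ?S \<in> ?S" by (rule closed_contains_Inf[OF ne bdd closed])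
  have "ennreal (Inf ?S) \<le> exit_time B U \<omega>"
  proof (rule le_exit_time)
    fix s assume "0 \<le> s" "B s \<omega> \<notin> U"
    then have "Inf ?S \<le> s" by (intro cInf_lower[OF _ bdd]) auto
    then show "ennreal (Inf ?S) \<le> ennreal s" by (rule ennreal_leI)
  qed
  then have "Inf ?S \<le> T" using T by (simp add: ennreal_le_iff)
  with ge[OF mem] have "T \<in> ?S" using mem by simp
  then show ?thesis using T by (simp add: exit_point_def)
qed

lemma path_in_closure:
  fixes w :: "real \<Rightarrow> complex"
  assumes w: "continuous_on {0..} w" and "0 \<le> T" "w 0 \<in> U" and U: "\<And>s. 0 \<le> s \<Longrightarrow> s < T \<Longrightarrow> w s \<in> U"
  shows "w T \<in> closure U"
proof (cases "T = 0")
  case True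
  then show ?thesis using assms closure_subset by auto
next
  case False
  then have Tpos: "0 < T" using assms by simp
  let ?u = "\<lambda>n. T - T / real (Suc n)"
  have "?u \<longlonglongrightarrow> T - 0"
    by (intro tendsto_intros LIMSEQ_Suc[OF lim_const_over_n])
  then have u: "?u \<longlonglongrightarrow> T" by simp
  have u0: "0 \<le> ?u n" "?u n < T" for n
    using Tpos by (auto simp: field_simps)
  have "(\<lambda>n. w (?u n)) \<longlonglongrightarrow> w T"
    by (rule continuous_on_tendsto_compose[OF w u]) (use u0 assms in auto)
  moreover have "w (?u n) \<in> U" for n
    using U u0 by blast
  ultimately show ?thesis
    unfolding closure_sequential by (intro exI[of _ "\<lambda>n. w (?u n)"] conjI allI)
qed

lemma before_exit_time: "0 \<le> s \<Longrightarrow> ennreal s < exit_time B U \<omega> \<Longrightarrow> B s \<omega> \<in> U"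
  using exit_time_le[of s B \<omega> U] by (metis not_less)

lemma exit_point_in_frontier:
  assumes w: "continuous_on {0..} (\<lambda>s. B s \<omega>)" and U: "open U" and fin: "exit_time B U \<omega> < \<infinity>"
    and 0: "B 0 \<omega> \<in> U"
  shows "exit_point B U \<omega> \<in> frontier U"
proof -
  obtain T where T: "exit_time B U \<omega> = ennreal T" "0 \<le> T"
    using fin by (cases "exit_time B U \<omega>") auto
  have "B T \<omega> \<in> closure U"
  proof (rule path_in_closure[of "\<lambda>s. B s \<omega>", OF w T(2) 0])
    fix s :: real assume "0 \<le> s" "s < T"
    then show "B s \<omega> \<in> U" using T by (intro before_exit_time) (auto simp: ennreal_lessI)
  qed
  then have "exit_point B U \<omega> \<in> closure U" using T by (simp add: exit_point_def)
  with exit_point_notin[where B=B, OF w U fin] show ?thesis using U by (simp add: frontier_def interior_open)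
qed

section \<open>Moments of a planar Gaussian increment\<close>

lemma measurable_Complex [measurable]: "(\<lambda>(x, y). Complex x y) \<in> borel_measurable (borel \<Otimes>\<^sub>M borel)"
  unfolding borel_prod case_prod_beta Complex_eq
  by (intro borel_measurable_continuous_onI continuous_intros)

lemma lborel_complex_eq:
  "(lborel :: complex measure) = distr (lborel \<Otimes>\<^sub>M lborel) borel (\<lambda>(x, y). Complex x y)"
proof (rule lborel_eqI)
  fix l u :: complex assume le: "\<And>b. b \<in> Basis \<Longrightarrow> l \<bullet> b \<le> u \<bullet> b"
  then have le': "Re l \<le> Re u" "Im l \<le> Im u"
    by (force simp: Basis_complex_def inner_complex_def)+
  have "(\<lambda>(x, y). Complex x y) -` box l u \<inter> space (lborel \<Otimes>\<^sub>M lborel) = {Re l <..< Re u} \<times> {Im l <..< Im u}"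
    by (auto simp: box_def Basis_complex_def inner_complex_def space_pair_measure)
  then show "emeasure (distr (lborel \<Otimes>\<^sub>M lborel) borel (\<lambda>(x, y). Complex x y)) (box l u) =
      (\<Prod>b\<in>Basis. (u - l) \<bullet> b)"
    using le' by (simp add: emeasure_distr lborel.emeasure_pair_measure_Times ennreal_mult
        Basis_complex_def inner_complex_def)
qed simp

lemma has_bochner_integral_lborel_complex_mult:
  fixes f g :: "real \<Rightarrow> real"
  assumes f: "has_bochner_integral lborel f A" and g: "has_bochner_integral lborel g B"
  shows "has_bochner_integral lborel (\<lambda>z::complex. f (Re z) * g (Im z)) (A * B)"
proof -
  have fi: "integrable lborel f" "integral\<^sup>L lborel f = A" and gi: "integrable lborel g" "integral\<^sup>L lborel g = B"
    using f g by (auto simp: has_bochner_integral_iff)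
  have [measurable]: "f \<in> borel_measurable borel" "g \<in> borel_measurable borel"
    using fi(1) gi(1) by auto
  have I: "integrable (lborel \<Otimes>\<^sub>M lborel) (\<lambda>(x, y). f x * g y)"
  proof (rule lborel_pair.Fubini_integrable)
    show "integrable lborel (\<lambda>x. \<integral>y. norm (case (x, y) of (x, y) \<Rightarrow> f x * g y) \<partial>lborel)"
      using fi gi by (simp add: abs_mult)
    show "AE x in lborel. integrable lborel (\<lambda>y. case (x, y) of (x, y) \<Rightarrow> f x * g y)"
      using gi by simp
  qed simp
  have "(\<integral>z. (case z of (x, y) \<Rightarrow> f x * g y) \<partial>(lborel \<Otimes>\<^sub>M lborel)) = A * B"
    using lborel_pair.integral_fst'[OF I] fi gi by simp
  with I show ?thesis
    unfolding lborel_complex_eq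
    by (subst has_bochner_integral_distr) (auto simp: has_bochner_integral_iff case_prod_beta')
qed

text \<open>Here \<open>\<delta>\<close> is the variance of each coordinate, that is, the length of the time step.\<close>
definition gauss :: "real \<Rightarrow> complex \<Rightarrow> real" where
  "gauss \<delta> z = normal_density 0 (sqrt \<delta>) (Re z) * normal_density 0 (sqrt \<delta>) (Im z)"

lemma gauss_nonneg: "0 \<le> gauss \<delta> z"
  by (simp add: gauss_def)

lemma measurable_gauss [measurable]: "gauss \<delta> \<in> borel_measurable borel"
  unfolding gauss_def by measurable

definition normal_moment_value :: "real \<Rightarrow> nat \<Rightarrow> real" where
  "normal_moment_value \<delta> n = (if even n then fact n / ((2 / \<delta>) ^ (n div 2) * fact (n div 2)) else 0)"

lemma normal_moment:
  assumes "0 < \<delta>"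
  shows "has_bochner_integral lborel (\<lambda>x. normal_density 0 (sqrt \<delta>) x * x ^ n) (normal_moment_value \<delta> n)"
proof (cases "even n")
  case True
  then obtain k where "n = 2 * k" by blast
  then show ?thesis using normal_moment_even[of "sqrt \<delta>" 0 k] assms by (simp add: normal_moment_value_def)
next
  case False
  then obtain k where "n = 2 * k + 1" using oddE by blast
  then show ?thesis using normal_moment_odd[of "sqrt \<delta>" 0 k] assms by (simp add: normal_moment_value_def)
qed

lemma gauss_mixed_moment:
  assumes "0 < \<delta>"
  shows "has_bochner_integral lborel (\<lambda>z. gauss \<delta> z * (Re z ^ m * Im z ^ n)) (normal_moment_value \<delta> m * normal_moment_value \<delta> n)"
  using has_bochner_integral_lborel_complex_mult[OF normal_moment[OF assms, of m] normal_moment[OF assms, of n]]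
  by (simp add: gauss_def mult_ac)

lemma gauss_moments:
  assumes "0 < \<delta>"
  shows "has_bochner_integral lborel (gauss \<delta>) 1"
    "has_bochner_integral lborel (\<lambda>z. gauss \<delta> z * norm z ^ 4) (8 * \<delta>\<^sup>2)"
    "has_bochner_integral lborel (\<lambda>z. gauss \<delta> z * Re (c1 * z + c2 * z\<^sup>2 + c3 * z ^ 3)) 0"
proof -
  note M = gauss_mixed_moment[OF assms]
  note G = normal_moment_value_def fact_numeral
  show "has_bochner_integral lborel (gauss \<delta>) 1"
    using M[of 0 0] by (simp add: G)
  have "has_bochner_integral lborel
      (\<lambda>z. gauss \<delta> z * (Re z ^ 4 * Im z ^ 0) + 2 * (gauss \<delta> z * (Re z ^ 2 * Im z ^ 2)) + gauss \<delta> z * (Re z ^ 0 * Im z ^ 4))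
      (normal_moment_value \<delta> 4 * normal_moment_value \<delta> 0 + 2 * (normal_moment_value \<delta> 2 * normal_moment_value \<delta> 2) + normal_moment_value \<delta> 0 * normal_moment_value \<delta> 4)"
    by (intro has_bochner_integral_add has_bochner_integral_mult_right M)
  moreover have "norm z ^ 4 = Re z ^ 4 + 2 * (Re z ^ 2 * Im z ^ 2) + Im z ^ 4" for z
  proof -
    have "norm z ^ 4 = ((norm z)\<^sup>2)\<^sup>2" by simp
    then show ?thesis unfolding cmod_power2 by algebra
  qed
  moreover have "normal_moment_value \<delta> 4 * normal_moment_value \<delta> 0 + 2 * (normal_moment_value \<delta> 2 * normal_moment_value \<delta> 2) + normal_moment_value \<delta> 0 * normal_moment_value \<delta> 4 = 8 * \<delta>\<^sup>2"
    using assms by (simp add: G power2_eq_square)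
  ultimately show "has_bochner_integral lborel (\<lambda>z. gauss \<delta> z * norm z ^ 4) (8 * \<delta>\<^sup>2)"
    by (simp add: distrib_left mult.left_commute)
  have "has_bochner_integral lborel
      (\<lambda>z. Re c1 * (gauss \<delta> z * (Re z ^ 1 * Im z ^ 0)) + (- Im c1) * (gauss \<delta> z * (Re z ^ 0 * Im z ^ 1))
        + Re c2 * (gauss \<delta> z * (Re z ^ 2 * Im z ^ 0)) + (- Re c2) * (gauss \<delta> z * (Re z ^ 0 * Im z ^ 2))
        + (- 2 * Im c2) * (gauss \<delta> z * (Re z ^ 1 * Im z ^ 1))
        + Re c3 * (gauss \<delta> z * (Re z ^ 3 * Im z ^ 0)) + (- 3 * Re c3) * (gauss \<delta> z * (Re z ^ 1 * Im z ^ 2))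
        + (- 3 * Im c3) * (gauss \<delta> z * (Re z ^ 2 * Im z ^ 1)) + Im c3 * (gauss \<delta> z * (Re z ^ 0 * Im z ^ 3)))
      (Re c1 * (normal_moment_value \<delta> 1 * normal_moment_value \<delta> 0) + (- Im c1) * (normal_moment_value \<delta> 0 * normal_moment_value \<delta> 1)
        + Re c2 * (normal_moment_value \<delta> 2 * normal_moment_value \<delta> 0) + (- Re c2) * (normal_moment_value \<delta> 0 * normal_moment_value \<delta> 2)
        + (- 2 * Im c2) * (normal_moment_value \<delta> 1 * normal_moment_value \<delta> 1)
        + Re c3 * (normal_moment_value \<delta> 3 * normal_moment_value \<delta> 0) + (- 3 * Re c3) * (normal_moment_value \<delta> 1 * normal_moment_value \<delta> 2)
        + (- 3 * Im c3) * (normal_moment_value \<delta> 2 * normal_moment_value \<delta> 1) + Im c3 * (normal_moment_value \<delta> 0 * normal_moment_value \<delta> 3))"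
    (is "has_bochner_integral _ ?f ?m")
    by (intro has_bochner_integral_add has_bochner_integral_mult_right M)
  moreover have "?m = 0" by (simp add: G)
  moreover have "gauss \<delta> z * Re (c1 * z + c2 * z\<^sup>2 + c3 * z ^ 3) = ?f z" for z
  proof -
    have e: "Re (z\<^sup>2) = Re z ^ 2 - Im z ^ 2" "Im (z\<^sup>2) = 2 * Re z * Im z"
      "Re (z ^ 3) = Re z ^ 3 - 3 * Re z * Im z ^ 2" "Im (z ^ 3) = 3 * Re z ^ 2 * Im z - Im z ^ 3"
      by (simp_all add: power2_eq_square power3_eq_cube algebra_simps)
    show ?thesis
      unfolding plus_complex.sel times_complex.sel e power_0 power_one_right by (simp add: algebra_simps)
  qed
  ultimately show "has_bochner_integral lborel (\<lambda>z. gauss \<delta> z * Re (c1 * z + c2 * z\<^sup>2 + c3 * z ^ 3)) 0"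
    by simp
qed

text \<open>
  A form of harmonicity that suits Gaussian increments: at points of \<open>S\<close> the function is the real part of a
  holomorphic cubic up to a fourth order error. The inequality is required of all increments \<open>g\<close>, large
  ones included, because Gaussian increments are unbounded; a function that is harmonic only near \<open>S\<close> is
  to be cut off. The constant \<open>C\<close> is the same at all points of \<open>S\<close>.
\<close>
definition harmonic_upto_4 :: "(complex \<Rightarrow> real) \<Rightarrow> complex set \<Rightarrow> real \<Rightarrow> bool" where
  "harmonic_upto_4 h S C \<longleftrightarrow> (\<forall>z\<in>S. \<exists>c1 c2 c3. \<forall>g.
     \<bar>h (z + g) - h z - Re (c1 * g + c2 * g\<^sup>2 + c3 * g ^ 3)\<bar> \<le> C * norm g ^ 4)"

text \<open>
  The cubic has expectation \<open>0\<close>, since \<open>G\<close>, \<open>G\<^sup>2\<close> and \<open>G\<^sup>3\<close> do for a rotationally symmetric Gaussian \<open>G\<close>;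
  the constant \<open>8\<close> is the fourth moment of the modulus.
\<close>
lemma gauss_increment_bound:
  assumes h: "harmonic_upto_4 h S C" and z: "z \<in> S" and \<delta>: "0 < \<delta>"
    and [measurable]: "h \<in> borel_measurable borel"
  shows "\<bar>\<integral>g. gauss \<delta> g * (h (z + g) - h z) \<partial>lborel\<bar> \<le> 8 * C * \<delta>\<^sup>2"
proof -
  obtain c1 c2 c3 where c: "\<And>g. \<bar>h (z + g) - h z - Re (c1 * g + c2 * g\<^sup>2 + c3 * g ^ 3)\<bar> \<le> C * norm g ^ 4"
    using h z unfolding harmonic_upto_4_def by metis
  let ?p = "\<lambda>g. Re (c1 * g + c2 * g\<^sup>2 + c3 * g ^ 3)"
  let ?d = "\<lambda>g. h (z + g) - h z - ?p g"
  have p: "integrable lborel (\<lambda>g. gauss \<delta> g * ?p g)" "(\<integral>g. gauss \<delta> g * ?p g \<partial>lborel) = 0"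
    using gauss_moments(3)[OF \<delta>, of c1 c2 c3] unfolding has_bochner_integral_iff by blast+
  have q: "integrable lborel (\<lambda>g. C * (gauss \<delta> g * norm g ^ 4))"
      "(\<integral>g. C * (gauss \<delta> g * norm g ^ 4) \<partial>lborel) = 8 * C * \<delta>\<^sup>2"
    using gauss_moments(2)[OF \<delta>] unfolding has_bochner_integral_iff by auto
  have bd: "norm (gauss \<delta> g * ?d g) \<le> C * (gauss \<delta> g * norm g ^ 4)" for g
    using mult_left_mono[OF c[of g] gauss_nonneg[of \<delta> g]] gauss_nonneg[of \<delta> g]
    by (simp add: abs_mult mult_ac)
  have d: "integrable lborel (\<lambda>g. gauss \<delta> g * ?d g)"
  proof (rule Bochner_Integration.integrable_bound[OF q(1)])
    show "AE g in lborel. norm (gauss \<delta> g * ?d g) \<le> norm (C * (gauss \<delta> g * norm g ^ 4))"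
      using bd by (intro AE_I2) (metis abs_ge_self order_trans real_norm_def)
  qed measurable
  have "(\<integral>g. gauss \<delta> g * (h (z + g) - h z) \<partial>lborel) = (\<integral>g. gauss \<delta> g * ?d g + gauss \<delta> g * ?p g \<partial>lborel)"
    by (intro Bochner_Integration.integral_cong) (auto simp: algebra_simps)
  also have "\<dots> = (\<integral>g. gauss \<delta> g * ?d g \<partial>lborel)"
    using p d by simp
  finally have eq: "(\<integral>g. gauss \<delta> g * (h (z + g) - h z) \<partial>lborel) = (\<integral>g. gauss \<delta> g * ?d g \<partial>lborel)" .
  have "norm (\<integral>g. gauss \<delta> g * ?d g \<partial>lborel) \<le> (\<integral>g. norm (gauss \<delta> g * ?d g) \<partial>lborel)"
    by (rule integral_norm_bound)
  also have "(\<integral>g. norm (gauss \<delta> g * ?d g) \<partial>lborel) \<le> (\<integral>g. C * (gauss \<delta> g * norm g ^ 4) \<partial>lborel)"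
    by (rule integral_mono[OF integrable_norm[OF d] q(1)]) (rule bd)
  finally show ?thesis unfolding eq q(2) by simp
qed

section \<open>Dynkin's formula along a dyadic grid\<close>

text \<open>
  The past enters through \<open>X\<close> only: by Fubini the increment may be integrated first, for a fixed
  value of \<open>X\<close>.
\<close>
lemma (in prob_space) indep_gauss_step:
  fixes h :: "complex \<Rightarrow> real"
  assumes ind: "indep_var S X T Y"
    and G: "distributed M lborel (\<lambda>\<omega>. g (Y \<omega>)) (\<lambda>z. ennreal (gauss \<delta> z))" and \<delta>: "0 < \<delta>"
    and [measurable]: "A \<in> sets S" "s \<in> borel_measurable S" "g \<in> borel_measurable T" "h \<in> borel_measurable borel"
    and h: "harmonic_upto_4 h K C" "0 \<le> C" and bd: "\<And>z. \<bar>h z\<bar> \<le> b"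
    and A: "\<And>x. x \<in> A \<Longrightarrow> s x \<in> K"
  shows "\<bar>\<integral>\<omega>. indicator A (X \<omega>) * (h (s (X \<omega>) + g (Y \<omega>)) - h (s (X \<omega>))) \<partial>M\<bar> \<le> 8 * C * \<delta>\<^sup>2"
proof -
  have [measurable]: "X \<in> measurable M S" "Y \<in> measurable M T"
    and D: "distr M (S \<Otimes>\<^sub>M T) (\<lambda>\<omega>. (X \<omega>, Y \<omega>)) = distr M S X \<Otimes>\<^sub>M distr M T Y"
    using ind unfolding indep_var_distribution_eq by auto
  have GD: "distr (distr M T Y) borel g = density lborel (\<lambda>z. ennreal (gauss \<delta> z))"
    using distributed_distr_eq_density[OF G] by (simp add: distr_distr comp_def cong: distr_cong)
  interpret P1: prob_space "distr M S X" by (rule prob_space_distr) measurable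
  interpret P2: prob_space "distr M T Y" by (rule prob_space_distr) measurable
  interpret P: pair_prob_space "distr M S X" "distr M T Y" ..
  define \<phi> where "\<phi> = (\<lambda>(x, y). indicator A x * (h (s x + g y) - h (s x)))"
  have m[measurable]: "\<phi> \<in> borel_measurable (S \<Otimes>\<^sub>M T)" unfolding \<phi>_def by measurable
  have m2: "\<phi> \<in> borel_measurable (distr M S X \<Otimes>\<^sub>M distr M T Y)"
    by (subst measurable_cong_sets[OF sets_pair_measure_cong[OF sets_distr sets_distr] refl]) (rule m)
  have \<phi>b: "\<bar>\<phi> p\<bar> \<le> 2 * b" for p
  proof -
    obtain x y where [simp]: "p = (x, y)" by (cases p)
    have "0 \<le> b" using bd[of 0] by linarith
    then show ?thesis
      using bd[of "s x + g y"] bd[of "s x"] by (auto simp: \<phi>_def indicator_def)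
  qed
  have int: "integrable (distr M S X \<Otimes>\<^sub>M distr M T Y) \<phi>"
    by (rule P.integrable_const_bound[of _ "2 * b"]) (use \<phi>b m2 in auto)
  have inner: "\<bar>\<integral>y. \<phi> (x, y) \<partial>distr M T Y\<bar> \<le> 8 * C * \<delta>\<^sup>2" for x
  proof (cases "x \<in> A")
    case True
    have "(\<integral>y. \<phi> (x, y) \<partial>distr M T Y) = (\<integral>z. h (s x + z) - h (s x) \<partial>distr (distr M T Y) borel g)"
      using True by (subst (2) integral_distr) (auto simp: \<phi>_def)
    also have "\<dots> = (\<integral>z. gauss \<delta> z * (h (s x + z) - h (s x)) \<partial>lborel)"
      unfolding GD by (subst integral_density) (auto simp: gauss_nonneg)
    finally show ?thesis using gauss_increment_bound[OF h(1) A[OF True] \<delta>] by simp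
  qed (use h in \<open>simp add: \<phi>_def\<close>)
  have "(\<integral>\<omega>. indicator A (X \<omega>) * (h (s (X \<omega>) + g (Y \<omega>)) - h (s (X \<omega>))) \<partial>M)
      = (\<integral>p. \<phi> p \<partial>distr M (S \<Otimes>\<^sub>M T) (\<lambda>\<omega>. (X \<omega>, Y \<omega>)))"
    by (subst integral_distr) (auto simp: \<phi>_def)
  also have "\<dots> = (\<integral>x. (\<integral>y. \<phi> (x, y) \<partial>distr M T Y) \<partial>distr M S X)"
    unfolding D using P.integral_fst'[OF int] by simp
  finally have eq: "(\<integral>\<omega>. indicator A (X \<omega>) * (h (s (X \<omega>) + g (Y \<omega>)) - h (s (X \<omega>))) \<partial>M)
      = (\<integral>x. (\<integral>y. \<phi> (x, y) \<partial>distr M T Y) \<partial>distr M S X)" .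
  have i2: "integrable (distr M S X) (\<lambda>x. \<integral>y. \<phi> (x, y) \<partial>distr M T Y)"
    using P.integrable_fst'[OF int] by simp
  have "\<bar>\<integral>x. (\<integral>y. \<phi> (x, y) \<partial>distr M T Y) \<partial>distr M S X\<bar>
      \<le> (\<integral>x. \<bar>\<integral>y. \<phi> (x, y) \<partial>distr M T Y\<bar> \<partial>distr M S X)"
    by (rule integral_abs_bound)
  also have "(\<integral>x. \<bar>\<integral>y. \<phi> (x, y) \<partial>distr M T Y\<bar> \<partial>distr M S X) \<le> (\<integral>x. 8 * C * \<delta>\<^sup>2 \<partial>distr M S X)"
    by (rule integral_mono) (use i2 inner in auto)
  also have "(\<integral>x. 8 * C * \<delta>\<^sup>2 \<partial>distr M S X) = 8 * C * \<delta>\<^sup>2"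
    using P1.prob_space by simp
  finally show ?thesis unfolding eq .
qed

lemma stopped_telescope:
  fixes f :: "nat \<Rightarrow> real"
  shows "f (grid_index w C t m) - f 0 =
    (\<Sum>k < t * 2 ^ m. (if \<forall>i\<le>k. w (real i / 2 ^ m) \<in> C then 1 else 0) * (f (Suc k) - f k))"
proof -
  let ?N = "t * 2 ^ m" and ?\<kappa> = "grid_index w C t m"
  have eq: "(\<forall>i\<le>k. w (real i / 2 ^ m) \<in> C) \<longleftrightarrow> k < ?\<kappa>" if "k < ?N" for k
  proof
    assume *: "\<forall>i\<le>k. w (real i / 2 ^ m) \<in> C"
    show "k < ?\<kappa>"
    proof (rule ccontr)
      assume "\<not> k < ?\<kappa>"
      then have "?\<kappa> \<le> k" by simp
      with * grid_index_properties(3)[of w C t m] that show False by auto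
    qed
  next
    assume "k < ?\<kappa>"
    then show "\<forall>i\<le>k. w (real i / 2 ^ m) \<in> C"
      using grid_index_properties(2)[of _ w C t m] by auto
  qed
  have "(\<Sum>k < ?N. (if \<forall>i\<le>k. w (real i / 2 ^ m) \<in> C then 1 else 0) * (f (Suc k) - f k))
      = (\<Sum>k < ?N. if k < ?\<kappa> then f (Suc k) - f k else 0)"
    by (intro sum.cong) (use eq in auto)
  also have "\<dots> = (\<Sum>k \<in> {..< ?N} \<inter> {k. k < ?\<kappa>}. f (Suc k) - f k)"
    by (simp add: sum.inter_restrict)
  also have "{..< ?N} \<inter> {k. k < ?\<kappa>} = {..< ?\<kappa>}"
    using grid_index_properties(1)[of w C t m] by auto
  also have "(\<Sum>k < ?\<kappa>. f (Suc k) - f k) = f ?\<kappa> - f 0"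
    by (rule sum_lessThan_telescope)
  finally show ?thesis ..
qed

context planar_brownian_motion
begin

lemma measurable_grid_time:
  assumes [measurable]: "C \<in> sets borel"
  shows "(\<lambda>\<omega>. B (grid_time (\<lambda>s. B s \<omega>) C t m) \<omega>) \<in> borel_measurable M"
proof -
  have [measurable]: "(\<lambda>\<omega>. B (real k / 2 ^ m) \<omega>) \<in> borel_measurable M" for k
    by (rule random_variable) simp
  have k: "(\<lambda>\<omega>. grid_index (\<lambda>s. B s \<omega>) C t m) \<in> measurable M (count_space UNIV)"
    unfolding grid_index_def by measurable
  show ?thesis
    unfolding grid_time_def
    by (rule measurable_compose_countable[OF _ k, where f="\<lambda>k \<omega>. B (real k / 2 ^ m) \<omega>"]) measurable
qed

text \<open>
  That the path has been in \<open>C\<close> at the grid times up to the \<open>k\<close>-th is an event about the first \<open>k\<close>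
  increments, as the starting point is constant; so it is independent of the next increment.
\<close>
lemma step_expectation_bound:
  fixes h :: "complex \<Rightarrow> real"
  assumes [measurable]: "C \<in> sets borel" "h \<in> borel_measurable borel"
    and CK: "C \<subseteq> K" and h: "harmonic_upto_4 h K c" "0 \<le> c" and bd: "\<And>z. \<bar>h z\<bar> \<le> b"
  shows "\<bar>\<integral>\<omega>. (if \<forall>i\<le>k. B (real i / 2 ^ m) \<omega> \<in> C then 1 else 0) *
      (h (B (real (Suc k) / 2 ^ m) \<omega>) - h (B (real k / 2 ^ m) \<omega>)) \<partial>M\<bar> \<le> 8 * c * (1 / 2 ^ m)\<^sup>2"
proof -
  define \<tau> where "\<tau> i = real i / 2 ^ m" for i :: nat
  define D where "D i \<omega> = B (\<tau> (Suc i)) \<omega> - B (\<tau> i) \<omega>" for i \<omega>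
  have [measurable]: "(\<lambda>\<omega>. B (\<tau> k) \<omega>) \<in> borel_measurable M" for k
    by (rule random_variable) (simp add: \<tau>_def)
  have [measurable]: "D i \<in> borel_measurable M" for i unfolding D_def by measurable
  let ?P = "PiM {..<k} (\<lambda>_. borel :: complex measure)"
  let ?X = "\<lambda>\<omega>. restrict (\<lambda>i. D i \<omega>) {..<k}"
  have "indep_vars (\<lambda>_. borel) (\<lambda>i \<omega>. B (\<tau> (Suc i)) \<omega> - B (\<tau> i) \<omega>) {..<Suc k}"
    by (rule indep_increments) (auto simp: \<tau>_def divide_strict_right_mono)
  then have iv: "indep_vars (\<lambda>_. borel) D {..<Suc k}" by (simp add: D_def[abs_def])
  let ?Y = "\<lambda>\<omega>. restrict (\<lambda>i. D i \<omega>) {k}"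
  have ind: "indep_var ?P ?X (PiM {k} (\<lambda>_. borel)) ?Y"
    by (rule indep_var_restrict[OF iv]) auto
  have "\<tau> (Suc k) - \<tau> k = 1 / 2 ^ m" by (simp add: \<tau>_def diff_divide_distrib[symmetric])
  moreover have "\<tau> k < \<tau> (Suc k)" "0 \<le> \<tau> k" by (auto simp: \<tau>_def divide_strict_right_mono)
  ultimately have dist: "distributed M lborel (D k) (\<lambda>z. ennreal (gauss (1 / 2 ^ m) z))"
    using normal_increments[of "\<tau> k" "\<tau> (Suc k)"] unfolding D_def gauss_def by simp
  then have dist': "distributed M lborel (\<lambda>\<omega>. ?Y \<omega> k) (\<lambda>z. ennreal (gauss (1 / 2 ^ m) z))" by simp
  define S where "S i x = a + (\<Sum>j<i. x j)" for i and x :: "nat \<Rightarrow> complex"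
  have S[measurable]: "S i \<in> borel_measurable ?P" if "i \<le> k" for i
    unfolding S_def by (intro borel_measurable_add borel_measurable_const borel_measurable_sum measurable_component_singleton) (use that in auto)
  define A where "A = {x \<in> space ?P. \<forall>i\<in>{..k}. S i x \<in> C}"
  have A: "A \<in> sets ?P"
    unfolding A_def
  proof (rule sets.sets_Collect_finite_All')
    fix i assume "i \<in> {..k}"
    then show "{x \<in> space ?P. S i x \<in> C} \<in> sets ?P"
      using measurable_sets[OF S[of i], of C] by (simp add: vimage_def Int_def conj_commute)
  qed auto
  have Sk: "S k \<in> borel_measurable ?P" by (rule S) simp
  have "\<bar>\<integral>\<omega>. indicator A (?X \<omega>) * (h (S k (?X \<omega>) + ?Y \<omega> k) - h (S k (?X \<omega>))) \<partial>M\<bar>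
      \<le> 8 * c * (1 / 2 ^ m)\<^sup>2"
    by (rule indep_gauss_step[OF ind dist' _ A Sk _ _ h bd]) (use CK in \<open>auto simp: A_def\<close>)
  then have "\<bar>\<integral>\<omega>. indicator A (?X \<omega>) * (h (S k (?X \<omega>) + D k \<omega>) - h (S k (?X \<omega>))) \<partial>M\<bar>
      \<le> 8 * c * (1 / 2 ^ m)\<^sup>2" by simp
  moreover have "(\<integral>\<omega>. indicator A (?X \<omega>) * (h (S k (?X \<omega>) + D k \<omega>) - h (S k (?X \<omega>))) \<partial>M)
      = (\<integral>\<omega>. (if \<forall>i\<le>k. B (\<tau> i) \<omega> \<in> C then 1 else 0) * (h (B (\<tau> (Suc k)) \<omega>) - h (B (\<tau> k) \<omega>)) \<partial>M)"
  proof (rule integral_cong_AE)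
    show "AE \<omega> in M. indicator A (?X \<omega>) * (h (S k (?X \<omega>) + D k \<omega>) - h (S k (?X \<omega>)))
      = (if \<forall>i\<le>k. B (\<tau> i) \<omega> \<in> C then 1 else 0) * (h (B (\<tau> (Suc k)) \<omega>) - h (B (\<tau> k) \<omega>))"
      using start
    proof eventually_elim
      case (elim \<omega>)
      have B: "S i (?X \<omega>) = B (\<tau> i) \<omega>" if "i \<le> k" for i
      proof -
        have "(\<Sum>j<i. ?X \<omega> j) = (\<Sum>j<i. B (\<tau> (Suc j)) \<omega> - B (\<tau> j) \<omega>)"
          using that by (intro sum.cong) (auto simp: D_def)
        also have "\<dots> = B (\<tau> i) \<omega> - B (\<tau> 0) \<omega>" by (rule sum_lessThan_telescope)
        finally show ?thesis using elim by (simp add: S_def \<tau>_def)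
      qed
      have "?X \<omega> \<in> A \<longleftrightarrow> (\<forall>i\<le>k. B (\<tau> i) \<omega> \<in> C)"
        using B by (auto simp: A_def space_PiM)
      moreover have "S k (?X \<omega>) + D k \<omega> = B (\<tau> (Suc k)) \<omega>"
        using B[of k] by (simp add: D_def)
      ultimately show ?case using B[of k] by (simp add: indicator_def)
    qed
  next
    note [measurable] = A Sk
    have [measurable]: "?X \<in> measurable M ?P" by measurable
    show "(\<lambda>\<omega>. indicator A (?X \<omega>) * (h (S k (?X \<omega>) + D k \<omega>) - h (S k (?X \<omega>)))) \<in> borel_measurable M"
      by measurable
  qed measurable
  ultimately show ?thesis by (simp add: \<tau>_def)
qed

text \<open>
  Each of the \<open>t 2\<^sup>m\<close> steps changes the expectation by the order of the square of the step length, so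
  the total error vanishes with the mesh.
\<close>
lemma grid_expectation:
  fixes h :: "complex \<Rightarrow> real"
  assumes [measurable]: "C \<in> sets borel" "h \<in> borel_measurable borel"
    and CK: "C \<subseteq> K" and h: "harmonic_upto_4 h K c" "0 \<le> c" and bd: "\<And>z. \<bar>h z\<bar> \<le> b"
  shows "\<bar>(\<integral>\<omega>. h (B (grid_time (\<lambda>s. B s \<omega>) C t m) \<omega>) \<partial>M) - h a\<bar> \<le> 8 * c * t * (1 / 2) ^ m"
proof -
  have [measurable]: "(\<lambda>\<omega>. B (real k / 2 ^ m) \<omega>) \<in> borel_measurable M" for k
    by (rule random_variable) simp
  have [measurable]: "(\<lambda>\<omega>. B (grid_time (\<lambda>s. B s \<omega>) C t m) \<omega>) \<in> borel_measurable M"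
    by (rule measurable_grid_time) measurable
  let ?\<kappa> = "\<lambda>\<omega>. grid_index (\<lambda>s. B s \<omega>) C t m"
  let ?d = "\<lambda>k \<omega>. (if \<forall>i\<le>k. B (real i / 2 ^ m) \<omega> \<in> C then 1 else 0) *
      (h (B (real (Suc k) / 2 ^ m) \<omega>) - h (B (real k / 2 ^ m) \<omega>))"
  have b0: "0 \<le> b" using bd[of 0] by linarith
  have id: "integrable M (?d k)" for k
  proof (rule integrable_const_bound[of _ "2 * b"])
    show "AE \<omega> in M. norm (?d k \<omega>) \<le> 2 * b"
    proof (rule AE_I2)
      fix \<omega>
      show "norm (?d k \<omega>) \<le> 2 * b"
        using bd[of "B (real (Suc k) / 2 ^ m) \<omega>"] bd[of "B (real k / 2 ^ m) \<omega>"] b0 by (auto simp: abs_mult)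
    qed
  qed measurable
  have ih: "integrable M (\<lambda>\<omega>. h (B (grid_time (\<lambda>s. B s \<omega>) C t m) \<omega>))"
    by (rule integrable_const_bound[of _ b]) (use bd in auto)
  have ae: "AE \<omega> in M. h (B (grid_time (\<lambda>s. B s \<omega>) C t m) \<omega>) - h a = (\<Sum>k < t * 2 ^ m. ?d k \<omega>)"
    using start
  proof eventually_elim
    case (elim \<omega>)
    show ?case
      using stopped_telescope[of "\<lambda>k. h (B (real k / 2 ^ m) \<omega>)" "\<lambda>s. B s \<omega>" C t m] elim
      by (simp add: grid_time_def)
  qed
  have "(\<integral>\<omega>. h (B (grid_time (\<lambda>s. B s \<omega>) C t m) \<omega>) \<partial>M) - h a
      = (\<integral>\<omega>. h (B (grid_time (\<lambda>s. B s \<omega>) C t m) \<omega>) - h a \<partial>M)"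
    using ih prob_space by simp
  also have "\<dots> = (\<integral>\<omega>. (\<Sum>k < t * 2 ^ m. ?d k \<omega>) \<partial>M)"
    by (rule integral_cong_AE) (use ae in \<open>measurable\<close>)
  also have "\<dots> = (\<Sum>k < t * 2 ^ m. \<integral>\<omega>. ?d k \<omega> \<partial>M)"
    by (rule Bochner_Integration.integral_sum) (rule id)
  finally have eq: "(\<integral>\<omega>. h (B (grid_time (\<lambda>s. B s \<omega>) C t m) \<omega>) \<partial>M) - h a
      = (\<Sum>k < t * 2 ^ m. \<integral>\<omega>. ?d k \<omega> \<partial>M)" .
  have "\<bar>\<Sum>k < t * 2 ^ m. \<integral>\<omega>. ?d k \<omega> \<partial>M\<bar> \<le> (\<Sum>k < t * 2 ^ m. 8 * c * (1 / 2 ^ m)\<^sup>2)"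
    by (rule order_trans[OF sum_abs]) (rule sum_mono, rule step_expectation_bound[OF assms])
  also have "\<dots> = 8 * c * t * (1 / 2) ^ m"
    by (simp add: power2_eq_square field_simps power_divide)
  finally show ?thesis unfolding eq .
qed

end

section \<open>Optional stopping at the exit from a bounded open set\<close>

text \<open>The sets are bounded away from the complement by \<open>1 / (n + 1)\<close>.\<close>
lemma open_exhaustion:
  fixes U :: "complex set"
  assumes "open U" "U \<noteq> UNIV"
  obtains C :: "nat \<Rightarrow> complex set" where "\<And>n. closed (C n)" "\<And>n. C n \<subseteq> interior (C (Suc n))" "(\<Union>n. C n) = U"
proof
  let ?d = "\<lambda>z. infdist z (- U)"
  let ?C = "\<lambda>n. {z. 1 / real (Suc n) \<le> ?d z}"
  show "closed (?C n)" for n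
    by (intro closed_Collect_le continuous_intros)
  show "?C n \<subseteq> interior (?C (Suc n))" for n
  proof (rule order_trans)
    show "{z. 1 / real (Suc (Suc n)) < ?d z} \<subseteq> interior (?C (Suc n))"
      by (rule interior_maximal) (auto intro!: open_Collect_less continuous_intros)
    have "1 / real (Suc (Suc n)) < 1 / real (Suc n)" by (simp add: field_simps)
    then show "?C n \<subseteq> {z. 1 / real (Suc (Suc n)) < ?d z}" by force
  qed
  have 1: "z \<in> U \<longleftrightarrow> 0 < ?d z" for z
    using in_closed_iff_infdist_zero[of "-U" z] assms infdist_nonneg[of z "-U"] by force
  have 2: "0 < ?d z \<longleftrightarrow> (\<exists>n. 1 / real (Suc n) \<le> ?d z)" for z
  proof
    assume "0 < ?d z"
    then obtain n where "inverse (real (Suc n)) < ?d z" using reals_Archimedean by blast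
    then show "\<exists>n. 1 / real (Suc n) \<le> ?d z" by (auto simp: inverse_eq_divide intro!: exI[of _ n])
  next
    assume "\<exists>n. 1 / real (Suc n) \<le> ?d z"
    then obtain n where "1 / real (Suc n) \<le> ?d z" by blast
    moreover have "0 < 1 / real (Suc n)" by simp
    ultimately show "0 < ?d z" by linarith
  qed
  show "(\<Union>n. ?C n) = U"
    unfolding set_eq_iff UN_iff mem_Collect_eq 1 2 by simp
qed

lemma harmonic_upto_4_isCont:
  assumes "harmonic_upto_4 h S C" "z \<in> S"
  shows "isCont h z"
proof -
  obtain c1 c2 c3 where c: "\<And>g. \<bar>h (z + g) - h z - Re (c1 * g + c2 * g\<^sup>2 + c3 * g ^ 3)\<bar> \<le> C * norm g ^ 4"
    using assms unfolding harmonic_upto_4_def by metis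
  have "((\<lambda>g. h (z + g) - h z - Re (c1 * g + c2 * g\<^sup>2 + c3 * g ^ 3)) \<longlongrightarrow> 0) (at 0)"
  proof (rule Lim_null_comparison)
    show "\<forall>\<^sub>F g in at 0. norm (h (z + g) - h z - Re (c1 * g + c2 * g\<^sup>2 + c3 * g ^ 3)) \<le> C * norm g ^ 4"
      using c by simp
    show "((\<lambda>g::complex. C * norm g ^ 4) \<longlongrightarrow> 0) (at 0)"
      by (auto intro!: tendsto_eq_intros)
  qed
  moreover have "((\<lambda>g. h z + Re (c1 * g + c2 * g\<^sup>2 + c3 * g ^ 3)) \<longlongrightarrow> h z) (at 0)"
    by (auto intro!: tendsto_eq_intros)
  ultimately have "((\<lambda>g. h (z + g)) \<longlongrightarrow> h z) (at 0)"
    using tendsto_add[of "\<lambda>g. h (z + g) - h z - Re (c1 * g + c2 * g\<^sup>2 + c3 * g ^ 3)" 0 "at 0"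
        "\<lambda>g. h z + Re (c1 * g + c2 * g\<^sup>2 + c3 * g ^ 3)" "h z"] by simp
  then show ?thesis by (simp add: isCont_iff)
qed

lemma gauss_le: "0 < \<delta> \<Longrightarrow> gauss \<delta> z \<le> 1 / (2 * pi * \<delta>)"
proof -
  assume \<delta>: "0 < \<delta>"
  have n: "normal_density 0 (sqrt \<delta>) x \<le> 1 / sqrt (2 * pi * \<delta>)" for x
    using \<delta> by (simp add: normal_density_def divide_simps)
  have "gauss \<delta> z \<le> 1 / sqrt (2 * pi * \<delta>) * (1 / sqrt (2 * pi * \<delta>))"
    unfolding gauss_def by (intro mult_mono n) (use \<delta> in auto)
  also have "\<dots> = 1 / (2 * pi * \<delta>)" using \<delta> by simp
  finally show ?thesis .
qed

context planar_brownian_motion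
begin

text \<open>The Gaussian density of \<open>B\<^sub>t\<close> is at most \<open>1 / (2 \<pi> t)\<close>, so that staying in a bounded set up to
  time \<open>t\<close> has a probability that tends to \<open>0\<close>.\<close>
lemma exit_time_finite:
  assumes U: "bounded U"
  shows "AE \<omega> in M. exit_time B U \<omega> < \<infinity>"
proof -
  obtain R where R: "U \<subseteq> cball a R" using U bounded_any_center[of U a] by (auto simp: subset_eq)
  let ?S = "cball 0 R :: complex set"
  define V where "V = emeasure lborel ?S"
  have V: "V < \<infinity>" unfolding V_def by (rule emeasure_lborel_cball_finite)
  define N where "N = {\<omega> \<in> space M. \<forall>n::nat. B (real (Suc n)) \<omega> - B 0 \<omega> \<in> ?S}"
  have [measurable]: "B (real n) \<in> borel_measurable M" "B 0 \<in> borel_measurable M" for n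
    by (auto intro: random_variable)
  have [measurable]: "?S \<in> sets borel" by simp
  have N: "N \<in> sets M" unfolding N_def by measurable
  have "emeasure M N \<le> ennreal (1 / (2 * pi * real (Suc n))) * V" for n
  proof -
    have d: "distributed M lborel (\<lambda>\<omega>. B (real (Suc n)) \<omega> - B 0 \<omega>) (\<lambda>z. ennreal (gauss (real (Suc n)) z))"
      using normal_increments[of 0 "real (Suc n)"] by (simp add: gauss_def)
    have "emeasure M N \<le> emeasure M ((\<lambda>\<omega>. B (real (Suc n)) \<omega> - B 0 \<omega>) -` ?S \<inter> space M)"
    proof (rule emeasure_mono)
      have [measurable]: "B (real (Suc n)) \<in> borel_measurable M" by (rule random_variable) simp
      show "(\<lambda>\<omega>. B (real (Suc n)) \<omega> - B 0 \<omega>) -` ?S \<inter> space M \<in> sets M" by measurable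
    qed (auto simp: N_def)
    also have "\<dots> = (\<integral>\<^sup>+z. ennreal (gauss (real (Suc n)) z) * indicator ?S z \<partial>lborel)"
      by (rule distributed_emeasure[OF d]) simp
    also have "\<dots> \<le> (\<integral>\<^sup>+z. ennreal (1 / (2 * pi * real (Suc n))) * indicator ?S z \<partial>lborel)"
      by (intro nn_integral_mono mult_right_mono ennreal_leI gauss_le) auto
    also have "\<dots> = ennreal (1 / (2 * pi * real (Suc n))) * V"
      unfolding V_def by (rule nn_integral_cmult_indicator) simp
    finally show ?thesis .
  qed
  moreover have "(\<lambda>n. ennreal (1 / (2 * pi * real (Suc n))) * V) \<longlonglongrightarrow> ennreal 0 * V"
  proof (rule tendsto_mult_ennreal)
    have "(\<lambda>n. 1 / (2 * pi) / real (Suc n)) \<longlonglongrightarrow> 0"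
      by (rule LIMSEQ_Suc[OF lim_const_over_n])
    then show "(\<lambda>n. ennreal (1 / (2 * pi * real (Suc n)))) \<longlonglongrightarrow> ennreal 0"
      by (intro tendsto_ennrealI) (simp only: divide_divide_eq_left)
  qed (use V in auto)
  ultimately have "emeasure M N \<le> ennreal 0 * V"
    by (intro LIMSEQ_le_const[of _ _ "emeasure M N"]) auto
  then have null: "N \<in> null_sets M" using N by (simp add: null_sets_def)
  show ?thesis
    using AE_not_in[OF null] start AE_space
  proof eventually_elim
    case (elim \<omega>)
    then obtain n where "B (real (Suc n)) \<omega> - B 0 \<omega> \<notin> ?S" by (auto simp: N_def)
    then have "B (real (Suc n)) \<omega> \<notin> cball a R" using elim by (simp add: dist_norm norm_minus_commute)
    then have "exit_time B U \<omega> \<le> ennreal (real (Suc n))"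
      using R by (intro exit_time_le) auto
    also have "\<dots> < \<infinity>" by simp
    finally show ?case .
  qed
qed

context
  fixes U :: "complex set" and C :: "nat \<Rightarrow> complex set"
  assumes C: "\<And>n. closed (C n)" "\<And>n. C n \<subseteq> interior (C (Suc n))" "(\<Union>n. C n) = U"
begin

text \<open>Three successive limits: \<open>m\<close> refines the grid, \<open>n\<close> exhausts \<open>U\<close>, and \<open>t\<close> is the time horizon.\<close>
private definition X where "X t n m \<omega> = B (grid_time (\<lambda>s. B s \<omega>) (C n) t m) \<omega>"
private definition Y where "Y t n \<omega> = lim (\<lambda>m. X t n m \<omega>)"
private definition Z where "Z t \<omega> = lim (\<lambda>n. Y t n \<omega>)"

private lemma measurable_XYZ [measurable]:
  "X t n m \<in> borel_measurable M" "Y t n \<in> borel_measurable M" "Z t \<in> borel_measurable M"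
proof -
  show X: "X t n m \<in> borel_measurable M" for t n m
    unfolding X_def[abs_def] using C(1) by (intro measurable_grid_time) auto
  show Y: "Y t n \<in> borel_measurable M" for t n
    unfolding Y_def[abs_def] by (rule borel_measurable_lim_metric) (rule X)
  show "Z t \<in> borel_measurable M" for t
    unfolding Z_def[abs_def] by (rule borel_measurable_lim_metric) (rule Y)
qed

private lemma limits:
  assumes \<omega>: "\<omega> \<in> space M"
  shows "(\<lambda>m. X t n m \<omega>) \<longlonglongrightarrow> Y t n \<omega>" "(\<lambda>n. Y t n \<omega>) \<longlonglongrightarrow> Z t \<omega>"
    "exit_time B U \<omega> < \<infinity> \<Longrightarrow> \<forall>\<^sub>F t in sequentially. Z t \<omega> = exit_point B U \<omega>"
    "Z t \<omega> \<notin> U \<Longrightarrow> exit_time B U \<omega> < \<infinity>"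
    "B 0 \<omega> \<in> U \<Longrightarrow> Y t n \<omega> \<in> closure U" "B 0 \<omega> \<in> U \<Longrightarrow> Z t \<omega> \<in> closure U"
proof -
  note w = continuous_paths[OF \<omega>]
  have "\<exists>\<sigma>. grid_time (\<lambda>s. B s \<omega>) (C n) t \<longlonglongrightarrow> \<sigma> \<and> 0 \<le> \<sigma> \<and>
      (\<forall>s. 0 \<le> s \<longrightarrow> s < \<sigma> \<longrightarrow> B s \<omega> \<in> C n) \<and> (\<lambda>m. X t n m \<omega>) \<longlonglongrightarrow> B \<sigma> \<omega>" for t n
    unfolding X_def by (rule grid_time_limit[OF w C(1), of n t]) blast
  then have "\<exists>\<sigma>. \<forall>t n. grid_time (\<lambda>s. B s \<omega>) (C n) t \<longlonglongrightarrow> \<sigma> t n \<and> 0 \<le> \<sigma> t n \<and>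
      (\<forall>s. 0 \<le> s \<longrightarrow> s < \<sigma> t n \<longrightarrow> B s \<omega> \<in> C n) \<and> (\<lambda>m. X t n m \<omega>) \<longlonglongrightarrow> B (\<sigma> t n) \<omega>"
    by (intro choice allI)
  then obtain \<sigma> where \<sigma>: "\<And>t n. grid_time (\<lambda>s. B s \<omega>) (C n) t \<longlonglongrightarrow> \<sigma> t n" "\<And>t n. 0 \<le> \<sigma> t n"
      "\<And>t n s. 0 \<le> s \<Longrightarrow> s < \<sigma> t n \<Longrightarrow> B s \<omega> \<in> C n" "\<And>t n. (\<lambda>m. X t n m \<omega>) \<longlonglongrightarrow> B (\<sigma> t n) \<omega>"
    by blast
  have Y: "Y t n \<omega> = B (\<sigma> t n) \<omega>" for t n
    unfolding Y_def by (rule limI) (rule \<sigma>)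
  have "\<exists>\<tau>. (\<lambda>n. B (\<sigma> t n) \<omega>) \<longlonglongrightarrow> B \<tau> \<omega> \<and> 0 \<le> \<tau> \<and> ennreal \<tau> = min (ennreal (real t)) (exit_time B U \<omega>)" for t
    using exit_time_exhaustion[where B=B, OF w C \<sigma>(1), of t] by blast
  then have "\<exists>\<tau>. \<forall>t. (\<lambda>n. B (\<sigma> t n) \<omega>) \<longlonglongrightarrow> B (\<tau> t) \<omega> \<and> 0 \<le> \<tau> t \<and>
      ennreal (\<tau> t) = min (ennreal (real t)) (exit_time B U \<omega>)"
    by (intro choice allI)
  then obtain \<tau> where \<tau>: "\<And>t. (\<lambda>n. B (\<sigma> t n) \<omega>) \<longlonglongrightarrow> B (\<tau> t) \<omega>" "\<And>t. 0 \<le> \<tau> t"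
      "\<And>t. ennreal (\<tau> t) = min (ennreal (real t)) (exit_time B U \<omega>)"
    by blast
  have Z: "Z t \<omega> = B (\<tau> t) \<omega>" for t
    unfolding Z_def Y by (rule limI) (rule \<tau>)
  show "(\<lambda>m. X t n m \<omega>) \<longlonglongrightarrow> Y t n \<omega>" unfolding Y by (rule \<sigma>)
  show "(\<lambda>n. Y t n \<omega>) \<longlonglongrightarrow> Z t \<omega>" unfolding Y Z by (rule \<tau>)
  show "\<forall>\<^sub>F t in sequentially. Z t \<omega> = exit_point B U \<omega>" if "exit_time B U \<omega> < \<infinity>"
    unfolding Z by (rule exit_point_eventually[OF that]) (use \<tau> in auto)
  show "exit_time B U \<omega> < \<infinity>" if "Z t \<omega> \<notin> U"
    using exit_time_le[of "\<tau> t" B \<omega> U] that \<tau>(2) unfolding Z by (auto intro: le_less_trans)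
  show "Y t n \<omega> \<in> closure U" if "B 0 \<omega> \<in> U"
    unfolding Y by (rule path_in_closure[of "\<lambda>s. B s \<omega>", OF w \<sigma>(2) that]) (use \<sigma>(3) C(3) in blast)
  show "Z t \<omega> \<in> closure U" if "B 0 \<omega> \<in> U"
    unfolding Z
  proof (rule path_in_closure[of "\<lambda>s. B s \<omega>", OF w \<tau>(2) that])
    fix s assume s: "0 \<le> s" "s < \<tau> t"
    then have "ennreal s < ennreal (\<tau> t)" by (auto simp: ennreal_lessI)
    then have "ennreal s < exit_time B U \<omega>" unfolding \<tau>(3) by simp
    then show "B s \<omega> \<in> U" using s by (intro before_exit_time)
  qed
qed

private lemma measurable_exit_point_aux: "exit_point B U \<in> borel_measurable M"
proof -
  have "open U"
  proof -
    have "U = (\<Union>n. interior (C n))" using C(2,3) interior_subset by blast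
    then show ?thesis by auto
  qed
  then have [measurable]: "U \<in> sets borel" by simp
  have [measurable]: "B 0 \<in> borel_measurable M" by (rule random_variable) simp
  have "exit_point B U \<omega> = (if \<exists>t. Z t \<omega> \<notin> U then lim (\<lambda>t. Z t \<omega>) else B 0 \<omega>)" if \<omega>: "\<omega> \<in> space M" for \<omega>
  proof (cases "exit_time B U \<omega> < \<infinity>")
    case True
    note ev = limits(3)[OF \<omega> True]
    have "exit_point B U \<omega> \<notin> U" by (rule exit_point_notin[where B=B, OF continuous_paths[OF \<omega>] \<open>open U\<close> True])
    moreover obtain t where "Z t \<omega> = exit_point B U \<omega>"
      using ev by (auto simp: eventually_sequentially)
    ultimately have "\<exists>t. Z t \<omega> \<notin> U" by metis
    moreover have "lim (\<lambda>t. Z t \<omega>) = exit_point B U \<omega>"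
      by (rule limI) (rule tendsto_eventually[OF ev])
    ultimately show ?thesis by simp
  next
    case False
    then show ?thesis using limits(4)[OF \<omega>] by (auto simp: exit_point_def less_top[symmetric])
  qed
  moreover have "(\<lambda>\<omega>. if \<exists>t. Z t \<omega> \<notin> U then lim (\<lambda>t. Z t \<omega>) else B 0 \<omega>) \<in> borel_measurable M"
    by (intro measurable_If borel_measurable_lim_metric) measurable
  ultimately show ?thesis by (subst measurable_cong)
qed

private lemma optional_stopping_aux:
  fixes h :: "complex \<Rightarrow> real"
  assumes U: "bounded U" "a \<in> U" and [measurable]: "h \<in> borel_measurable borel"
    and h: "harmonic_upto_4 h (closure U) c" "0 \<le> c" and bd: "\<And>z. \<bar>h z\<bar> \<le> b"
  shows "(\<integral>\<omega>. h (exit_point B U \<omega>) \<partial>M) = h a"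
proof -
  have [measurable]: "exit_point B U \<in> borel_measurable M" by (rule measurable_exit_point_aux)
  have cont: "(\<lambda>n. h (u n)) \<longlonglongrightarrow> h z" if "u \<longlonglongrightarrow> z" "z \<in> closure U" for u z
    using isCont_tendsto_compose[OF harmonic_upto_4_isCont[OF h(1) that(2)] that(1)] .
  have lim: "(\<lambda>n. \<integral>\<omega>. h (F n \<omega>) \<partial>M) \<longlonglongrightarrow> (\<integral>\<omega>. h (G \<omega>) \<partial>M)"
    if [measurable]: "\<And>n. F n \<in> borel_measurable M" "G \<in> borel_measurable M"
      and "AE \<omega> in M. (\<lambda>n. h (F n \<omega>)) \<longlonglongrightarrow> h (G \<omega>)" for F G
    by (rule integral_dominated_convergence[where w="\<lambda>_. b"]) (use that(3) bd in auto)
  have 0: "AE \<omega> in M. B 0 \<omega> \<in> U" using start by eventually_elim (use U in simp)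
  have Y: "(\<integral>\<omega>. h (Y t n \<omega>) \<partial>M) = h a" for t n
  proof (rule LIMSEQ_unique)
    show "(\<lambda>m. \<integral>\<omega>. h (X t n m \<omega>) \<partial>M) \<longlonglongrightarrow> (\<integral>\<omega>. h (Y t n \<omega>) \<partial>M)"
    proof (rule lim)
      show "AE \<omega> in M. (\<lambda>m. h (X t n m \<omega>)) \<longlonglongrightarrow> h (Y t n \<omega>)"
        using 0 AE_space by eventually_elim (rule cont[OF limits(1) limits(5)])
    qed measurable
    have "C n \<subseteq> U" unfolding C(3)[symmetric] by (rule UN_upper) simp
    then have sub: "C n \<subseteq> closure U" by (rule order_trans[OF _ closure_subset])
    have "(\<lambda>m. (\<integral>\<omega>. h (X t n m \<omega>) \<partial>M) - h a) \<longlonglongrightarrow> 0"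
    proof (rule Lim_null_comparison)
      show "\<forall>\<^sub>F m in sequentially. norm ((\<integral>\<omega>. h (X t n m \<omega>) \<partial>M) - h a) \<le> 8 * c * t * (1 / 2) ^ m"
        unfolding X_def real_norm_def
        by (rule always_eventually, rule allI, rule grid_expectation[OF _ _ sub h bd]) (simp_all add: C(1) borel_closed assms(3))
      show "(\<lambda>m. 8 * c * t * (1 / 2) ^ m) \<longlonglongrightarrow> 0"
        by (rule tendsto_mult_right_zero, rule LIMSEQ_realpow_zero) auto
    qed
    then show "(\<lambda>m. \<integral>\<omega>. h (X t n m \<omega>) \<partial>M) \<longlonglongrightarrow> h a" by (simp add: LIM_zero_iff)
  qed
  have Z: "(\<integral>\<omega>. h (Z t \<omega>) \<partial>M) = h a" for t
  proof (rule LIMSEQ_unique)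
    show "(\<lambda>n. \<integral>\<omega>. h (Y t n \<omega>) \<partial>M) \<longlonglongrightarrow> (\<integral>\<omega>. h (Z t \<omega>) \<partial>M)"
    proof (rule lim)
      show "AE \<omega> in M. (\<lambda>n. h (Y t n \<omega>)) \<longlonglongrightarrow> h (Z t \<omega>)"
        using 0 AE_space by eventually_elim (rule cont[OF limits(2) limits(6)])
    qed measurable
  qed (simp add: Y)
  show ?thesis
  proof (rule LIMSEQ_unique)
    show "(\<lambda>t. \<integral>\<omega>. h (Z t \<omega>) \<partial>M) \<longlonglongrightarrow> (\<integral>\<omega>. h (exit_point B U \<omega>) \<partial>M)"
    proof (rule lim)
      show "AE \<omega> in M. (\<lambda>t. h (Z t \<omega>)) \<longlonglongrightarrow> h (exit_point B U \<omega>)"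
        using exit_time_finite[OF U(1)] AE_space
      proof eventually_elim
        case (elim \<omega>)
        show ?case
          by (rule tendsto_eventually) (use limits(3)[OF elim(2,1)] in \<open>eventually_elim, simp\<close>)
      qed
    qed measurable
  qed (simp add: Z)
qed

lemmas exit_from_exhausted = measurable_exit_point_aux optional_stopping_aux

end

lemma measurable_exit_point:
  assumes "open U" "U \<noteq> UNIV"
  shows "exit_point B U \<in> borel_measurable M"
proof -
  obtain C :: "nat \<Rightarrow> complex set"
    where C: "\<And>n. closed (C n)" "\<And>n. C n \<subseteq> interior (C (Suc n))" "(\<Union>n. C n) = U"
    by (rule open_exhaustion[OF assms]) (rule that, assumption+)
  show ?thesis by (rule exit_from_exhausted(1)[of C U, OF C])
qed

text \<open>The approximate identity for grid times passes through the three limits by dominated convergence.\<close>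
lemma optional_stopping:
  fixes h :: "complex \<Rightarrow> real"
  assumes U: "open U" "bounded U" "a \<in> U" and "h \<in> borel_measurable borel"
    and "harmonic_upto_4 h (closure U) c" "0 \<le> c" and "\<And>z. \<bar>h z\<bar> \<le> b"
  shows "(\<integral>\<omega>. h (exit_point B U \<omega>) \<partial>M) = h a"
proof -
  have "U \<noteq> UNIV" using U(2) not_bounded_UNIV[where 'a=complex] by metis
  with U(1) obtain C :: "nat \<Rightarrow> complex set"
    where C: "\<And>n. closed (C n)" "\<And>n. C n \<subseteq> interior (C (Suc n))" "(\<Union>n. C n) = U"
    by (rule open_exhaustion) (rule that, assumption+)
  show ?thesis by (rule exit_from_exhausted(2)[of C U h c b, OF C assms(2-)])
qed

lemma exit_point_AE_frontier:
  assumes U: "open U" "bounded U" "a \<in> U"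
  shows "AE \<omega> in M. exit_point B U \<omega> \<in> frontier U"
  using exit_time_finite[OF U(2)] start AE_space
proof eventually_elim
  case (elim \<omega>)
  have "B 0 \<omega> \<in> U" using elim(2) U(3) by simp
  then show ?case
    by (rule exit_point_in_frontier[where B=B, OF continuous_paths[OF elim(3)] U(1) elim(1)])
qed

end

section \<open>Harmonic test functions on the annulus\<close>

lemma cubic_taylor:
  assumes f: "f holomorphic_on ball 0 1"
  shows "\<exists>c1 c2 c3 D. 0 \<le> D \<and>
    (\<forall>\<zeta>. norm \<zeta> \<le> 1 / 2 \<longrightarrow> norm (f \<zeta> - f 0 - (c1 * \<zeta> + c2 * \<zeta>\<^sup>2 + c3 * \<zeta> ^ 3)) \<le> D * norm \<zeta> ^ 4)"
proof -
  let ?S = "cball (0::complex) (1 / 2)"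
  define d where "d i = (deriv ^^ i) f" for i
  have hol: "d i holomorphic_on ball 0 1" for i
    unfolding d_def by (rule holomorphic_higher_deriv[OF f]) simp
  have sub: "?S \<subseteq> ball 0 1" by auto
  have der: "(d i has_field_derivative d (Suc i) x) (at x within ?S)" if "x \<in> ?S" for i x
    using holomorphic_derivI[OF hol[of i] open_ball, of x ?S] that sub
    by (auto simp: d_def intro: DERIV_subset)
  have "compact (d 4 ` ?S)"
    by (intro compact_continuous_image holomorphic_on_imp_continuous_on holomorphic_on_subset[OF hol sub]) simp
  then obtain D where D: "\<And>x. x \<in> ?S \<Longrightarrow> norm (d 4 x) \<le> D"
    using compact_imp_bounded bounded_iff by (metis imageI)
  have D0: "0 \<le> D" using order_trans[OF norm_ge_zero D[of 0]] by simp
  have "norm (f \<zeta> - f 0 - (d 1 0 * \<zeta> + d 2 0 / 2 * \<zeta>\<^sup>2 + d 3 0 / 6 * \<zeta> ^ 3)) \<le> D * norm \<zeta> ^ 4"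
    if "norm \<zeta> \<le> 1 / 2" for \<zeta>
  proof -
    have "norm (d 0 \<zeta> - (\<Sum>i\<le>3. d i 0 * (\<zeta> - 0) ^ i / fact i)) \<le> D * norm (\<zeta> - 0) ^ Suc 3 / fact 3"
      by (rule complex_Taylor[of ?S 3 d]) (use der D that in auto)
    also have "(\<Sum>i\<le>3. d i 0 * (\<zeta> - 0) ^ i / fact i) = f 0 + (d 1 0 * \<zeta> + d 2 0 / 2 * \<zeta>\<^sup>2 + d 3 0 / 6 * \<zeta> ^ 3)"
      by (simp add: numeral_eq_Suc d_def fact_Suc)
    also have "D * norm (\<zeta> - 0) ^ Suc 3 / fact 3 \<le> D * norm \<zeta> ^ 4"
    proof -
      have "0 \<le> D * norm \<zeta> ^ 4" using D0 by simp
      then show ?thesis by (simp add: fact_numeral)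
    qed
    finally show ?thesis by (simp add: d_def algebra_simps)
  qed
  then show ?thesis using D0 by blast
qed

text \<open>Powers and logarithm are unbounded near the origin or at infinity, so they are set to \<open>0\<close> outside a
  somewhat larger annulus.\<close>
definition cutoff :: "real \<Rightarrow> (complex \<Rightarrow> real) \<Rightarrow> complex \<Rightarrow> real" where
  "cutoff r h z = (if exp (- r) / 2 \<le> norm z \<and> norm z \<le> 2 * exp r then h z else 0)"

text \<open>
  Writing increments as multiples \<open>g = \<zeta> z\<close> of the point turns the Taylor expansions of powers and
  logarithm at all points into a single one, whence the uniform constant.
\<close>
lemma cutoff_harmonic_upto_4:
  fixes h :: "complex \<Rightarrow> real" and A f :: "complex \<Rightarrow> complex"
  assumes h: "continuous_on (- {0}) h" and A: "continuous_on (- {0}) A"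
    and f: "f holomorphic_on ball 0 1"
    and eq: "\<And>z \<zeta>. z \<noteq> 0 \<Longrightarrow> norm \<zeta> \<le> 1 / 2 \<Longrightarrow> h (z * (1 + \<zeta>)) = h z + Re (A z * (f \<zeta> - f 0))"
  shows "\<exists>C b. 0 \<le> C \<and> harmonic_upto_4 (cutoff r h) {z. exp (- r) \<le> norm z \<and> norm z \<le> exp r} C \<and>
    (\<forall>z. \<bar>cutoff r h z\<bar> \<le> b)"
proof -
  let ?K = "{z::complex. exp (- r) \<le> norm z \<and> norm z \<le> exp r}"
  let ?L = "{z::complex. exp (- r) / 2 \<le> norm z \<and> norm z \<le> 2 * exp r}"
  have bd: "\<exists>b\<ge>0. \<forall>z\<in>S. norm (q z) \<le> b"
    if q: "continuous_on (- {0}) q" and S: "closed S" "0 \<notin> S" "bounded S"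
    for q :: "complex \<Rightarrow> 'b :: real_normed_vector" and S
  proof -
    have "compact (q ` S)"
      using S by (intro compact_continuous_image continuous_on_subset[OF q]) (auto simp: compact_eq_bounded_closed)
    then show ?thesis using compact_imp_bounded bounded_pos[of "q ` S"] by (auto intro: less_imp_le)
  qed
  have "closed ?K" "closed ?L"
    by (intro closed_Collect_conj closed_Collect_le continuous_intros)+
  moreover have "bounded ?K" "bounded ?L" by (auto intro: boundedI)
  ultimately obtain b M where b: "0 \<le> b" "\<And>z. z \<in> ?L \<Longrightarrow> \<bar>h z\<bar> \<le> b"
    and M: "0 \<le> M" "\<And>z. z \<in> ?K \<Longrightarrow> norm (A z) \<le> M"
    using bd[OF h, of ?L] bd[OF A, of ?K] by auto
  have cb: "\<bar>cutoff r h z\<bar> \<le> b" for z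
    using b by (simp add: cutoff_def)
  obtain c1 c2 c3 D where D: "0 \<le> D"
    "\<And>\<zeta>. norm \<zeta> \<le> 1 / 2 \<Longrightarrow> norm (f \<zeta> - f 0 - (c1 * \<zeta> + c2 * \<zeta>\<^sup>2 + c3 * \<zeta> ^ 3)) \<le> D * norm \<zeta> ^ 4"
    using cubic_taylor[OF f] by blast
  let ?P = "\<lambda>\<zeta>. c1 * \<zeta> + c2 * \<zeta>\<^sup>2 + c3 * \<zeta> ^ 3"
  define E where "E = M * D + (32 * b + M * (8 * norm c1 + 4 * norm c2 + 2 * norm c3))"
  have E0: "0 \<le> E" using M(1) D(1) b(1) by (simp add: E_def)
  have main: "\<bar>cutoff r h (z + g) - cutoff r h z - Re (A z / z * c1 * g + A z / z\<^sup>2 * c2 * g\<^sup>2 + A z / z ^ 3 * c3 * g ^ 3)\<bar>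
      \<le> E * exp r ^ 4 * norm g ^ 4" if z: "z \<in> ?K" for z g
  proof -
    have z0: "z \<noteq> 0" using z by auto
    define \<zeta> where "\<zeta> = g / z"
    have g: "g = z * \<zeta>" using z0 by (simp add: \<zeta>_def)
    have zg: "z + g = z * (1 + \<zeta>)" by (simp add: g algebra_simps)
    have P: "A z / z * c1 * g + A z / z\<^sup>2 * c2 * g\<^sup>2 + A z / z ^ 3 * c3 * g ^ 3 = A z * ?P \<zeta>"
      using z0 by (simp add: g power_mult_distrib algebra_simps)
    have hz: "cutoff r h z = h z"
    proof -
      have "exp (- r) / 2 \<le> exp (- r)" "exp r \<le> 2 * exp r" by auto
      then show ?thesis using z by (auto simp: cutoff_def intro: order_trans)
    qed
    \<comment> \<open>For \<open>\<bar>\<zeta>\<bar> \<le> 1/2\<close> the point \<open>z + g\<close> stays where nothing is cut off; for larger \<open>\<zeta>\<close> each lower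
      power is dominated by \<open>(2 \<bar>\<zeta>\<bar>)\<^sup>4\<close>.\<close>
    have "\<bar>cutoff r h (z + g) - cutoff r h z - Re (A z * ?P \<zeta>)\<bar> \<le> E * norm \<zeta> ^ 4"
    proof (cases "norm \<zeta> \<le> 1 / 2")
      case True
      have "norm (1 + \<zeta>) \<le> 3 / 2" using norm_triangle_ineq[of 1 \<zeta>] True by simp
      moreover have "1 / 2 \<le> norm (1 + \<zeta>)" using norm_triangle_ineq2[of 1 "- \<zeta>"] True by simp
      ultimately have "norm z * (1 / 2) \<le> norm (z + g)" "norm (z + g) \<le> norm z * (3 / 2)"
        unfolding zg norm_mult by (intro mult_left_mono; simp)+
      then have "exp (- r) / 2 \<le> norm (z + g)" "norm (z + g) \<le> 2 * exp r"
        using z exp_gt_zero[of r] by auto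
      then have "cutoff r h (z + g) = h z + Re (A z * (f \<zeta> - f 0))"
        using eq[OF z0 True] by (simp add: cutoff_def zg)
      then have "cutoff r h (z + g) - cutoff r h z - Re (A z * ?P \<zeta>) = Re (A z * (f \<zeta> - f 0 - ?P \<zeta>))"
        unfolding hz by (simp add: algebra_simps)
      also have "\<bar>\<dots>\<bar> \<le> norm (A z * (f \<zeta> - f 0 - ?P \<zeta>))" by (rule abs_Re_le_cmod)
      also have "norm (A z * (f \<zeta> - f 0 - ?P \<zeta>)) \<le> M * (D * norm \<zeta> ^ 4)"
        unfolding norm_mult by (intro mult_mono M z D(2)[OF True]) auto
      also have "M * (D * norm \<zeta> ^ 4) \<le> E * norm \<zeta> ^ 4"
        unfolding E_def mult.assoc[symmetric]
        by (intro mult_right_mono) (use M(1) b(1) in auto)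
      finally show ?thesis .
    next
      case False
      define n where "n = 2 * norm \<zeta>"
      have n1: "1 \<le> n" using False by (simp add: n_def)
      have pw: "n ^ i \<le> n ^ 4" if "i \<le> 4" for i using n1 that by (intro power_increasing) auto
      have "norm (?P \<zeta>) \<le> norm (c1 * \<zeta>) + norm (c2 * \<zeta>\<^sup>2) + norm (c3 * \<zeta> ^ 3)"
        by (intro order_trans[OF norm_triangle_ineq] add_mono norm_triangle_ineq order_refl)
      also have "\<dots> = norm c1 / 2 * n ^ 1 + norm c2 / 4 * n ^ 2 + norm c3 / 8 * n ^ 3"
        by (simp add: n_def norm_mult norm_power power_mult_distrib)
      also have "\<dots> \<le> norm c1 / 2 * n ^ 4 + norm c2 / 4 * n ^ 4 + norm c3 / 8 * n ^ 4"
        by (intro add_mono mult_left_mono pw) auto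
      finally have P4: "norm (?P \<zeta>) \<le> (8 * norm c1 + 4 * norm c2 + 2 * norm c3) * norm \<zeta> ^ 4"
        by (simp add: n_def power_mult_distrib algebra_simps)
      have "\<bar>Re (A z * ?P \<zeta>)\<bar> \<le> norm (A z) * norm (?P \<zeta>)"
        using abs_Re_le_cmod[of "A z * ?P \<zeta>"] by (simp only: norm_mult)
      also have "\<dots> \<le> M * ((8 * norm c1 + 4 * norm c2 + 2 * norm c3) * norm \<zeta> ^ 4)"
        by (intro mult_mono M z P4) auto
      finally have 1: "\<bar>Re (A z * ?P \<zeta>)\<bar> \<le> M * (8 * norm c1 + 4 * norm c2 + 2 * norm c3) * norm \<zeta> ^ 4"
        by (simp add: mult_ac)
      have "2 * b * 1 \<le> 2 * b * n ^ 4"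
        using pw[of 0] b(1) by (intro mult_left_mono) auto
      then have 2: "2 * b \<le> 32 * b * norm \<zeta> ^ 4" by (simp add: n_def power_mult_distrib)
      have 3: "0 \<le> M * D * norm \<zeta> ^ 4" using M(1) D(1) by simp
      show ?thesis
        using 1 2 3 cb[of "z + g"] cb[of z] unfolding E_def by (simp add: distrib_right abs_le_iff)
    qed
    also have "\<dots> \<le> E * (exp r * norm g) ^ 4"
    proof (intro mult_left_mono power_mono E0)
      have "exp (- r) \<le> norm z" using z by simp
      then have "norm g / norm z \<le> norm g / exp (- r)"
        by (intro divide_left_mono) (use z0 in auto)
      then show "norm \<zeta> \<le> exp r * norm g" by (simp add: \<zeta>_def norm_divide exp_minus field_simps)
    qed auto
    finally show ?thesis unfolding P by (simp add: power_mult_distrib mult_ac)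
  qed
  have "harmonic_upto_4 (cutoff r h) ?K (E * exp r ^ 4)"
    unfolding harmonic_upto_4_def using main by blast
  then show ?thesis using cb E0 by (intro exI[of _ "E * exp r ^ 4"] exI[of _ b]) auto
qed

lemma cutoff_power:
  "\<exists>C b. 0 \<le> C \<and> harmonic_upto_4 (cutoff r (\<lambda>z. Re (c * z powi n))) {z. exp (- r) \<le> norm z \<and> norm z \<le> exp r} C \<and>
    (\<forall>z. \<bar>cutoff r (\<lambda>z. Re (c * z powi n)) z\<bar> \<le> b)"
proof (rule cutoff_harmonic_upto_4)
  show "continuous_on (- {0}) (\<lambda>z. Re (c * z powi n))" "continuous_on (- {0}) (\<lambda>z. c * z powi n)"
    by (auto intro!: continuous_intros)
  have "1 + z \<noteq> 0" if "z \<in> ball 0 1" for z :: complex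
    using that by (metis add_eq_0_iff dist_0_norm less_irrefl mem_ball norm_minus_cancel norm_one)
  then show "(\<lambda>\<zeta>. (1 + \<zeta>) powi n) holomorphic_on ball 0 1"
    by (auto intro!: holomorphic_intros)
  show "Re (c * (z * (1 + \<zeta>)) powi n) = Re (c * z powi n) + Re (c * z powi n * ((1 + \<zeta>) powi n - (1 + 0) powi n))" for z \<zeta>
    by (simp add: power_int_mult_distrib) (simp add: algebra_simps)
qed

lemma cutoff_ln:
  "\<exists>C b. 0 \<le> C \<and> harmonic_upto_4 (cutoff r (\<lambda>z. ln (norm z))) {z. exp (- r) \<le> norm z \<and> norm z \<le> exp r} C \<and>
    (\<forall>z. \<bar>cutoff r (\<lambda>z. ln (norm z)) z\<bar> \<le> b)"
proof (rule cutoff_harmonic_upto_4)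
  show "continuous_on (- {0}) (\<lambda>z::complex. ln (norm z))"
    by (auto intro!: continuous_intros)
  show "continuous_on (- {0}) (\<lambda>_. 1 :: complex)" by simp
  have pos: "0 < Re (1 + z)" if "norm z < 1" for z :: complex
    using that abs_Re_le_cmod[of z] by simp
  show "(\<lambda>\<zeta>. Ln (1 + \<zeta>)) holomorphic_on ball 0 1"
    using pos by (auto intro!: holomorphic_intros simp: complex_nonpos_Reals_iff) force
  show "ln (norm (z * (1 + \<zeta>))) = ln (norm z) + Re (1 * (Ln (1 + \<zeta>) - Ln (1 + 0)))"
    if "z \<noteq> 0" "norm \<zeta> \<le> 1 / 2" for z \<zeta>
  proof -
    have "0 < Re (1 + \<zeta>)" using that by (intro pos) simp
    then have "1 + \<zeta> \<noteq> 0" by (metis less_irrefl zero_complex.sel(1))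
    then show ?thesis using that by (simp add: norm_mult ln_mult)
  qed
qed

lemma closure_annulus_subset: "closure (annulus r) \<subseteq> {z. exp (- r) \<le> norm z \<and> norm z \<le> exp r}"
proof (rule closure_minimal)
  show "closed {z::complex. exp (- r) \<le> norm z \<and> norm z \<le> exp r}"
    by (intro closed_Collect_conj closed_Collect_le continuous_intros)
qed (auto simp: annulus_def)

lemma open_annulus: "open (annulus r)"
  unfolding annulus_def by (intro open_Collect_conj open_Collect_less continuous_intros)

lemma bounded_annulus: "bounded (annulus r)"
  unfolding annulus_def by (auto intro!: boundedI[of _ "exp r"])

context planar_brownian_motion
begin

lemma annulus_exit_expectation:
  fixes h :: "complex \<Rightarrow> real"
  assumes a: "a \<in> annulus r" and [measurable]: "h \<in> borel_measurable borel"
    and h: "\<exists>C b. 0 \<le> C \<and> harmonic_upto_4 (cutoff r h) {z. exp (- r) \<le> norm z \<and> norm z \<le> exp r} C \<and>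
      (\<forall>z. \<bar>cutoff r h z\<bar> \<le> b)"
  shows "(\<integral>\<omega>. h (exit_point B (annulus r) \<omega>) \<partial>M) = h a"
proof -
  let ?K = "{z::complex. exp (- r) \<le> norm z \<and> norm z \<le> exp r}"
  obtain C b where C: "0 \<le> C" "harmonic_upto_4 (cutoff r h) ?K C" and b: "\<And>z. \<bar>cutoff r h z\<bar> \<le> b"
    using h by blast
  have cut: "cutoff r h z = h z" if "z \<in> ?K" for z
  proof -
    have "exp (- r) / 2 \<le> exp (- r)" "exp r \<le> 2 * exp r" by auto
    then show ?thesis using that by (auto simp: cutoff_def intro: order_trans)
  qed
  have m[measurable]: "cutoff r h \<in> borel_measurable borel" unfolding cutoff_def[abs_def] by measurable
  have [measurable]: "exit_point B (annulus r) \<in> borel_measurable M"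
    using a bounded_annulus[of r] not_bounded_UNIV[where 'a=complex]
    by (intro measurable_exit_point open_annulus) metis
  have "harmonic_upto_4 (cutoff r h) (closure (annulus r)) C"
    using C(2) closure_annulus_subset[of r] unfolding harmonic_upto_4_def by blast
  from optional_stopping[OF open_annulus bounded_annulus a m this C(1) b]
  have "(\<integral>\<omega>. cutoff r h (exit_point B (annulus r) \<omega>) \<partial>M) = cutoff r h a" .
  moreover have "cutoff r h a = h a"
    using a by (intro cut) (auto simp: annulus_def)
  moreover have "(\<integral>\<omega>. cutoff r h (exit_point B (annulus r) \<omega>) \<partial>M) = (\<integral>\<omega>. h (exit_point B (annulus r) \<omega>) \<partial>M)"
  proof (rule integral_cong_AE)
    show "AE \<omega> in M. cutoff r h (exit_point B (annulus r) \<omega>) = h (exit_point B (annulus r) \<omega>)"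
      using exit_point_AE_frontier[OF open_annulus bounded_annulus a]
    proof eventually_elim
      case (elim \<omega>)
      then show ?case
        using closure_annulus_subset[of r] by (intro cut) (auto simp: frontier_def)
    qed
  qed measurable
  ultimately show ?thesis by simp
qed

end

section \<open>The Poisson kernel of a strip\<close>

text \<open>The Poisson kernel of the strip \<open>\<bar>Re w\<bar> < r\<close> for the real point \<open>x\<close>, with respect to Lebesgue measure on
  the line \<open>Re w = s r\<close>, where \<open>s\<close> is \<open>1\<close> or \<open>- 1\<close>.\<close>
definition strip_kernel :: "real \<Rightarrow> real \<Rightarrow> real \<Rightarrow> real \<Rightarrow> real" where
  "strip_kernel r x s y =
     cos (pi * x / (2 * r)) / (4 * r * (cosh (pi * y / (2 * r)) - s * sin (pi * x / (2 * r))))"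

locale strip =
  fixes r x :: real
  assumes r: "0 < r" and x: "\<bar>x\<bar> < r"
begin

definition \<phi> :: real where "\<phi> = pi * x / (2 * r)"

lemma \<phi>: "\<bar>\<phi>\<bar> < pi / 2" "0 < cos \<phi>" "\<bar>sin \<phi>\<bar> < 1"
proof -
  have "\<bar>\<phi>\<bar> = pi / 2 * (\<bar>x\<bar> / r)" using r by (simp add: \<phi>_def abs_mult)
  also have "\<dots> < pi / 2 * 1" using x r by (intro mult_strict_left_mono) auto
  finally show *: "\<bar>\<phi>\<bar> < pi / 2" by simp
  then show c: "0 < cos \<phi>" by (intro cos_gt_zero_pi) auto
  have "(sin \<phi>)\<^sup>2 < 1" using sin_cos_squared_add[of \<phi>] c by (smt (verit) zero_less_power)
  then show "\<bar>sin \<phi>\<bar> < 1" by (simp add: abs_square_less_1)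
qed

lemma kernel_eq: "strip_kernel r x s y = cos \<phi> / (4 * r * (cosh (pi * y / (2 * r)) - s * sin \<phi>))"
  by (simp add: strip_kernel_def \<phi>_def)

lemma kernel_denom_pos: "\<bar>s\<bar> = 1 \<Longrightarrow> 0 < cosh v - s * sin \<phi>"
  using \<phi>(3) cosh_real_ge_1[of v] abs_le_D1[of "s * sin \<phi>" "\<bar>s * sin \<phi>\<bar>"] by (simp add: abs_mult)

lemma kernel_nonneg: "\<bar>s\<bar> = 1 \<Longrightarrow> 0 \<le> strip_kernel r x s y"
  unfolding kernel_eq using \<phi>(2) r kernel_denom_pos[of s "pi * y / (2 * r)"]
  by (intro divide_nonneg_pos) auto

lemma cosh_ge_quadratic: "1 + v\<^sup>2 / 2 \<le> cosh (v::real)"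
proof -
  have "\<bar>v / 2\<bar> \<le> \<bar>sinh (v / 2)\<bar>"
    using real_le_abs_sinh[of "v / 2"] by (simp add: sinh_def exp_minus)
  then have "(v / 2)\<^sup>2 \<le> (sinh (v / 2))\<^sup>2" by (rule abs_le_square_iff[THEN iffD1])
  then show ?thesis using cosh_double[of "v / 2"] cosh_square_eq[of "v / 2"] by (simp add: power_divide)
qed

text \<open>The kernel decays exponentially; the rational bound is enough for integrability and for the
  convergence of the sum over the translates by multiples of \<open>2 \<pi>\<close>.\<close>
lemma kernel_bound:
  obtains c where "0 < c" "\<And>s y. \<bar>s\<bar> = 1 \<Longrightarrow> strip_kernel r x s y \<le> c * inverse (1 + y\<^sup>2)"
proof -
  define m where "m = min (1 - \<bar>sin \<phi>\<bar>) ((pi / (2 * r))\<^sup>2 / 2)"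
  have m: "0 < m" unfolding m_def using \<phi>(3) r by simp
  have "strip_kernel r x s y \<le> cos \<phi> / (4 * r * m) * inverse (1 + y\<^sup>2)" if s: "\<bar>s\<bar> = 1" for s y
  proof -
    have "s * sin \<phi> \<le> \<bar>sin \<phi>\<bar>" using abs_ge_self[of "s * sin \<phi>"] s by (simp add: abs_mult)
    then have "(1 - \<bar>sin \<phi>\<bar>) + (pi / (2 * r))\<^sup>2 / 2 * y\<^sup>2 \<le> cosh (pi * y / (2 * r)) - s * sin \<phi>"
      using cosh_ge_quadratic[of "pi * y / (2 * r)"] by (simp add: power_mult_distrib power_divide)
    moreover have "m * 1 + m * y\<^sup>2 \<le> (1 - \<bar>sin \<phi>\<bar>) + (pi / (2 * r))\<^sup>2 / 2 * y\<^sup>2"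
    proof (intro add_mono mult_right_mono)
      show "m * 1 \<le> 1 - \<bar>sin \<phi>\<bar>" "m \<le> (pi / (2 * r))\<^sup>2 / 2" by (simp_all only: m_def mult_1_right min.cobounded1 min.cobounded2)
    qed simp
    ultimately have le: "m * (1 + y\<^sup>2) \<le> cosh (pi * y / (2 * r)) - s * sin \<phi>"
      by (simp add: distrib_left)
    have p: "0 < m * (1 + y\<^sup>2)" using m by (intro mult_pos_pos add_pos_nonneg) auto
    have "strip_kernel r x s y \<le> cos \<phi> / (4 * r * (m * (1 + y\<^sup>2)))"
      unfolding kernel_eq using le p \<phi>(2) r kernel_denom_pos[OF s, of "pi * y / (2 * r)"]
      by (intro divide_left_mono mult_left_mono mult_pos_pos m) (auto simp: add_pos_nonneg)
    then show ?thesis by (simp add: field_simps)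
  qed
  moreover have "0 < cos \<phi> / (4 * r * m)" using \<phi>(2) r m by simp
  ultimately show thesis using that by blast
qed

lemma measurable_kernel [measurable]: "strip_kernel r x s \<in> borel_measurable borel"
  unfolding strip_kernel_def[abs_def] cosh_def by measurable

lemma continuous_kernel: "\<bar>s\<bar> = 1 \<Longrightarrow> continuous_on A (strip_kernel r x s)"
  unfolding kernel_eq[abs_def] using kernel_denom_pos r
  by (intro continuous_intros) (auto simp: less_le)

lemma integrable_kernel: "\<bar>s\<bar> = 1 \<Longrightarrow> integrable lborel (strip_kernel r x s)"
proof -
  assume s: "\<bar>s\<bar> = 1"
  obtain c where c: "0 < c" "\<And>y. strip_kernel r x s y \<le> c * inverse (1 + y\<^sup>2)"
    using kernel_bound s by metis
  have "integrable lborel (\<lambda>y::real. c * inverse (1 + y\<^sup>2))"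
    using integrable_inverse_1_plus_square by (simp add: set_integrable_def einterval_def)
  then show ?thesis
  proof (rule Bochner_Integration.integrable_bound)
    have "norm (strip_kernel r x s y) \<le> norm (c * inverse (1 + y\<^sup>2))" for y
      using c(2)[of y] kernel_nonneg[OF s, of y] by simp
    then show "AE y in lborel. norm (strip_kernel r x s y) \<le> norm (c * inverse (1 + y\<^sup>2))" by simp
  qed measurable
qed

text \<open>The strip is widened a little so that the rectangle lies in an open set with no further pole.\<close>
lemma sin_eq_only_at_x:
  assumes w: "\<bar>Re w\<bar> < r + (r - \<bar>x\<bar>) / 2" and eq: "sin (of_real (pi / (2 * r)) * w) = sin (of_real \<phi>)"
  shows "w = of_real x"
proof -
  have r0: "complex_of_real r \<noteq> 0" using r by simp
  obtain n :: int where n: "of_real (pi / (2 * r)) * w = of_real \<phi> + of_real (2 * of_int n * pi) \<or>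
      of_real (pi / (2 * r)) * w = - of_real \<phi> + of_real ((2 * of_int n + 1) * pi)"
    using eq unfolding complex_sin_eq by (elim bexE Ints_cases) blast
  have scale: "w = of_real (2 * r / pi * v)" if "of_real (pi / (2 * r)) * w = of_real v" for v
  proof -
    have "of_real (2 * r / pi) * (of_real (pi / (2 * r)) * w) = w"
      unfolding mult.assoc[symmetric] of_real_mult[symmetric] using r by simp
    then show ?thesis unfolding that by simp
  qed
  from n show ?thesis
  proof
    assume "of_real (pi / (2 * r)) * w = of_real \<phi> + of_real (2 * of_int n * pi)"
    then have "w = of_real (2 * r / pi * (\<phi> + 2 * of_int n * pi))"
      by (intro scale) (simp del: of_real_mult of_real_of_int_eq)
    also have "2 * r / pi * (\<phi> + 2 * of_int n * pi) = x + 4 * r * of_int n"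
      using r by (simp add: \<phi>_def field_simps)
    finally have w': "w = of_real (x + 4 * r * of_int n)" .
    have "n = 0"
    proof (rule ccontr)
      assume "n \<noteq> 0"
      then have "4 * r * 1 \<le> 4 * r * \<bar>real_of_int n\<bar>" using r by (intro mult_left_mono) auto
      also have "\<dots> = \<bar>4 * r * of_int n\<bar>" using r by (simp add: abs_mult)
      also have "\<dots> \<le> \<bar>Re w\<bar> + \<bar>x\<bar>" unfolding w' by simp
      finally show False using w x by (simp add: field_simps)
    qed
    then show ?thesis using w' by simp
  next
    assume "of_real (pi / (2 * r)) * w = - of_real \<phi> + of_real ((2 * of_int n + 1) * pi)"
    then have "w = of_real (2 * r / pi * (- \<phi> + (2 * of_int n + 1) * pi))"
      by (intro scale) (simp del: of_real_mult of_real_of_int_eq of_real_add)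
    also have "2 * r / pi * (- \<phi> + (2 * of_int n + 1) * pi) = - x + 2 * r * of_int (2 * n + 1)"
      using r by (simp add: \<phi>_def field_simps)
    finally have w': "w = of_real (- x + 2 * r * of_int (2 * n + 1))" .
    have "2 * n + 1 \<noteq> 0" by presburger
    then have "1 \<le> \<bar>2 * n + 1\<bar>" by linarith
    then have "(1::real) \<le> \<bar>of_int (2 * n + 1)\<bar>" by (metis of_int_1_le_iff of_int_abs)
    then have "2 * r * 1 \<le> 2 * r * \<bar>of_int (2 * n + 1)\<bar>" using r by (intro mult_left_mono) auto
    also have "\<dots> = \<bar>2 * r * of_int (2 * n + 1)\<bar>" using r by (simp add: abs_mult)
    also have "\<dots> \<le> \<bar>Re w\<bar> + \<bar>x\<bar>" unfolding w' by simp
    finally show ?thesis using w x by (simp add: field_simps)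
  qed
qed

lemma norm_sin_ge: "\<bar>sinh (Im z)\<bar> \<le> norm (sin z)"
proof -
  have "(sinh (Im z))\<^sup>2 = (exp (2 * Im z) + inverse (exp (2 * Im z)) - 2) / 4"
    unfolding exp_double by (simp add: sinh_def power2_eq_square exp_minus field_simps)
  also have "\<dots> \<le> (norm (sin z))\<^sup>2"
    unfolding norm_sin_squared using cos_le_one[of "2 * Re z"] by simp
  finally show ?thesis by (metis abs_le_square_iff abs_norm_cancel)
qed

lemma strip_boundary_values:
  assumes "\<bar>s\<bar> = 1"
  shows "sin (of_real (pi / (2 * r)) * Complex (s * r) y) = of_real (s * cosh (pi * y / (2 * r)))"
proof -
  have 1: "of_real (pi / (2 * r)) * Complex (s * r) y = of_real (s * pi / 2) + \<i> * of_real (pi * y / (2 * r))"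
    using r by (simp add: complex_eq_iff)
  have 2: "sin (of_real (s * pi / 2) :: complex) = of_real s" "cos (of_real (s * pi / 2) :: complex) = 0"
    using assms by (auto simp: abs_if sin_of_real cos_of_real minus_equation_iff[of s] split: if_splits)
  have 3: "cos (\<i> * of_real v) = of_real (cosh v)" for v
    unfolding cosh_conv_cos[symmetric]
    by (simp add: cosh_def scaleR_conv_of_real flip: exp_of_real)
  show ?thesis unfolding 1 sin_add 2 3 by simp
qed

text \<open>
  Multiplying \<open>F\<close> by \<open>cos \<phi> / (sin (\<pi> w / 2 r) - sin \<phi>)\<close> creates a simple pole at \<open>x\<close>, while on the two
  boundary lines the factor is real and equals the Poisson kernel up to constants. The horizontal
  sides of a tall rectangle contribute little because \<open>sin\<close> grows exponentially in the vertical direction.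
\<close>
lemma rectangle_formula:
  fixes F :: "complex \<Rightarrow> complex"
  assumes F: "F holomorphic_on UNIV" and C: "\<And>w. \<bar>Re w\<bar> \<le> r \<Longrightarrow> norm (F w) \<le> C * (1 + \<bar>Im w\<bar>)"
    and Y: "0 < Y" "1 < sinh (pi * Y / (2 * r))"
  shows "norm (integral {- Y..Y} (\<lambda>y. of_real (strip_kernel r x 1 y) * F (Complex r y)
      + of_real (strip_kernel r x (- 1) y) * F (Complex (- r) y)) - F (of_real x))
    \<le> cos \<phi> * C * (1 + Y) / (sinh (pi * Y / (2 * r)) - 1)"
proof -
  define \<alpha> where "\<alpha> = pi / (2 * r)"
  have \<alpha>: "0 < \<alpha>" using r by (simp add: \<alpha>_def)
  have \<alpha>Y: "pi * y / (2 * r) = \<alpha> * y" for y by (simp add: \<alpha>_def)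
  define g where "g w = sin (of_real \<alpha> * w) - sin (of_real \<phi> :: complex)" for w
  define f where "f w = F w * of_real (cos \<phi>) / g w" for w
  define S where "S = {w::complex. \<bar>Re w\<bar> < r + (r - \<bar>x\<bar>) / 2}"
  have \<alpha>x: "\<alpha> * x = \<phi>" by (simp add: \<alpha>_def \<phi>_def)
  have S: "open S" "convex S"
  proof -
    have eq: "S = {w. Re w < r + (r - \<bar>x\<bar>) / 2} \<inter> {w. Re w > - (r + (r - \<bar>x\<bar>) / 2)}"
      by (auto simp: S_def)
    show "open S" unfolding eq by (intro open_Int open_halfspace_Re_lt open_halfspace_Re_gt)
    show "convex S" unfolding eq by (intro convex_Int convex_halfspace_Re_lt convex_halfspace_Re_gt)
  qed
  have g0: "g w \<noteq> 0" if "w \<in> S - {of_real x}" for w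
    using sin_eq_only_at_x[of w] that unfolding g_def S_def \<alpha>_def by auto
  have gh: "g holomorphic_on A" for A unfolding g_def[abs_def] by (intro holomorphic_intros)
  have fh: "f holomorphic_on S - {of_real x}"
    unfolding f_def[abs_def] using g0 holomorphic_on_subset[OF F]
    by (intro holomorphic_intros gh) auto
  have res: "residue f (of_real x) = of_real (2 * r / pi) * F (of_real x)"
  proof (rule residue_simple'[OF S(1) _ fh])
    show "of_real x \<in> S" using x r by (simp add: S_def field_simps)
    have gx: "g (of_real x) = 0" by (simp add: g_def \<alpha>x[symmetric])
    have "(g has_field_derivative of_real (\<alpha> * cos \<phi>)) (at (of_real x))"
      unfolding g_def[abs_def] \<alpha>x[symmetric]
      by (auto intro!: derivative_eq_intros simp: cos_of_real[symmetric])
    then have "((\<lambda>w. (g w - g (of_real x)) / (w - of_real x)) \<longlongrightarrow> of_real (\<alpha> * cos \<phi>)) (at (of_real x))"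
      by (simp add: has_field_derivative_iff)
    then have "((\<lambda>w. F w * of_real (cos \<phi>) / ((g w - g (of_real x)) / (w - of_real x)))
        \<longlongrightarrow> F (of_real x) * of_real (cos \<phi>) / of_real (\<alpha> * cos \<phi>)) (at (of_real x))"
      using \<alpha> \<phi>(2) holomorphic_on_imp_continuous_on[OF F]
      by (intro tendsto_intros) (auto simp: continuous_on_def)
    moreover have "F (of_real x) * of_real (cos \<phi>) / of_real (\<alpha> * cos \<phi>) = of_real (2 * r / pi) * F (of_real x)"
      using \<phi>(2) r by (simp add: \<alpha>_def field_simps)
    ultimately show "((\<lambda>w. f w * (w - of_real x)) \<longlongrightarrow> of_real (2 * r / pi) * F (of_real x)) (at (of_real x))"
      by (simp add: gx f_def)
  qed
  let ?a1 = "Complex (- r) (- Y)" and ?a2 = "Complex r (- Y)" and ?a3 = "Complex r Y" and ?a4 = "Complex (- r) Y"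
  have xb: "of_real x \<in> box ?a1 ?a3"
    using x Y by (auto simp: in_box_complex_iff)
  have cS: "cbox ?a1 ?a3 \<subseteq> S"
  proof
    fix w assume "w \<in> cbox ?a1 ?a3"
    then have "\<bar>Re w\<bar> \<le> r" by (auto simp: in_cbox_complex_iff)
    then show "w \<in> S" using x by (simp add: S_def field_simps)
  qed
  have path: "path_image (rectpath ?a1 ?a3) \<subseteq> S - {of_real x}"
    using path_image_rectpath_cbox_minus_box[of ?a1 ?a3] r Y cS xb by auto
  have out: "\<forall>z. z \<notin> S \<longrightarrow> winding_number (rectpath ?a1 ?a3) z = 0"
    using cS r Y by (intro allI impI winding_number_rectpath_outside) auto
  have "contour_integral (rectpath ?a1 ?a3) f
      = 2 * pi * \<i> * (\<Sum>p\<in>{of_real x}. winding_number (rectpath ?a1 ?a3) p * residue f p)"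
    by (rule Residue_theorem[OF S(1) convex_connected[OF S(2)] _ fh _ _ path out]) simp_all
  also have "\<dots> = 4 * r * \<i> * F (of_real x)"
    using winding_number_rectpath[OF xb] by (simp add: res)
  finally have CI: "contour_integral (rectpath ?a1 ?a3) f = 4 * r * \<i> * F (of_real x)" .
  have sides: "path_image (rectpath ?a1 ?a3) = closed_segment ?a1 ?a2 \<union> closed_segment ?a2 ?a3 \<union> closed_segment ?a3 ?a4 \<union> closed_segment ?a4 ?a1"
    by (auto simp: rectpath_def Let_def path_image_join)
  have fc: "continuous_on (S - {of_real x}) f" by (rule holomorphic_on_imp_continuous_on[OF fh])
  have int: "f contour_integrable_on linepath u v"
    if "closed_segment u v \<subseteq> path_image (rectpath ?a1 ?a3)" for u v
    using that path by (intro contour_integrable_continuous_linepath continuous_on_subset[OF fc]) auto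
  have i: "f contour_integrable_on linepath ?a1 ?a2" "f contour_integrable_on linepath ?a2 ?a3"
    "f contour_integrable_on linepath ?a3 ?a4" "f contour_integrable_on linepath ?a4 ?a1"
    by (rule int, unfold sides, blast)+
  have "contour_integral (rectpath ?a1 ?a3) f = contour_integral (linepath ?a1 ?a2) f + (contour_integral (linepath ?a2 ?a3) f
      + (contour_integral (linepath ?a3 ?a4) f + contour_integral (linepath ?a4 ?a1) f))"
    using i by (simp add: rectpath_def Let_def)
  also have "contour_integral (linepath ?a4 ?a1) f = - contour_integral (linepath ?a1 ?a4) f"
    using contour_integral_reversepath[of "linepath ?a1 ?a4" f] by simp
  finally have CI2: "4 * r * \<i> * F (of_real x) = contour_integral (linepath ?a1 ?a2) f + contour_integral (linepath ?a2 ?a3) f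
      + contour_integral (linepath ?a3 ?a4) f - contour_integral (linepath ?a1 ?a4) f"
    unfolding CI by simp
  let ?k = "\<lambda>s y. of_real (strip_kernel r x s y) * F (Complex (s * r) y)"
  have fk: "f (Complex (s * r) y) = 4 * r * s * ?k s y" if "\<bar>s\<bar> = 1" for s y
  proof -
    have ss: "s * s = 1" using that by (metis abs_mult_self_eq mult.right_neutral)
    have "g (Complex (s * r) y) = of_real (s * cosh (pi * y / (2 * r)) - sin \<phi>)"
      using strip_boundary_values[OF that, of y] by (simp add: g_def \<alpha>_def sin_of_real)
    moreover have "s * cosh (pi * y / (2 * r)) - sin \<phi> = s * (cosh (pi * y / (2 * r)) - s * sin \<phi>)"
      by (simp add: algebra_simps mult.assoc[symmetric] ss)
    moreover have "c / (s * d) = s * (c / d)" for c d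
      using that by (auto simp: abs_if minus_equation_iff[of s] split: if_splits)
    ultimately have "f (Complex (s * r) y) = F (Complex (s * r) y) * of_real (s * (cos \<phi> / (cosh (pi * y / (2 * r)) - s * sin \<phi>)))"
      by (metis f_def of_real_divide times_divide_eq_right)
    also have "cos \<phi> / (cosh (pi * y / (2 * r)) - s * sin \<phi>) = 4 * r * strip_kernel r x s y"
      using r by (simp add: kernel_eq)
    finally show ?thesis by (simp add: mult_ac)
  qed
  have kc: "continuous_on A (?k s)" if "\<bar>s\<bar> = 1" for s A
  proof (intro continuous_intros continuous_kernel that)
    have "continuous_on A (\<lambda>y. Complex (s * r) y)"
      unfolding Complex_eq by (intro continuous_intros)
    then show "continuous_on A (\<lambda>y. F (Complex (s * r) y))"
      by (rule continuous_on_compose2[OF holomorphic_on_imp_continuous_on[OF F]]) simp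
  qed
  have ik: "integral {- Y..Y} (\<lambda>y. f (Complex (s * r) y)) = 4 * r * s * integral {- Y..Y} (?k s)" if "\<bar>s\<bar> = 1" for s
    unfolding fk[OF that] by (rule Henstock_Kurzweil_Integration.integral_mult_right)
  have right: "contour_integral (linepath ?a2 ?a3) f = 4 * r * \<i> * integral {- Y..Y} (?k 1)"
    using Y ik[of 1] by (subst contour_integral_linepath_same_Re[where c=r and a="-Y" and b=Y]) (simp_all add: mult_ac)
  have left: "contour_integral (linepath ?a1 ?a4) f = - (4 * r * \<i> * integral {- Y..Y} (?k (- 1)))"
    using Y ik[of "-1"] by (subst contour_integral_linepath_same_Re[where c="-r" and a="-Y" and b=Y]) (simp_all add: mult_ac)
  define I where "I = integral {- Y..Y} (\<lambda>y. ?k 1 y + ?k (- 1) y)"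
  have I: "I = integral {- Y..Y} (?k 1) + integral {- Y..Y} (?k (- 1))"
    unfolding I_def by (intro integral_add integrable_continuous_real kc) auto
  define bd where "bd = cos \<phi> * C * (1 + Y) / (sinh (pi * Y / (2 * r)) - 1)"
  have C0: "0 \<le> C" using order_trans[OF norm_ge_zero C[of 0]] r by simp
  have bd0: "0 \<le> bd" using C0 Y \<phi>(2) by (simp add: bd_def)
  have hor: "norm (f w) \<le> bd" if "\<bar>Re w\<bar> \<le> r" "\<bar>Im w\<bar> = Y" for w
  proof -
    have "Im w = Y \<or> Im w = - Y" using that(2) by linarith
    moreover have "0 \<le> \<alpha> * Y" using \<alpha> Y by simp
    ultimately have "sinh (\<alpha> * Y) = \<bar>sinh (Im (of_real \<alpha> * w))\<bar>"
      by auto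
    also have "\<dots> \<le> norm (sin (of_real \<alpha> * w))" by (rule norm_sin_ge)
    finally have "sinh (\<alpha> * Y) - 1 \<le> norm (sin (of_real \<alpha> * w)) - norm (sin (of_real \<phi> :: complex))"
      using \<phi>(3) by (simp add: sin_of_real)
    also have "\<dots> \<le> norm (g w)" unfolding g_def by (rule norm_triangle_ineq2)
    finally have "sinh (pi * Y / (2 * r)) - 1 \<le> norm (g w)" unfolding \<alpha>Y .
    moreover have "norm (F w) * cos \<phi> \<le> cos \<phi> * C * (1 + Y)"
      using mult_right_mono[OF C[OF that(1)], of "cos \<phi>"] \<phi>(2) that(2) by (simp add: mult_ac)
    ultimately show ?thesis
      using Y \<phi>(2) C0 unfolding f_def bd_def norm_divide norm_mult norm_of_real
      by (intro frac_le) auto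
  qed
  have bot: "norm (contour_integral (linepath ?a1 ?a2) f) \<le> bd * (2 * r)"
  proof -
    have "norm (contour_integral (linepath ?a1 ?a2) f) \<le> bd * norm (?a2 - ?a1)"
    proof (rule contour_integral_bound_linepath[OF i(1) bd0 hor])
      fix w assume "w \<in> closed_segment ?a1 ?a2"
      then show "\<bar>Re w\<bar> \<le> r" "\<bar>Im w\<bar> = Y"
        using r Y by (auto simp: closed_segment_same_Im closed_segment_eq_real_ivl)
    qed
    also have "?a2 - ?a1 = of_real (2 * r)" by (simp add: complex_eq_iff)
    also have "norm (of_real (2 * r) :: complex) = 2 * r" unfolding norm_of_real using r by simp
    finally show ?thesis .
  qed
  have top: "norm (contour_integral (linepath ?a3 ?a4) f) \<le> bd * (2 * r)"
  proof -
    have "norm (contour_integral (linepath ?a3 ?a4) f) \<le> bd * norm (?a4 - ?a3)"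
    proof (rule contour_integral_bound_linepath[OF i(3) bd0 hor])
      fix w assume "w \<in> closed_segment ?a3 ?a4"
      then show "\<bar>Re w\<bar> \<le> r" "\<bar>Im w\<bar> = Y"
        using r Y by (auto simp: closed_segment_same_Im closed_segment_eq_real_ivl)
    qed
    also have "?a4 - ?a3 = of_real (- 2 * r)" by (simp add: complex_eq_iff)
    also have "norm (of_real (- 2 * r) :: complex) = 2 * r" unfolding norm_of_real using r by simp
    finally show ?thesis .
  qed
  have "4 * r * \<i> * (I - F (of_real x)) = - (contour_integral (linepath ?a1 ?a2) f + contour_integral (linepath ?a3 ?a4) f)"
    using CI2 unfolding I right left by (simp add: algebra_simps)
  then have "norm (4 * r * \<i> * (I - F (of_real x))) = norm (contour_integral (linepath ?a1 ?a2) f + contour_integral (linepath ?a3 ?a4) f)"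
    by (simp only: norm_minus_cancel)
  also have "\<dots> \<le> bd * (2 * r) + bd * (2 * r)"
    by (rule norm_triangle_le) (intro add_mono bot top)
  finally have "4 * r * norm (I - F (of_real x)) \<le> 4 * r * bd"
    using r by (simp add: norm_mult)
  then have "norm (I - F (of_real x)) \<le> bd" using r by simp
  then show ?thesis unfolding I_def bd_def by simp
qed

lemma rectangle_error_tendsto:
  "(\<lambda>n. cos \<phi> * C * (1 + real (Suc n)) / (sinh (pi * real (Suc n) / (2 * r)) - 1)) \<longlonglongrightarrow> 0"
proof -
  have "((\<lambda>y. (1 + y) / (sinh (\<alpha> * y) - 1)) \<longlongrightarrow> 0) at_top" if "0 < \<alpha>" for \<alpha> :: real
    using that unfolding sinh_def by simp real_asymp
  from this[of "pi / (2 * r)"] have "((\<lambda>y. cos \<phi> * C * ((1 + y) / (sinh (pi / (2 * r) * y) - 1))) \<longlongrightarrow> 0) at_top"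
    using r by (intro tendsto_mult_right_zero) simp
  from filterlim_compose[OF this filterlim_real_sequentially]
  have "(\<lambda>n. cos \<phi> * C * ((1 + real n) / (sinh (pi / (2 * r) * real n) - 1))) \<longlonglongrightarrow> 0" .
  from LIMSEQ_Suc[OF this] show ?thesis by simp
qed

lemma sinh_gt_1_eventually: "\<forall>\<^sub>F n in sequentially. 1 < sinh (pi * real (Suc n) / (2 * r))"
proof -
  have "filterlim (\<lambda>y. sinh (\<alpha> * y)) at_top at_top" if "0 < \<alpha>" for \<alpha> :: real
    using that unfolding sinh_def by simp real_asymp
  from this[of "pi / (2 * r)"] have "filterlim (\<lambda>y. sinh (pi / (2 * r) * y)) at_top at_top"
    using r by simp
  from filterlim_compose[OF this filterlim_real_sequentially]
  have "\<forall>\<^sub>F n in sequentially. 1 < sinh (pi / (2 * r) * real n)"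
    by (simp add: filterlim_at_top_dense)
  then show ?thesis by (subst (asm) eventually_sequentially_Suc[symmetric]) simp
qed

lemma set_integral_symmetric_limit:
  fixes f :: "real \<Rightarrow> real"
  assumes f: "integrable lborel f"
  shows "(\<lambda>n. integral {- real (Suc n)..real (Suc n)} f) \<longlonglongrightarrow> integral\<^sup>L lborel f"
proof -
  have [measurable]: "f \<in> borel_measurable borel" using f by auto
  have "(\<lambda>n. \<integral>y. indicator {- real (Suc n)..real (Suc n)} y *\<^sub>R f y \<partial>lborel) \<longlonglongrightarrow> integral\<^sup>L lborel f"
  proof (rule integral_dominated_convergence[where w="\<lambda>y. norm (f y)"])
    have "\<forall>\<^sub>F n in sequentially. indicator {- real (Suc n)..real (Suc n)} y *\<^sub>R f y = f y" for y
    proof -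
      have "\<forall>\<^sub>F n in sequentially. \<bar>y\<bar> \<le> real n"
        using filterlim_real_sequentially by (auto simp: filterlim_at_top)
      then show ?thesis by eventually_elim (auto simp: indicator_def)
    qed
    then show "AE y in lborel. (\<lambda>n. indicator {- real (Suc n)..real (Suc n)} y *\<^sub>R f y) \<longlonglongrightarrow> f y"
      by (intro AE_I2 tendsto_eventually)
  qed (use f in \<open>auto simp: indicator_def\<close>)
  moreover have "(\<integral>y. indicator {- real (Suc n)..real (Suc n)} y *\<^sub>R f y \<partial>lborel) = integral {- real (Suc n)..real (Suc n)} f" for n
  proof -
    have "set_integrable lborel {- real (Suc n)..real (Suc n)} f"
      unfolding set_integrable_def by (rule integrable_mult_indicator[OF _ f]) simp
    from set_borel_integral_eq_integral(2)[OF this] show ?thesis by (simp add: set_lebesgue_integral_def)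
  qed
  ultimately show ?thesis by simp
qed

lemma integrable_kernel_mult:
  assumes "\<bar>s\<bar> = 1" "u \<in> borel_measurable borel" "\<And>y. \<bar>u y\<bar> \<le> b"
  shows "integrable lborel (\<lambda>y. strip_kernel r x s y * u y)"
proof (rule Bochner_Integration.integrable_bound)
  note [measurable] = assms(2)
  show "integrable lborel (\<lambda>y. b * strip_kernel r x s y)"
    using integrable_kernel[OF assms(1)] by simp
  show "AE y in lborel. norm (strip_kernel r x s y * u y) \<le> norm (b * strip_kernel r x s y)"
  proof (rule AE_I2)
    fix y
    have "0 \<le> b" using assms(3)[of 0] by linarith
    then show "norm (strip_kernel r x s y * u y) \<le> norm (b * strip_kernel r x s y)"
      using mult_left_mono[OF assms(3)[of y] kernel_nonneg[OF assms(1), of y]] kernel_nonneg[OF assms(1), of y]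
      by (simp add: abs_mult mult_ac)
  qed
  show "(\<lambda>y. strip_kernel r x s y * u y) \<in> borel_measurable lborel" by measurable
qed

text \<open>The growth bound on \<open>F\<close> admits exponentials as well as the identity, which correspond to powers and
  to the logarithm on the annulus.\<close>
lemma poisson_formula:
  fixes F :: "complex \<Rightarrow> complex"
  assumes F: "F holomorphic_on UNIV" and C: "\<And>w. \<bar>Re w\<bar> \<le> r \<Longrightarrow> norm (F w) \<le> C * (1 + \<bar>Im w\<bar>)"
    and b: "\<And>w. \<bar>Re w\<bar> \<le> r \<Longrightarrow> \<bar>Re (F w)\<bar> \<le> b"
  shows "(\<integral>y. strip_kernel r x 1 y * Re (F (Complex r y)) \<partial>lborel)
    + (\<integral>y. strip_kernel r x (- 1) y * Re (F (Complex (- r) y)) \<partial>lborel) = Re (F (of_real x))"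
proof -
  define f where "f s y = strip_kernel r x s y * Re (F (Complex (s * r) y))" for s y
  have cF: "continuous_on A (\<lambda>y. F (Complex (s * r) y))" for s A
  proof -
    have "continuous_on A (\<lambda>y. Complex (s * r) y)"
      unfolding Complex_eq by (intro continuous_intros)
    then show ?thesis
      by (rule continuous_on_compose2[OF holomorphic_on_imp_continuous_on[OF F]]) simp
  qed
  have int: "integrable lborel (f s)" if "\<bar>s\<bar> = 1" for s
    unfolding f_def using that r
    by (intro integrable_kernel_mult[where b=b] borel_measurable_continuous_onI continuous_intros cF b)
      (auto simp: abs_mult)
  let ?f = "\<lambda>y. of_real (strip_kernel r x 1 y) * F (Complex r y)
      + of_real (strip_kernel r x (- 1) y) * F (Complex (- r) y)"
  have "(\<lambda>n. Re (integral {- real (Suc n)..real (Suc n)} ?f) - Re (F (of_real x))) \<longlonglongrightarrow> 0"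
  proof (rule Lim_null_comparison[OF _ rectangle_error_tendsto])
    show "\<forall>\<^sub>F n in sequentially. norm (Re (integral {- real (Suc n)..real (Suc n)} ?f) - Re (F (of_real x)))
        \<le> cos \<phi> * C * (1 + real (Suc n)) / (sinh (pi * real (Suc n) / (2 * r)) - 1)"
      using sinh_gt_1_eventually
    proof eventually_elim
      case (elim n)
      have "norm (Re (integral {- real (Suc n)..real (Suc n)} ?f) - Re (F (of_real x)))
          \<le> norm (integral {- real (Suc n)..real (Suc n)} ?f - F (of_real x))"
        unfolding minus_complex.sel(1)[symmetric] real_norm_def by (rule abs_Re_le_cmod)
      also have "\<dots> \<le> cos \<phi> * C * (1 + real (Suc n)) / (sinh (pi * real (Suc n) / (2 * r)) - 1)"
        by (rule rectangle_formula[OF F C _ elim]) auto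
      finally show ?case .
    qed
  qed
  then have 1: "(\<lambda>n. Re (integral {- real (Suc n)..real (Suc n)} ?f)) \<longlonglongrightarrow> Re (F (of_real x))"
    by (simp add: LIM_zero_iff)
  have "Re (integral {- real (Suc n)..real (Suc n)} ?f) = integral {- real (Suc n)..real (Suc n)} (\<lambda>y. f 1 y + f (- 1) y)" for n
  proof -
    let ?I = "{- real (Suc n)..real (Suc n)}"
    have "continuous_on ?I ?f"
      using cF[of _ 1] cF[of _ "-1"] by (intro continuous_intros continuous_kernel) auto
    then have "(?f has_integral integral ?I ?f) ?I"
      by (intro integrable_integral integrable_continuous_real)
    from has_integral_Re[OF this] show ?thesis
      by (intro integral_unique[symmetric]) (simp add: f_def)
  qed
  with 1 have 2: "(\<lambda>n. integral {- real (Suc n)..real (Suc n)} (\<lambda>y. f 1 y + f (- 1) y)) \<longlonglongrightarrow> Re (F (of_real x))"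
    by simp
  have "(\<lambda>n. integral {- real (Suc n)..real (Suc n)} (\<lambda>y. f 1 y + f (- 1) y))
      \<longlonglongrightarrow> (\<integral>y. f 1 y + f (- 1) y \<partial>lborel)"
    by (intro set_integral_symmetric_limit Bochner_Integration.integrable_add int) auto
  from LIMSEQ_unique[OF this 2] show ?thesis
    using int[of 1] int[of "-1"] by (subst (asm) Bochner_Integration.integral_add) (simp_all add: f_def[abs_def])
qed

end

section \<open>Harmonic polynomials determine measures on two circles\<close>

text \<open>The boundary of the annulus.\<close>
definition two_circles :: "real \<Rightarrow> complex set" where
  "two_circles r = {z. norm z = exp r \<or> norm z = exp (- r)}"

text \<open>Polynomials in \<open>Re z\<close> and \<open>Im z\<close>, written in the coordinates \<open>z\<close> and \<open>cnj z\<close>.\<close>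
inductive monomial_sum :: "(complex \<Rightarrow> complex) \<Rightarrow> bool" where
  mono: "monomial_sum (\<lambda>z. c * z ^ j * cnj z ^ k)"
| add: "monomial_sum f \<Longrightarrow> monomial_sum g \<Longrightarrow> monomial_sum (\<lambda>z. f z + g z)"

lemma monomial_sum_mult:
  assumes "monomial_sum f" "monomial_sum g"
  shows "monomial_sum (\<lambda>z. f z * g z)"
  using assms
proof (induction f rule: monomial_sum.induct)
  case (mono c j k)
  from mono.prems show ?case
  proof (induction g rule: monomial_sum.induct)
    case (mono d l m)
    have "(\<lambda>z. c * z ^ j * cnj z ^ k * (d * z ^ l * cnj z ^ m)) = (\<lambda>z. (c * d) * z ^ (j + l) * cnj z ^ (k + m))"
      by (simp add: power_add mult_ac)
    then show ?case by (simp only: monomial_sum.mono)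
  next
    case (add g1 g2)
    then show ?case using monomial_sum.add by (simp add: distrib_left)
  qed
next
  case (add f1 f2)
  then show ?case using monomial_sum.add by (simp add: distrib_right)
qed

lemma real_polynomial_monomial_sum:
  assumes "real_polynomial_function p"
  shows "monomial_sum (\<lambda>z. of_real (p z))"
  using assms
proof (induction rule: real_polynomial_function.induct)
  case (linear f)
  then interpret bounded_linear f .
  define a where "a = complex_of_real (f 1) / 2"
  define b where "b = \<i> * complex_of_real (f \<i>) / 2"
  have "of_real (f z) = (a - b) * z ^ 1 * cnj z ^ 0 + (a + b) * z ^ 0 * cnj z ^ 1" for z
  proof -
    have "f z = f (Re z *\<^sub>R 1 + Im z *\<^sub>R \<i>)" by (metis complex_eq mult.commute scaleR_conv_of_real mult.right_neutral)
    also have "\<dots> = Re z * f 1 + Im z * f \<i>" by (simp add: add scaleR)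
    finally show ?thesis by (simp add: a_def b_def complex_eq_iff algebra_simps)
  qed
  then show ?case by (simp only: monomial_sum.intros)
next
  case (const c)
  have "(\<lambda>_. complex_of_real c) = (\<lambda>z. of_real c * z ^ 0 * cnj z ^ 0)" by simp
  then show ?case by (simp only: monomial_sum.mono)
qed (simp_all add: monomial_sum.add monomial_sum_mult)

lemma measurable_powi [measurable]: "(\<lambda>z::complex. z powi n) \<in> borel_measurable borel"
  unfolding power_int_def by measurable

text \<open>
  Put \<open>m = j - k\<close>, so that \<open>z\<^sup>j (cnj z)\<^sup>k = z\<^sup>m (z cnj z)\<^sup>k\<close>. On the two circles the second factor takes only
  two values, and can be interpolated there by \<open>1\<close> and another function of the modulus: for
  \<open>m \<noteq> 0\<close> by a power of the modulus that turns \<open>z\<^sup>m\<close> into the conjugate of its inverse, and for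
  \<open>m = 0\<close> by the logarithm. Either choice gives a harmonic function.
\<close>
lemma monomial_on_two_circles:
  assumes r: "0 < r"
  shows "\<exists>c1 n1 c2 n2 \<beta>. \<forall>z\<in>two_circles r. Re (c * z ^ j * cnj z ^ k) =
    Re (c1 * z powi n1) + Re (c2 * z powi n2) + \<beta> * ln (norm z)"
proof (cases "j = k")
  case True
  define \<beta> where "\<beta> = Re c * (exp (2 * k * r) - exp (- (2 * k * r))) / (2 * r)"
  define \<alpha> where "\<alpha> = Re c * (exp (2 * k * r) + exp (- (2 * k * r))) / 2"
  have "Re (c * z ^ j * cnj z ^ k) = Re (of_real \<alpha> * z powi 0) + Re (0 * z powi 0) + \<beta> * ln (norm z)"
    if z: "z \<in> two_circles r" for z
  proof -
    obtain s :: real where s: "norm z = exp (s * r)" "s = 1 \<or> s = - 1"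
      using z that[of 1] that[of "- 1"] by (auto simp: two_circles_def)
    have "c * z ^ j * cnj z ^ k = c * (z * cnj z) ^ k"
      using True by (simp add: power_mult_distrib)
    also have "(z * cnj z) ^ k = of_real (norm z ^ (2 * k))"
      by (simp add: complex_norm_square[symmetric] power_mult)
    also have "norm z ^ (2 * k) = exp (2 * k * (s * r))"
      unfolding s(1) by (simp add: exp_of_nat_mult[symmetric])
    finally have "c * z ^ j * cnj z ^ k = c * of_real (exp (2 * k * (s * r)))" .
    then have "Re (c * z ^ j * cnj z ^ k) = Re c * exp (2 * k * (s * r))" by (simp only:) simp
    also have "\<dots> = \<alpha> + \<beta> * (s * r)"
      using s(2) r by (auto simp: \<alpha>_def \<beta>_def field_simps)
    finally show ?thesis unfolding s(1) by simp
  qed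
  then show ?thesis by blast
next
  case False
  define m where "m = int j - int k"
  have m0: "m \<noteq> 0" using False by (simp add: m_def)
  define d where "d = exp (- 2 * of_int m * r) - exp (2 * of_int m * r)"
  have d0: "d \<noteq> 0" using m0 r by (simp add: d_def)
  define \<beta> where "\<beta> = (exp (2 * k * r) - exp (- (2 * k * r))) / d"
  define \<alpha> where "\<alpha> = exp (2 * k * r) - \<beta> * exp (- 2 * of_int m * r)"
  have "Re (c * z ^ j * cnj z ^ k) = Re (of_real \<alpha> * c * z powi m) + Re (of_real \<beta> * cnj c * z powi (- m)) + 0 * ln (norm z)"
    if z: "z \<in> two_circles r" for z
  proof -
    obtain s :: real where s: "norm z = exp (s * r)" "s = 1 \<or> s = - 1"
      using z that[of 1] that[of "- 1"] by (auto simp: two_circles_def)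
    have z0: "z \<noteq> 0" using s(1) by auto
    have zj: "z ^ j = z powi m * z ^ k"
      using power_int_add[of z m "int k"] z0 by (simp add: m_def)
    have nk: "z ^ k * cnj z ^ k = of_real (norm z ^ (2 * k))"
      by (simp add: complex_norm_square[symmetric] power_mult power_mult_distrib[symmetric])
    have "norm z ^ (2 * k) = exp (2 * k * (s * r))"
      unfolding s(1) by (simp add: exp_of_nat_mult[symmetric])
    moreover have "exp (2 * k * (s * r)) = \<alpha> + \<beta> * exp (- 2 * of_int m * (s * r))"
    proof -
      have "\<beta> * d = exp (2 * k * r) - exp (- (2 * k * r))" using d0 by (simp add: \<beta>_def)
      then have "\<alpha> + \<beta> * exp (2 * of_int m * r) = exp (- (2 * k * r))"
        by (simp add: \<alpha>_def d_def algebra_simps)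
      then show ?thesis using s(2) by (auto simp: \<alpha>_def)
    qed
    ultimately have e: "norm z ^ (2 * k) = \<alpha> + \<beta> * exp (- 2 * of_int m * (s * r))" by simp
    have zm: "z powi m * of_real (exp (- 2 * of_int m * (s * r))) = cnj (z powi (- m))"
    proof -
      have "z powi m * cnj (z powi m) = of_real ((norm (z powi m))\<^sup>2)"
        by (rule complex_norm_square[symmetric])
      also have "(norm (z powi m))\<^sup>2 = exp (2 * of_int m * (s * r))"
        by (simp add: norm_power_int s(1) exp_power_int exp_double[symmetric] mult.assoc)
      finally have *: "z powi m * cnj (z powi m) = of_real (exp (2 * of_int m * (s * r)))" .
      have "z powi m * of_real (exp (- 2 * of_int m * (s * r)))
          = z powi m * cnj (z powi m) * cnj (z powi (- m)) * of_real (exp (- 2 * of_int m * (s * r)))"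
        using z0 by (simp add: power_int_minus)
      also have "\<dots> = cnj (z powi (- m))"
        unfolding * by (simp add: exp_minus)
      finally show ?thesis .
    qed
    have "c * z ^ j * cnj z ^ k = c * z powi m * (z ^ k * cnj z ^ k)"
      by (simp add: zj mult_ac)
    also have "\<dots> = of_real \<alpha> * c * z powi m + of_real \<beta> * c * (z powi m * of_real (exp (- 2 * of_int m * (s * r))))"
      unfolding nk e by (simp add: algebra_simps)
    also have "\<dots> = of_real \<alpha> * c * z powi m + cnj (of_real \<beta> * cnj c * z powi (- m))"
      unfolding zm by simp
    finally show ?thesis by (simp del: complex_cnj_mult)
  qed
  then show ?thesis by blast
qed

lemma compact_two_circles: "compact (two_circles r)"
proof -
  have "two_circles r = sphere 0 (exp r) \<union> sphere 0 (exp (- r))"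
    by (auto simp: two_circles_def)
  then show ?thesis by (simp add: compact_Un)
qed

text \<open>A probability measure on the two circles that integrates powers and logarithm to their values at
  the point \<open>exp x\<close>, as the distribution of the exit point does.\<close>
locale harmonic_measure_two_circles = strip + prob_space \<mu> for \<mu> :: "complex measure" +
  assumes sets_\<mu> [measurable_cong, simp]: "sets \<mu> = sets borel"
    and supp: "AE z in \<mu>. z \<in> two_circles r"
    and power: "\<And>c n. (\<integral>z. Re (c * z powi n) \<partial>\<mu>) = Re (c * exp (of_real x) powi n)"
    and log: "(\<integral>z. ln (norm z) \<partial>\<mu>) = x"
begin

definition side :: "real \<Rightarrow> real \<Rightarrow> complex" where "side s y = exp (Complex (s * r) y)"

lemma measurable_side [measurable]: "side s \<in> borel_measurable borel"
  unfolding side_def[abs_def] Complex_eq by (intro borel_measurable_continuous_onI continuous_intros)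

lemma norm_side: "norm (side s y) = exp (s * r)"
  by (simp add: side_def)

lemma side_in: "\<bar>s\<bar> = 1 \<Longrightarrow> side s y \<in> two_circles r"
  by (auto simp: two_circles_def norm_side abs_if split: if_splits)

definition I :: "real \<Rightarrow> (complex \<Rightarrow> real) \<Rightarrow> real" where
  "I s g = (\<integral>y. strip_kernel r x s y * g (side s y) \<partial>lborel)"

definition admissible :: "(complex \<Rightarrow> real) \<Rightarrow> bool" where
  "admissible g \<longleftrightarrow> g \<in> borel_measurable borel \<and> (\<exists>b. \<forall>z\<in>two_circles r. \<bar>g z\<bar> \<le> b)"

text \<open>The difference between integration against \<open>\<mu>\<close> and the Poisson integral; the aim is \<open>D = 0\<close>.\<close>
definition D :: "(complex \<Rightarrow> real) \<Rightarrow> real" where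
  "D g = (\<integral>z. g z \<partial>\<mu>) - I 1 g - I (- 1) g"

lemma admissible_continuous: "continuous_on (two_circles r) g \<Longrightarrow> g \<in> borel_measurable borel \<Longrightarrow> admissible g"
  using compact_continuous_image[OF _ compact_two_circles, of r g]
  by (auto simp: admissible_def dest!: compact_imp_bounded simp: bounded_iff)

lemma admissible_add: "admissible f \<Longrightarrow> admissible g \<Longrightarrow> admissible (\<lambda>z. f z + g z)"
proof -
  assume "admissible f" "admissible g"
  then obtain b d where *: "f \<in> borel_measurable borel" "g \<in> borel_measurable borel"
      "\<And>z. z \<in> two_circles r \<Longrightarrow> \<bar>f z\<bar> \<le> b" "\<And>z. z \<in> two_circles r \<Longrightarrow> \<bar>g z\<bar> \<le> d"
    unfolding admissible_def by blast
  have "\<bar>f z + g z\<bar> \<le> b + d" if "z \<in> two_circles r" for z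
    using *(3,4)[OF that] by linarith
  then show ?thesis using *(1,2) unfolding admissible_def by (intro conjI exI[of _ "b + d"]) auto
qed

lemma admissible_cmult: "admissible f \<Longrightarrow> admissible (\<lambda>z. c * f z)"
proof -
  assume "admissible f"
  then obtain b where *: "f \<in> borel_measurable borel" "\<And>z. z \<in> two_circles r \<Longrightarrow> \<bar>f z\<bar> \<le> b"
    unfolding admissible_def by blast
  have "\<bar>c * f z\<bar> \<le> \<bar>c\<bar> * b" if "z \<in> two_circles r" for z
    unfolding abs_mult using *(2)[OF that] by (intro mult_left_mono) auto
  then show ?thesis using *(1) unfolding admissible_def by (intro conjI exI[of _ "\<bar>c\<bar> * b"]) auto
qed

lemma integrable_admissible:
  assumes "admissible g"
  shows "integrable \<mu> g" "\<bar>s\<bar> = 1 \<Longrightarrow> integrable lborel (\<lambda>y. strip_kernel r x s y * g (side s y))"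
proof -
  obtain b where [measurable]: "g \<in> borel_measurable borel" and b: "\<And>z. z \<in> two_circles r \<Longrightarrow> \<bar>g z\<bar> \<le> b"
    using assms unfolding admissible_def by blast
  show "integrable \<mu> g"
    using supp b by (intro integrable_const_bound[of _ b]) auto
  show "integrable lborel (\<lambda>y. strip_kernel r x s y * g (side s y))" if "\<bar>s\<bar> = 1"
    using that b side_in by (intro integrable_kernel_mult[where b=b]) auto
qed

lemma D_add: "admissible f \<Longrightarrow> admissible g \<Longrightarrow> D (\<lambda>z. f z + g z) = D f + D g"
  using integrable_admissible[of f] integrable_admissible[of g] by (simp add: D_def I_def distrib_left)

lemma D_cmult: "D (\<lambda>z. c * f z) = c * D f"
  by (simp add: D_def I_def mult.left_commute[of _ c] right_diff_distrib)

lemma D_cong: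
  assumes "admissible f" "admissible g" "\<And>z. z \<in> two_circles r \<Longrightarrow> f z = g z"
  shows "D f = D g"
proof -
  have [measurable]: "f \<in> borel_measurable borel" "g \<in> borel_measurable borel"
    using assms unfolding admissible_def by auto
  have "(\<integral>z. f z \<partial>\<mu>) = (\<integral>z. g z \<partial>\<mu>)"
    by (rule integral_cong_AE) (use supp assms(3) in auto)
  then show ?thesis using assms(3)[OF side_in] by (simp add: D_def I_def)
qed

lemma two_circles_nonzero: "(\<And>z. z \<in> two_circles r \<Longrightarrow> z \<noteq> 0)"
  by (auto simp: two_circles_def)

text \<open>Under \<open>z = exp w\<close> the power becomes an exponential of \<open>w\<close>, a bounded function on the strip.\<close>
lemma D_power: "admissible (\<lambda>z. Re (c * z powi n))" "D (\<lambda>z. Re (c * z powi n)) = 0"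
proof -
  have "continuous_on (two_circles r) (\<lambda>z. Re (c * z powi n))"
    using two_circles_nonzero by (intro continuous_intros) auto
  then show "admissible (\<lambda>z. Re (c * z powi n))"
    by (rule admissible_continuous) measurable
  define F where "F w = c * exp (of_int n * w)" for w :: complex
  have F: "norm (F w) \<le> norm c * exp (\<bar>of_int n\<bar> * r)" if "\<bar>Re w\<bar> \<le> r" for w
  proof -
    have "of_int n * Re w \<le> \<bar>of_int n * Re w\<bar>" by simp
    also have "\<dots> \<le> \<bar>of_int n\<bar> * r" unfolding abs_mult using that by (intro mult_left_mono) auto
    finally show ?thesis by (simp add: F_def norm_mult mult_left_mono)
  qed
  have "(\<integral>y. strip_kernel r x 1 y * Re (F (Complex r y)) \<partial>lborel)
    + (\<integral>y. strip_kernel r x (- 1) y * Re (F (Complex (- r) y)) \<partial>lborel) = Re (F (of_real x))"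
  proof (rule poisson_formula)
    show "F holomorphic_on UNIV" unfolding F_def[abs_def] by (intro holomorphic_intros)
    show "norm (F w) \<le> norm c * exp (\<bar>of_int n\<bar> * r) * (1 + \<bar>Im w\<bar>)" if "\<bar>Re w\<bar> \<le> r" for w
    proof -
      have "norm c * exp (\<bar>of_int n\<bar> * r) * 1 \<le> norm c * exp (\<bar>of_int n\<bar> * r) * (1 + \<bar>Im w\<bar>)"
        by (intro mult_left_mono) auto
      then show ?thesis using F[OF that] by simp
    qed
    show "\<bar>Re (F w)\<bar> \<le> norm c * exp (\<bar>of_int n\<bar> * r)" if "\<bar>Re w\<bar> \<le> r" for w
      using F[OF that] abs_Re_le_cmod[of "F w"] by linarith
  qed
  moreover have "F w = c * exp w powi n" for w by (simp add: F_def exp_power_int)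
  ultimately show "D (\<lambda>z. Re (c * z powi n)) = 0"
    by (simp only: D_def power) (simp add: I_def side_def)
qed

lemma D_ln: "admissible (\<lambda>z. ln (norm z))" "D (\<lambda>z. ln (norm z)) = 0"
proof -
  have "continuous_on (two_circles r) (\<lambda>z. ln (norm z))"
    using two_circles_nonzero by (intro continuous_intros) auto
  then show "admissible (\<lambda>z. ln (norm z))"
    by (rule admissible_continuous) measurable
  have "(\<integral>y. strip_kernel r x 1 y * Re (Complex r y) \<partial>lborel)
    + (\<integral>y. strip_kernel r x (- 1) y * Re (Complex (- r) y) \<partial>lborel) = Re (of_real x)"
  proof (rule poisson_formula)
    show "norm w \<le> (r + 1) * (1 + \<bar>Im w\<bar>)" if "\<bar>Re w\<bar> \<le> r" for w
    proof -
      have "0 \<le> r * \<bar>Im w\<bar>" using r by simp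
      moreover have "(r + 1) * (1 + \<bar>Im w\<bar>) = r + r * \<bar>Im w\<bar> + 1 + \<bar>Im w\<bar>" by (simp add: algebra_simps)
      ultimately show ?thesis using cmod_le[of w] that by linarith
    qed
  qed (auto simp: holomorphic_on_ident)
  then show "D (\<lambda>z. ln (norm z)) = 0"
    by (simp only: D_def log) (simp add: I_def norm_side)
qed

lemma D_monomial_sum:
  assumes "monomial_sum q"
  shows "continuous_on UNIV q \<and> D (\<lambda>z. Re (q z)) = 0"
  using assms
proof (induction rule: monomial_sum.induct)
  case (mono c j k)
  obtain c1 n1 c2 n2 \<beta> where eq: "\<And>z. z \<in> two_circles r \<Longrightarrow> Re (c * z ^ j * cnj z ^ k) =
    Re (c1 * z powi n1) + Re (c2 * z powi n2) + \<beta> * ln (norm z)"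
    using monomial_on_two_circles[OF r, of c j k] by blast
  have cont: "continuous_on A (\<lambda>z. c * z ^ j * cnj z ^ k)" for A
    by (intro continuous_intros)
  then have "admissible (\<lambda>z. Re (c * z ^ j * cnj z ^ k))"
    by (intro admissible_continuous borel_measurable_continuous_onI continuous_intros)
  then have "D (\<lambda>z. Re (c * z ^ j * cnj z ^ k)) = D (\<lambda>z. Re (c1 * z powi n1) + Re (c2 * z powi n2) + \<beta> * ln (norm z))"
    by (intro D_cong admissible_add admissible_cmult D_power D_ln eq)
  also have "\<dots> = 0"
    using D_power(1)[of c1 n1] D_power(1)[of c2 n2] D_ln(1)
    by (simp only: D_add admissible_add admissible_cmult D_cmult D_power(2) D_ln(2))
  finally show ?case using cont by simp
next
  case (add f g)
  have "admissible (\<lambda>z. Re (h z))" if "continuous_on UNIV h" for h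
    using that by (intro admissible_continuous borel_measurable_continuous_onI continuous_intros) (auto intro: continuous_on_subset)
  then show ?case using add.IH by (simp add: D_add continuous_on_add)
qed

lemma D_one: "D (\<lambda>_. 1) = 0"
  using D_power(2)[of 1 0] by simp

text \<open>Uniform approximation by polynomials suffices because \<open>D\<close> is a difference of two probability
  measures: the Poisson integral has mass \<open>1\<close> by \<open>D 1 = 0\<close>.\<close>
lemma D_continuous:
  assumes g: "continuous_on UNIV g"
  shows "D g = 0"
proof -
  have adm: "admissible h" if "continuous_on UNIV h" for h
    using that by (intro admissible_continuous borel_measurable_continuous_onI) (auto intro: continuous_on_subset)
  have "\<bar>D g\<bar> \<le> e" if e: "0 < e" for e
  proof -
    obtain p where p: "real_polynomial_function p" "\<And>z. z \<in> two_circles r \<Longrightarrow> \<bar>g z - p z\<bar> < e / 2"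
      using Stone_Weierstrass_real_polynomial_function[OF compact_two_circles continuous_on_subset[OF g], of r "e / 2"] e
      by auto
    have Dp: "D p = 0" and cp: "continuous_on UNIV p"
      using D_monomial_sum[OF real_polynomial_monomial_sum[OF p(1)]] continuous_real_polymonial_function[OF p(1)]
      by (auto simp: continuous_on_eq_continuous_within)
    define h where "h z = g z - p z" for z
    have h: "admissible h" unfolding h_def[abs_def] using g cp by (intro adm continuous_intros)
    have he: "\<bar>h z\<bar> \<le> e / 2" if "z \<in> two_circles r" for z using p(2)[OF that] by (simp add: h_def)
    have "D g = D (\<lambda>z. h z + p z)" by (simp add: h_def)
    also have "\<dots> = D h" using D_add[OF h adm[OF cp]] Dp by simp
    finally have Dgh: "D g = D h" .
    have 1: "\<bar>\<integral>z. h z \<partial>\<mu>\<bar> \<le> e / 2"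
    proof -
      have "\<bar>\<integral>z. h z \<partial>\<mu>\<bar> \<le> (\<integral>z. \<bar>h z\<bar> \<partial>\<mu>)" by (rule integral_abs_bound)
      also have "\<dots> \<le> (\<integral>z. e / 2 \<partial>\<mu>)"
        using integrable_admissible(1)[OF h] supp he by (intro integral_mono_AE) auto
      finally show ?thesis using prob_space by simp
    qed
    have 2: "\<bar>I s h\<bar> \<le> e / 2 * I s (\<lambda>_. 1)" if s: "\<bar>s\<bar> = 1" for s
    proof -
      have "\<bar>I s h\<bar> \<le> (\<integral>y. \<bar>strip_kernel r x s y * h (side s y)\<bar> \<partial>lborel)"
        unfolding I_def by (rule integral_abs_bound)
      also have "\<dots> \<le> (\<integral>y. e / 2 * strip_kernel r x s y \<partial>lborel)"
      proof (rule integral_mono)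
        show "integrable lborel (\<lambda>y. \<bar>strip_kernel r x s y * h (side s y)\<bar>)"
          using integrable_admissible(2)[OF h s] by simp
        show "integrable lborel (\<lambda>y. e / 2 * strip_kernel r x s y)"
          using integrable_kernel[OF s] by simp
        show "\<bar>strip_kernel r x s y * h (side s y)\<bar> \<le> e / 2 * strip_kernel r x s y" for y
          using mult_left_mono[OF he[OF side_in[OF s]] kernel_nonneg[OF s]] kernel_nonneg[OF s, of y]
          by (simp add: abs_mult mult_ac)
      qed
      finally show ?thesis by (simp add: I_def)
    qed
    have "I 1 (\<lambda>_. 1) + I (- 1) (\<lambda>_. 1) = 1"
      using D_one prob_space by (simp add: D_def)
    then have "e / 2 * I 1 (\<lambda>_. 1) + e / 2 * I (- 1) (\<lambda>_. 1) = e / 2"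
      by (metis distrib_left mult.right_neutral)
    then show ?thesis
      using 1 2[of 1] 2[of "-1"] unfolding Dgh by (simp add: D_def)
  qed
  then show ?thesis by (metis abs_ge_zero antisym abs_eq_0 field_le_epsilon add.left_neutral)
qed

lemma D_closed:
  assumes S: "closed S"
  shows "D (indicator S) = 0"
proof (cases "S = {}")
  case True
  then show ?thesis by (simp add: D_def I_def)
next
  case False
  define g where "g n z = max 0 (1 - real n * infdist z S)" for n z
  have g01: "\<bar>g n z\<bar> \<le> 1" for n z by (auto simp: g_def infdist_nonneg)
  have gc: "continuous_on UNIV (g n)" for n unfolding g_def[abs_def] by (intro continuous_intros)
  have [measurable]: "g n \<in> borel_measurable borel" for n using gc by (rule borel_measurable_continuous_onI)
  have [measurable]: "S \<in> sets borel" using S by simp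
  have lim: "(\<lambda>n. g n z) \<longlonglongrightarrow> indicator S z" for z
  proof (cases "z \<in> S")
    case True
    then show ?thesis by (simp add: g_def)
  next
    case F: False
    then have "0 < infdist z S"
      using in_closed_iff_infdist_zero[OF S False] infdist_nonneg[of z S] by (simp add: less_le)
    then obtain N where N: "1 < real N * infdist z S" using reals_Archimedean3 by blast
    have "g n z = 0" if "N \<le> n" for n
    proof -
      have "real N * infdist z S \<le> real n * infdist z S"
        using that infdist_nonneg by (intro mult_right_mono) auto
      then show ?thesis using N by (simp add: g_def)
    qed
    then have "\<forall>\<^sub>F n in sequentially. g n z = 0"
      unfolding eventually_sequentially by blast
    then show ?thesis using F by (simp add: tendsto_eventually)
  qed
  have 1: "(\<lambda>n. \<integral>z. g n z \<partial>\<mu>) \<longlonglongrightarrow> (\<integral>z. indicator S z \<partial>\<mu>)"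
    by (rule integral_dominated_convergence[where w="\<lambda>_. 1"]) (use lim g01 in auto)
  have 2: "(\<lambda>n. I s (g n)) \<longlonglongrightarrow> I s (indicator S)" if s: "\<bar>s\<bar> = 1" for s
    unfolding I_def
  proof (rule integral_dominated_convergence[where w="strip_kernel r x s"])
    show "integrable lborel (strip_kernel r x s)" by (rule integrable_kernel[OF s])
    show "AE y in lborel. (\<lambda>n. strip_kernel r x s y * g n (side s y)) \<longlonglongrightarrow> strip_kernel r x s y * indicator S (side s y)"
      by (intro AE_I2 tendsto_intros lim)
    show "AE y in lborel. norm (strip_kernel r x s y * g n (side s y)) \<le> strip_kernel r x s y" for n
      using mult_left_mono[OF g01 kernel_nonneg[OF s]] kernel_nonneg[OF s] by (auto simp: abs_mult)
  qed measurable
  have "(\<lambda>n. D (g n)) \<longlonglongrightarrow> D (indicator S)"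
    unfolding D_def by (intro tendsto_diff 1 2) auto
  then show ?thesis unfolding D_continuous[OF gc] by (simp add: LIMSEQ_const_iff)
qed

text \<open>The measure is the image, under the exponential map, of harmonic measure of the strip.\<close>
lemma measure_eq:
  assumes "sets \<nu> = sets borel"
    and \<nu>: "\<And>S. S \<in> sets borel \<Longrightarrow> emeasure \<nu> S =
      (\<integral>\<^sup>+y. ennreal (strip_kernel r x 1 y) * indicator S (side 1 y) \<partial>lborel)
      + (\<integral>\<^sup>+y. ennreal (strip_kernel r x (- 1) y) * indicator S (side (- 1) y) \<partial>lborel)"
  shows "\<mu> = \<nu>"
proof (rule measure_eqI_generator_eq[where E="Collect closed" and A="\<lambda>_. UNIV" and \<Omega>=UNIV])
  show "Int_stable (Collect closed :: complex set set)"
    by (auto simp: Int_stable_def)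
  have b: "sets (borel :: complex measure) = sigma_sets UNIV (Collect closed)"
    unfolding borel_eq_closed by simp
  then show "sets \<mu> = sigma_sets UNIV (Collect closed)" "sets \<nu> = sigma_sets UNIV (Collect closed)"
    using assms(1) by simp_all
  show "emeasure \<mu> S = emeasure \<nu> S" if "S \<in> Collect closed" for S
  proof -
    have S: "closed S" using that by simp
    then have [measurable]: "S \<in> sets borel" by simp
    have adm: "admissible (indicator S)" unfolding admissible_def by (auto simp: indicator_def intro!: exI[of _ 1])
    have k: "(\<integral>\<^sup>+y. ennreal (strip_kernel r x s y) * indicator S (side s y) \<partial>lborel) = ennreal (I s (indicator S))"
      if s: "\<bar>s\<bar> = 1" for s
    proof -
      have "(\<integral>\<^sup>+y. ennreal (strip_kernel r x s y) * indicator S (side s y) \<partial>lborel)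
          = (\<integral>\<^sup>+y. ennreal (strip_kernel r x s y * indicator S (side s y)) \<partial>lborel)"
        by (intro nn_integral_cong) (auto simp: indicator_def)
      also have "\<dots> = ennreal (I s (indicator S))"
        unfolding I_def by (rule nn_integral_eq_integral[OF integrable_admissible(2)[OF adm s]]) (auto simp: kernel_nonneg[OF s])
      finally show ?thesis .
    qed
    have I0: "0 \<le> I s (indicator S)" if s: "\<bar>s\<bar> = 1" for s
      unfolding I_def by (intro integral_nonneg_AE) (simp add: kernel_nonneg[OF s])
    have "measure \<mu> S = I 1 (indicator S) + I (- 1) (indicator S)"
      using D_closed[OF S] by (simp add: D_def)
    then have "emeasure \<mu> S = ennreal (I 1 (indicator S)) + ennreal (I (- 1) (indicator S))"
      using I0 by (simp add: emeasure_eq_measure ennreal_plus)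
    then show ?thesis by (simp add: \<nu> k)
  qed
qed auto

end

section \<open>Arclength and wrapping a line around a circle\<close>

lemma nn_integral_arclength:
  assumes fin: "finite \<Gamma>"
    and m: "\<And>\<gamma>. \<gamma> \<in> \<Gamma> \<Longrightarrow> \<gamma> \<in> borel_measurable borel"
      "\<And>\<gamma>. \<gamma> \<in> \<Gamma> \<Longrightarrow> (\<lambda>t. vector_derivative \<gamma> (at t)) \<in> borel_measurable borel"
    and f: "f \<in> borel_measurable borel"
  shows "(\<integral>\<^sup>+z. f z \<partial>arclength \<Gamma>) =
    (\<Sum>\<gamma>\<in>\<Gamma>. \<integral>\<^sup>+t\<in>{0..1}. ennreal (norm (vector_derivative \<gamma> (at t))) * f (\<gamma> t) \<partial>lborel)"
  using f
proof (induction rule: borel_measurable_induct)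
  case (cong f g)
  then show ?case by (simp cong: nn_integral_cong)
next
  case (set A)
  then show ?case using emeasure_arclength[OF fin m] by (simp add: nn_integral_indicator)
next
  case (mult u c)
  note [measurable] = \<open>u \<in> borel_measurable borel\<close>
  have "(\<integral>\<^sup>+t\<in>{0..1}. ennreal (norm (vector_derivative \<gamma> (at t))) * (c * u (\<gamma> t)) \<partial>lborel)
      = c * (\<integral>\<^sup>+t\<in>{0..1}. ennreal (norm (vector_derivative \<gamma> (at t))) * u (\<gamma> t) \<partial>lborel)" if "\<gamma> \<in> \<Gamma>" for \<gamma>
  proof -
    note [measurable] = m[OF that]
    show ?thesis by (subst nn_integral_cmult[symmetric]) (auto simp: mult_ac)
  qed
  then show ?case using mult by (simp add: nn_integral_cmult sum_distrib_left)
next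
  case (add u v)
  note [measurable] = \<open>u \<in> borel_measurable borel\<close> \<open>v \<in> borel_measurable borel\<close>
  have "(\<integral>\<^sup>+t\<in>{0..1}. ennreal (norm (vector_derivative \<gamma> (at t))) * (v (\<gamma> t) + u (\<gamma> t)) \<partial>lborel)
      = (\<integral>\<^sup>+t\<in>{0..1}. ennreal (norm (vector_derivative \<gamma> (at t))) * v (\<gamma> t) \<partial>lborel)
      + (\<integral>\<^sup>+t\<in>{0..1}. ennreal (norm (vector_derivative \<gamma> (at t))) * u (\<gamma> t) \<partial>lborel)" if "\<gamma> \<in> \<Gamma>" for \<gamma>
  proof -
    note [measurable] = m[OF that]
    show ?thesis by (subst nn_integral_add[symmetric]) (auto simp: distrib_left distrib_right)
  qed
  then show ?case using add by (simp add: nn_integral_add sum.distrib)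
next
  case (seq U)
  note [measurable] = seq.hyps(1)
  have sup: "(\<integral>\<^sup>+t\<in>{0..1}. ennreal (norm (vector_derivative \<gamma> (at t))) * (SUP i. U i) (\<gamma> t) \<partial>lborel)
      = (SUP i. \<integral>\<^sup>+t\<in>{0..1}. ennreal (norm (vector_derivative \<gamma> (at t))) * U i (\<gamma> t) \<partial>lborel)"
    and inc: "incseq (\<lambda>i. \<integral>\<^sup>+t\<in>{0..1}. ennreal (norm (vector_derivative \<gamma> (at t))) * U i (\<gamma> t) \<partial>lborel)"
    if "\<gamma> \<in> \<Gamma>" for \<gamma>
  proof -
    note [measurable] = m[OF that]
    let ?g = "\<lambda>i t. ennreal (norm (vector_derivative \<gamma> (at t))) * U i (\<gamma> t) * indicator {0..1} t"
    have i: "incseq ?g"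
      using \<open>incseq U\<close> by (auto simp: incseq_def le_fun_def intro!: mult_mono)
    have "(\<integral>\<^sup>+t. (SUP i. ?g i t) \<partial>lborel) = (SUP i. \<integral>\<^sup>+t. ?g i t \<partial>lborel)"
      by (rule nn_integral_monotone_convergence_SUP[OF i]) measurable
    moreover have "(SUP i. ?g i t) = ennreal (norm (vector_derivative \<gamma> (at t))) * (SUP i. U i) (\<gamma> t) * indicator {0..1} t" for t
      by (simp add: SUP_mult_left_ennreal SUP_mult_right_ennreal image_comp)
    ultimately show "(\<integral>\<^sup>+t\<in>{0..1}. ennreal (norm (vector_derivative \<gamma> (at t))) * (SUP i. U i) (\<gamma> t) \<partial>lborel)
      = (SUP i. \<integral>\<^sup>+t\<in>{0..1}. ennreal (norm (vector_derivative \<gamma> (at t))) * U i (\<gamma> t) \<partial>lborel)" by simp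
    show "incseq (\<lambda>i. \<integral>\<^sup>+t. ?g i t \<partial>lborel)"
      using i by (auto simp: incseq_def le_fun_def intro!: nn_integral_mono)
  qed
  have "(\<integral>\<^sup>+z. (SUP i. U i) z \<partial>arclength \<Gamma>) = (SUP i. \<integral>\<^sup>+z. U i z \<partial>arclength \<Gamma>)"
    using nn_integral_monotone_convergence_SUP[OF \<open>incseq U\<close>, of "arclength \<Gamma>"] by (simp add: image_comp)
  also have "\<dots> = (SUP i. \<Sum>\<gamma>\<in>\<Gamma>. \<integral>\<^sup>+t\<in>{0..1}. ennreal (norm (vector_derivative \<gamma> (at t))) * U i (\<gamma> t) \<partial>lborel)"
    using seq.IH by simp
  also have "\<dots> = (\<Sum>\<gamma>\<in>\<Gamma>. SUP i. \<integral>\<^sup>+t\<in>{0..1}. ennreal (norm (vector_derivative \<gamma> (at t))) * U i (\<gamma> t) \<partial>lborel)"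
    by (rule ennreal_SUP_sum) (rule inc)
  also have "\<dots> = (\<Sum>\<gamma>\<in>\<Gamma>. \<integral>\<^sup>+t\<in>{0..1}. ennreal (norm (vector_derivative \<gamma> (at t))) * (SUP i. U i) (\<gamma> t) \<partial>lborel)"
    by (intro sum.cong refl sup[symmetric])
  finally show ?case .
qed

text \<open>The line is cut into unit intervals, enumerated through a bijection of the integers with the naturals.\<close>
lemma nn_integral_wrap:
  fixes G :: "real \<Rightarrow> ennreal"
  assumes [measurable]: "G \<in> borel_measurable borel"
  shows "(\<integral>\<^sup>+t. G t \<partial>lborel) = (\<integral>\<^sup>+t\<in>{0..1}. (\<Sum>n. G (t + of_int (int_decode n))) \<partial>lborel)"
proof -
  define A where "A n = {real_of_int (int_decode n) ..< real_of_int (int_decode n) + 1}" for n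
  have disj: "disjoint_family A"
    unfolding disjoint_family_on_def
  proof (intro ballI impI)
    fix m n :: nat assume "m \<noteq> n"
    then have "int_decode m \<noteq> int_decode n" by (metis int_decode_inverse)
    then show "A m \<inter> A n = {}" unfolding A_def by auto
  qed
  have G: "G t = (\<Sum>n. G t * indicator (A n) t)" for t
  proof -
    have "t \<in> A (int_encode \<lfloor>t\<rfloor>)" by (simp add: A_def)
    from suminf_cmult_indicator[OF disj this, of "\<lambda>_. G t"] show ?thesis by simp
  qed
  have [measurable]: "A n \<in> sets borel" for n by (simp add: A_def)
  have "(\<integral>\<^sup>+t. G t \<partial>lborel) = (\<integral>\<^sup>+t. (\<Sum>n. G t * indicator (A n) t) \<partial>lborel)"
    by (rule nn_integral_cong) (rule G)
  also have "\<dots> = (\<Sum>n. \<integral>\<^sup>+t. G t * indicator (A n) t \<partial>lborel)"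
    by (rule nn_integral_suminf) measurable
  also have "(\<lambda>n. \<integral>\<^sup>+t. G t * indicator (A n) t \<partial>lborel)
      = (\<lambda>n. \<integral>\<^sup>+t. G (t + of_int (int_decode n)) * indicator {0..1} t \<partial>lborel)"
  proof
    fix n
    have "(\<integral>\<^sup>+t. G t * indicator (A n) t \<partial>lborel)
        = (\<integral>\<^sup>+t. G (of_int (int_decode n) + 1 * t) * indicator (A n) (of_int (int_decode n) + 1 * t) \<partial>lborel)"
      by (subst nn_integral_real_affine[where c=1 and t="of_int (int_decode n)"]) auto
    also have "\<dots> = (\<integral>\<^sup>+t. G (t + of_int (int_decode n)) * indicator {0..1} t \<partial>lborel)"
    proof (rule nn_integral_cong_AE)
      have "AE t::real in lborel. t \<noteq> 1" by (rule AE_lborel_singleton)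
      then show "AE t in lborel. G (of_int (int_decode n) + 1 * t) * indicator (A n) (of_int (int_decode n) + 1 * t)
          = G (t + of_int (int_decode n)) * indicator {0..1} t"
        by eventually_elim (auto simp: A_def indicator_def add.commute)
    qed
    finally show "(\<integral>\<^sup>+t. G t * indicator (A n) t \<partial>lborel)
        = (\<integral>\<^sup>+t. G (t + of_int (int_decode n)) * indicator {0..1} t \<partial>lborel)" .
  qed
  also have "(\<Sum>n. \<integral>\<^sup>+t. G (t + of_int (int_decode n)) * indicator {0..1} t \<partial>lborel)
      = (\<integral>\<^sup>+t. (\<Sum>n. G (t + of_int (int_decode n)) * indicator {0..1} t) \<partial>lborel)"
    by (rule nn_integral_suminf[symmetric]) measurable
  finally show ?thesis by simp
qed

lemma measurable_Arg: "Arg \<in> borel_measurable borel"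
proof -
  have "(\<lambda>z. if z \<in> \<real>\<^sub>\<le>\<^sub>0 then pi else Arg z) \<in> borel_measurable borel"
    by (intro borel_measurable_continuous_on_if continuous_on_Arg) auto
  then have "(\<lambda>z. if z = 0 then 0 else if z \<in> \<real>\<^sub>\<le>\<^sub>0 then pi else Arg z) \<in> borel_measurable borel"
    by measurable
  moreover have "Arg = (\<lambda>z. if z = 0 then 0 else if z \<in> \<real>\<^sub>\<le>\<^sub>0 then pi else Arg z)"
  proof
    fix z
    show "Arg z = (if z = 0 then 0 else if z \<in> \<real>\<^sub>\<le>\<^sub>0 then pi else Arg z)"
    proof (cases "z = 0")
      case False
      then show ?thesis
        by (auto simp: Arg_eq_pi complex_nonpos_Reals_iff complex_eq_iff)
    qed (simp add: Arg_zero)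
  qed
  ultimately show ?thesis by metis
qed

lemma summable_on_inverse_1_plus_int_square: "(\<lambda>k::int. inverse (1 + (real_of_int k)\<^sup>2)) summable_on UNIV"
proof -
  let ?f = "\<lambda>k::int. inverse (1 + (real_of_int k)\<^sup>2)"
  have "summable (\<lambda>n. inverse (1 + (real n)\<^sup>2))"
  proof (rule summable_comparison_test')
    show "summable (\<lambda>n. inverse (real n ^ 2))" by (rule inverse_power_summable) simp
    show "norm (inverse (1 + (real n)\<^sup>2)) \<le> inverse (real n ^ 2)" if "1 \<le> n" for n
      using that by (simp add: field_simps add_nonneg_pos)
  qed
  then have nat: "(\<lambda>n. inverse (1 + (real n)\<^sup>2)) summable_on UNIV"
    by (subst summable_on_UNIV_nonneg_real_iff) auto
  have "?f summable_on range int"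
    using nat by (subst summable_on_reindex) (auto simp: comp_def)
  moreover have "?f summable_on range (\<lambda>n. - int n)"
    using nat by (subst summable_on_reindex) (auto simp: comp_def inj_on_def)
  moreover have "range int \<union> range (\<lambda>n. - int n) = (UNIV :: int set)"
  proof -
    have "k \<in> range int \<union> range (\<lambda>n. - int n)" for k
      by (cases k rule: int_cases2) auto
    then show ?thesis by blast
  qed
  ultimately show ?thesis using summable_on_union by metis
qed

context strip
begin

text \<open>The exponential map wraps each boundary line of the strip around a circle with period \<open>2 \<pi>\<close>.\<close>
definition wrapped_kernel :: "real \<Rightarrow> real \<Rightarrow> real" where
  "wrapped_kernel s \<theta> = (\<Sum>\<^sub>\<infinity>k::int. strip_kernel r x s (\<theta> + 2 * pi * of_int k))"

lemma wrapped_kernel_summable: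
  assumes s: "\<bar>s\<bar> = 1"
  shows "(\<lambda>k::int. strip_kernel r x s (\<theta> + 2 * pi * of_int k)) summable_on UNIV"
proof -
  obtain c where c: "0 < c" "\<And>y. strip_kernel r x s y \<le> c * inverse (1 + y\<^sup>2)"
    using kernel_bound s by metis
  show ?thesis
  proof (rule summable_on_comparison_test)
    show "(\<lambda>k::int. c * (1 + \<theta>\<^sup>2) * inverse (1 + (real_of_int k)\<^sup>2)) summable_on UNIV"
      by (intro summable_on_cmult_right summable_on_inverse_1_plus_int_square)
    fix k :: int
    define y where "y = \<theta> + 2 * pi * of_int k"
    have "(2 * pi * of_int k)\<^sup>2 \<le> 2 * y\<^sup>2 + 2 * \<theta>\<^sup>2"
      using zero_le_power2[of "y + \<theta>"] by (simp add: y_def power2_eq_square algebra_simps)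
    moreover have "2 * (of_int k)\<^sup>2 \<le> (2 * pi * of_int k)\<^sup>2"
    proof -
      have "2 * 1 \<le> (2 * pi) * (2 * pi)" using pi_ge_two by (intro mult_mono) auto
      then have "2 * (of_int k)\<^sup>2 \<le> ((2 * pi) * (2 * pi)) * (of_int k)\<^sup>2" by (intro mult_right_mono) auto
      then show ?thesis by (simp add: power2_eq_square mult_ac)
    qed
    ultimately have "(of_int k)\<^sup>2 \<le> y\<^sup>2 + \<theta>\<^sup>2" by linarith
    moreover have "0 \<le> \<theta>\<^sup>2 * y\<^sup>2" by simp
    moreover have "(1 + \<theta>\<^sup>2) * (1 + y\<^sup>2) = 1 + y\<^sup>2 + \<theta>\<^sup>2 + \<theta>\<^sup>2 * y\<^sup>2" by (simp add: algebra_simps)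
    ultimately have "1 + (of_int k)\<^sup>2 \<le> (1 + \<theta>\<^sup>2) * (1 + y\<^sup>2)" by linarith
    then have "inverse (1 + y\<^sup>2) \<le> (1 + \<theta>\<^sup>2) * inverse (1 + (of_int k)\<^sup>2)"
      by (simp add: field_simps add_pos_nonneg)
    then have "c * inverse (1 + y\<^sup>2) \<le> c * ((1 + \<theta>\<^sup>2) * inverse (1 + (of_int k)\<^sup>2))"
      using c(1) by (intro mult_left_mono) auto
    with c(2)[of y] show "strip_kernel r x s (\<theta> + 2 * pi * of_int k) \<le> c * (1 + \<theta>\<^sup>2) * inverse (1 + (real_of_int k)\<^sup>2)"
      by (simp add: y_def mult.assoc)
  qed (use kernel_nonneg[OF s] in auto)
qed

lemma wrapped_kernel_nonneg: "\<bar>s\<bar> = 1 \<Longrightarrow> 0 \<le> wrapped_kernel s \<theta>"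
  unfolding wrapped_kernel_def by (intro infsum_nonneg kernel_nonneg)

lemma wrapped_kernel_eq_suminf:
  assumes s: "\<bar>s\<bar> = 1"
  shows "ennreal (wrapped_kernel s \<theta>) = (\<Sum>n. ennreal (strip_kernel r x s (\<theta> + 2 * pi * of_int (int_decode n))))"
proof -
  let ?f = "\<lambda>k::int. strip_kernel r x s (\<theta> + 2 * pi * of_int k)"
  have "(\<lambda>n. ?f (int_decode n)) summable_on UNIV"
    using wrapped_kernel_summable[OF s] by (subst summable_on_reindex_bij_betw[OF bij_int_decode])
  moreover have "wrapped_kernel s \<theta> = (\<Sum>\<^sub>\<infinity>n. ?f (int_decode n))"
    unfolding wrapped_kernel_def by (rule infsum_reindex_bij_betw[OF bij_int_decode, symmetric])
  ultimately have "(\<lambda>n. ?f (int_decode n)) sums wrapped_kernel s \<theta>"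
    by (metis has_sum_imp_sums has_sum_infsum)
  then show ?thesis
    using kernel_nonneg[OF s] by (subst suminf_ennreal2) (auto simp: sums_iff)
qed

lemma wrapped_kernel_periodic: "wrapped_kernel s (\<theta> + 2 * pi * of_int m) = wrapped_kernel s \<theta>"
proof -
  have bij: "bij_betw (\<lambda>k::int. m + k) UNIV UNIV" by (rule bij_betwI[where g="\<lambda>k. k - m"]) auto
  show ?thesis
    unfolding wrapped_kernel_def
    by (subst infsum_reindex_bij_betw[OF bij, symmetric]) (simp add: algebra_simps)
qed

lemma measurable_wrapped_kernel:
  assumes "\<bar>s\<bar> = 1"
  shows "wrapped_kernel s \<in> borel_measurable borel"
proof -
  have "(\<lambda>\<theta>. \<Sum>n. ennreal (strip_kernel r x s (\<theta> + 2 * pi * of_int (int_decode n)))) \<in> borel_measurable borel"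
    by measurable
  then have "(\<lambda>\<theta>. enn2real (ennreal (wrapped_kernel s \<theta>))) \<in> borel_measurable borel"
    unfolding wrapped_kernel_eq_suminf[OF assms] by measurable
  then show ?thesis using wrapped_kernel_nonneg[OF assms] by simp
qed

text \<open>The factor \<open>exp (\<mp> r)\<close> converts the angle into arclength on the circle of radius \<open>exp (\<plusminus> r)\<close>. The
  junk value \<open>0\<close> off the two circles is invisible to arclength.\<close>
definition exit_density :: "complex \<Rightarrow> real" where
  "exit_density z = (if norm z = exp r then exp (- r) * wrapped_kernel 1 (Arg z)
     else if norm z = exp (- r) then exp r * wrapped_kernel (- 1) (Arg z) else 0)"

lemma exit_density_nonneg: "0 \<le> exit_density z"
  using wrapped_kernel_nonneg[of 1] wrapped_kernel_nonneg[of "- 1"] by (simp add: exit_density_def)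

lemma measurable_exit_density [measurable]: "exit_density \<in> borel_measurable borel"
proof -
  note [measurable] = measurable_Arg measurable_wrapped_kernel[of 1] measurable_wrapped_kernel[of "- 1"]
  show ?thesis unfolding exit_density_def[abs_def] by measurable
qed

lemma exit_density_polar:
  assumes s: "s = 1 \<or> s = - 1"
  shows "exit_density (of_real (exp (s * r)) * exp (\<i> * of_real \<theta>)) = exp (- s * r) * wrapped_kernel s \<theta>"
proof -
  let ?z = "of_real (exp (s * r)) * exp (\<i> * of_real \<theta>)"
  have z: "?z = of_real (exp (s * r)) * cis \<theta>" by (simp add: cis_conv_exp)
  have nz: "norm ?z = exp (s * r)" by (simp add: norm_mult)
  have "cis (Arg ?z) = sgn ?z" by (rule cis_Arg) simp
  also have "\<dots> = cis \<theta>" unfolding z by (simp add: sgn_mult sgn_of_real)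
  finally have "cis (Arg ?z) = cis \<theta>" .
  then have "sin (Arg ?z) = sin \<theta> \<and> cos (Arg ?z) = cos \<theta>" by (metis cis.sel)
  then obtain m :: int where A: "Arg ?z = \<theta> + 2 * pi * of_int m" using sin_cos_eq_iff by blast
  have "r \<noteq> - r" using r by simp
  then show ?thesis
    using s nz unfolding exit_density_def A wrapped_kernel_periodic by auto
qed

lemma emeasure_exit_density:
  assumes [measurable]: "S \<in> sets borel"
  shows "emeasure (density (arclength {circlepath 0 (exp r), circlepath 0 (exp (- r))}) (\<lambda>z. ennreal (exit_density z))) S
    = (\<integral>\<^sup>+y. ennreal (strip_kernel r x 1 y) * indicator S (exp (Complex r y)) \<partial>lborel)
    + (\<integral>\<^sup>+y. ennreal (strip_kernel r x (- 1) y) * indicator S (exp (Complex (- r) y)) \<partial>lborel)"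
proof -
  let ?c = "\<lambda>s. circlepath 0 (exp (s * r))"
  let ?\<Gamma> = "{circlepath 0 (exp r), circlepath 0 (exp (- r))}"
  let ?e = "\<lambda>s y. exp (Complex (s * r) y)"
  have [measurable]: "?e s \<in> borel_measurable borel" for s
    unfolding Complex_eq by (intro borel_measurable_continuous_onI continuous_intros)
  have mc: "\<gamma> \<in> borel_measurable borel" "(\<lambda>t. vector_derivative \<gamma> (at t)) \<in> borel_measurable borel"
    if "\<gamma> \<in> ?\<Gamma>" for \<gamma>
  proof -
    obtain R where R: "\<gamma> = circlepath 0 R" using \<open>\<gamma> \<in> ?\<Gamma>\<close> by auto
    show "\<gamma> \<in> borel_measurable borel"
      unfolding R circlepath by (intro borel_measurable_continuous_onI continuous_intros)
    show "(\<lambda>t. vector_derivative \<gamma> (at t)) \<in> borel_measurable borel"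
      unfolding R vector_derivative_circlepath by (intro borel_measurable_continuous_onI continuous_intros)
  qed
  have ne: "circlepath 0 (exp r) \<noteq> circlepath 0 (exp (- r))"
  proof
    assume "circlepath 0 (exp r) = circlepath 0 (exp (- r))"
    then have "circlepath 0 (exp r) 0 = circlepath 0 (exp (- r)) 0" by simp
    then have "complex_of_real (exp r) = of_real (exp (- r))" by (simp add: circlepath)
    then show False using r by (simp only: of_real_eq_iff exp_inj_iff)
  qed
  have side: "(\<integral>\<^sup>+t\<in>{0..1}. ennreal (norm (vector_derivative (?c s) (at t))) *
        (ennreal (exit_density (?c s t)) * indicator S (?c s t)) \<partial>lborel)
      = (\<integral>\<^sup>+y. ennreal (strip_kernel r x s y) * indicator S (?e s y) \<partial>lborel)"
    if s: "s = 1 \<or> s = - 1" for s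
  proof -
    have s1: "\<bar>s\<bar> = 1" using s by auto
    define G where "G t = ennreal (2 * pi) * (ennreal (strip_kernel r x s (2 * pi * t)) * indicator S (?e s (2 * pi * t)))" for t
    have [measurable]: "G \<in> borel_measurable borel" unfolding G_def[abs_def] by measurable
    have ct: "?c s t = of_real (exp (s * r)) * exp (\<i> * of_real (2 * pi * t))" for t
      by (simp add: circlepath mult_ac)
    have per: "?e s (2 * pi * (t + of_int k)) = ?c s t" for t and k :: int
    proof -
      have "Complex (s * r) (2 * pi * (t + of_int k)) = (of_real (s * r) + \<i> * of_real (2 * pi * t)) + of_int k * (of_real (2 * pi) * \<i>)"
        by (simp add: complex_eq_iff algebra_simps)
      moreover have "exp (of_int k * (of_real (2 * pi) * \<i>)) = 1"
        using exp_integer_2pi[of "of_int k"] by (simp add: mult_ac)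
      ultimately show ?thesis unfolding ct exp_of_real[symmetric] by (simp only: exp_add mult_1_right)
    qed
    have pt: "(\<Sum>n. G (t + of_int (int_decode n))) = ennreal (norm (vector_derivative (?c s) (at t))) *
        (ennreal (exit_density (?c s t)) * indicator S (?c s t))" for t
    proof -
      have "(\<Sum>n. G (t + of_int (int_decode n))) = ennreal (2 * pi) *
          ((\<Sum>n. ennreal (strip_kernel r x s (2 * pi * t + 2 * pi * of_int (int_decode n)))) * indicator S (?c s t))"
        unfolding G_def per by (simp add: distrib_left)
      also have "\<dots> = ennreal (2 * pi) * (ennreal (wrapped_kernel s (2 * pi * t)) * indicator S (?c s t))"
        unfolding wrapped_kernel_eq_suminf[OF s1] ..
      also have "ennreal (wrapped_kernel s (2 * pi * t)) = ennreal (exp (s * r)) * ennreal (exit_density (?c s t))"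
        unfolding ct exit_density_polar[OF s]
        by (simp add: ennreal_mult[symmetric] wrapped_kernel_nonneg[OF s1] mult.assoc[symmetric] exp_add[symmetric])
      also have "ennreal (2 * pi) * (ennreal (exp (s * r)) * ennreal (exit_density (?c s t)) * indicator S (?c s t))
          = ennreal (2 * pi * exp (s * r)) * (ennreal (exit_density (?c s t)) * indicator S (?c s t))"
        by (simp add: ennreal_mult mult_ac)
      also have "2 * pi * exp (s * r) = norm (vector_derivative (?c s) (at t))"
        by (simp add: vector_derivative_circlepath norm_mult)
      finally show ?thesis .
    qed
    have "(\<integral>\<^sup>+y. ennreal (strip_kernel r x s y) * indicator S (?e s y) \<partial>lborel) = (\<integral>\<^sup>+t. G t \<partial>lborel)"
      by (subst nn_integral_real_affine[where c="2 * pi" and t=0]) (auto simp: G_def[abs_def] nn_integral_cmult)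
    also have "\<dots> = (\<integral>\<^sup>+t\<in>{0..1}. (\<Sum>n. G (t + of_int (int_decode n))) \<partial>lborel)"
      by (rule nn_integral_wrap) measurable
    finally show ?thesis unfolding pt ..
  qed
  have "emeasure (density (arclength ?\<Gamma>) (\<lambda>z. ennreal (exit_density z))) S
      = (\<integral>\<^sup>+z. ennreal (exit_density z) * indicator S z \<partial>arclength ?\<Gamma>)"
    by (subst emeasure_density) auto
  also have "\<dots> = (\<Sum>\<gamma>\<in>?\<Gamma>. \<integral>\<^sup>+t\<in>{0..1}. ennreal (norm (vector_derivative \<gamma> (at t))) *
      (ennreal (exit_density (\<gamma> t)) * indicator S (\<gamma> t)) \<partial>lborel)"
    by (rule nn_integral_arclength) (use mc in auto)
  finally show ?thesis using ne side[of 1] side[of "- 1"] by simp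
qed

end

section \<open>The exit density of the annulus\<close>

text \<open>Half-angle formulas for \<open>t = tan (\<phi> / 2)\<close> and \<open>tanh (v / 2)\<close>, \<open>v = \<pi> y / 2 r\<close>, turn both sides into
  \<open>cos \<phi> / (4 (cosh v - s sin \<phi>))\<close>.\<close>
lemma strip_kernel_half_angle:
  assumes r: "0 < r" and x: "\<bar>x\<bar> < r" and s: "s = 1 \<or> s = - 1" and t: "t = tan (pi * x / (4 * r))" and u: "u = y / r"
  shows "sech (pi / 2 * u) * (1 - t\<^sup>2) /
      (4 * ((1 - s * t * ((1 - (tanh (pi / 4 * u))\<^sup>2) / (1 + (tanh (pi / 4 * u))\<^sup>2)))\<^sup>2
         + (t * (2 * tanh (pi / 4 * u) / (1 + (tanh (pi / 4 * u))\<^sup>2)))\<^sup>2))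
    = r * strip_kernel r x s y"
proof -
  interpret strip r x by unfold_locales fact+
  define w where "w = pi / 4 * u"
  define h where "h = cosh (2 * w)"
  define q where "q = sinh (2 * w)"
  define c where "c = cos (\<phi> / 2)"
  have v: "pi / 2 * u = 2 * w" "pi * y / (2 * r) = 2 * w" by (simp_all add: w_def u)
  have h0: "0 < h" by (simp add: h_def)
  have hq: "h\<^sup>2 - q\<^sup>2 = 1" unfolding h_def q_def by (simp add: cosh_square_eq)
  have C0: "0 < cosh w" by simp
  have P: "(cosh w)\<^sup>2 - (sinh w)\<^sup>2 = 1" by (simp add: cosh_square_eq)
  have Tm: "1 - (tanh w)\<^sup>2 = ((cosh w)\<^sup>2 - (sinh w)\<^sup>2) / (cosh w)\<^sup>2"
    and Tp: "1 + (tanh w)\<^sup>2 = h / (cosh w)\<^sup>2"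
    using C0 by (simp_all add: tanh_def h_def cosh_double power_divide diff_divide_distrib add_divide_distrib)
  have T1: "(1 - (tanh w)\<^sup>2) / (1 + (tanh w)\<^sup>2) = 1 / h"
    unfolding Tm Tp P using C0 by simp
  have T2: "2 * tanh w / (1 + (tanh w)\<^sup>2) = q / h"
    unfolding Tp using C0 by (simp add: tanh_def q_def sinh_double power2_eq_square)
  have c0: "0 < c"
    using \<phi>(1) unfolding c_def by (intro cos_gt_zero_pi) auto
  have tc: "t = sin (\<phi> / 2) / c" by (simp add: t \<phi>_def tan_def c_def)
  have sc: "(sin (\<phi> / 2))\<^sup>2 = 1 - c\<^sup>2" by (simp add: c_def sin_squared_eq)
  have t2: "t\<^sup>2 = (1 - c\<^sup>2) / c\<^sup>2" by (simp add: tc power_divide sc)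
  have cosphi: "cos \<phi> = 2 * c\<^sup>2 - 1" using cos_double_cos[of "\<phi> / 2"] by (simp add: c_def)
  have sinphi: "sin \<phi> = 2 * t * c\<^sup>2" using sin_double[of "\<phi> / 2"] c0 by (simp add: tc c_def power2_eq_square)
  have A: "(1 - t\<^sup>2) * c\<^sup>2 = cos \<phi>" using c0 by (simp add: t2 cosphi field_simps)
  have ss: "s * s = 1" using s by auto
  have "(1 - s * t * (1 / h))\<^sup>2 + (t * (q / h))\<^sup>2 = ((h - s * t)\<^sup>2 + t\<^sup>2 * q\<^sup>2) / h\<^sup>2"
    using h0 by (simp add: power2_eq_square field_simps)
  also have "(h - s * t)\<^sup>2 + t\<^sup>2 * q\<^sup>2 = h * (h * (1 + t\<^sup>2) - 2 * s * t)"
    using hq ss by algebra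
  also have "h * (h * (1 + t\<^sup>2) - 2 * s * t) / h\<^sup>2 = (h * (1 + t\<^sup>2) - 2 * s * t) / h"
    using h0 by (simp add: power2_eq_square)
  finally have B: "(1 - s * t * (1 / h))\<^sup>2 + (t * (q / h))\<^sup>2 = (h * (1 + t\<^sup>2) - 2 * s * t) / h" .
  have C: "(h * (1 + t\<^sup>2) - 2 * s * t) * c\<^sup>2 = h - s * sin \<phi>"
    using c0 unfolding sinphi t2 by (simp add: field_simps)
  have d: "0 < h - s * sin \<phi>" unfolding h_def using s by (intro kernel_denom_pos) auto
  then have d2: "h * (1 + t\<^sup>2) - 2 * s * t \<noteq> 0" using C by auto
  have "1 / h * (1 - t\<^sup>2) / (4 * ((h * (1 + t\<^sup>2) - 2 * s * t) / h)) = (1 - t\<^sup>2) / (4 * (h * (1 + t\<^sup>2) - 2 * s * t))"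
    using h0 by simp
  also have "\<dots> = ((1 - t\<^sup>2) * c\<^sup>2) / (4 * ((h * (1 + t\<^sup>2) - 2 * s * t) * c\<^sup>2))"
    using c0 by simp
  also have "\<dots> = r * strip_kernel r x s y"
    unfolding A C kernel_eq v(2) h_def[symmetric] using r by simp
  finally show ?thesis
    unfolding w_def[symmetric] v(1) sech_def T1 T2 B h_def[symmetric] .
qed

theorem mainTheorem12:
  fixes M :: "'a measure" and B :: "real \<Rightarrow> 'a \<Rightarrow> complex"
    and r a t :: real and u :: "real \<Rightarrow> int \<Rightarrow> real"
  assumes r: "0 < r"
    and a: "exp (- r) < a" "a < exp r"
    and bm: "planar_brownian_motion M B (of_real a)"
    and t: "t = tan (pi * ln a / (4 * r))"
    and u: "\<And>\<theta> k. u \<theta> k = (\<theta> + 2 * pi * of_int k) / r"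
  shows "\<exists>\<rho>. has_exit_density M B (annulus r) {circlepath 0 (exp r), circlepath 0 (exp (- r))} \<rho> \<and>
    (\<forall>\<sigma>\<in>{1, - 1}. \<forall>\<theta>.
      (let f = (\<lambda>k::int.
             sech (pi / 2 * u \<theta> k) * (1 - t\<^sup>2) /
             (4 * ((1 - \<sigma> * t * ((1 - (tanh (pi / 4 * u \<theta> k))\<^sup>2) / (1 + (tanh (pi / 4 * u \<theta> k))\<^sup>2)))\<^sup>2
                 + (t * (2 * tanh (pi / 4 * u \<theta> k) / (1 + (tanh (pi / 4 * u \<theta> k))\<^sup>2)))\<^sup>2)))
       in f summable_on UNIV \<and>
          \<rho> (of_real (exp (\<sigma> * r)) * exp (\<i> * of_real \<theta>)) = 1 / (r * exp (\<sigma> * r)) * (\<Sum>\<^sub>\<infinity>k\<in>UNIV. f k)))"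
proof -
  interpret planar_brownian_motion M B "of_real a" by (rule bm)
  define x where "x = ln a"
  have a0: "0 < a" using a(1) by (rule less_trans[OF exp_gt_zero])
  have ax: "a = exp x" using a0 by (simp add: x_def)
  have x: "\<bar>x\<bar> < r" using a unfolding ax by auto
  let ?X = "exit_point B (annulus r)"
  let ?\<Gamma> = "{circlepath 0 (exp r), circlepath 0 (exp (- r))}"
  have aU: "of_real a \<in> annulus r" using a a0 by (simp add: annulus_def)
  have X[measurable]: "?X \<in> borel_measurable M"
    using bounded_annulus[of r] not_bounded_UNIV[where 'a=complex]
    by (intro measurable_exit_point open_annulus) metis
  interpret S: strip r x using r x by unfold_locales
  have H: "harmonic_measure_two_circles r x (distr M borel ?X)"
  proof (intro harmonic_measure_two_circles.intro harmonic_measure_two_circles_axioms.intro)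
    show "strip r x" by (rule S.strip_axioms)
    show "prob_space (distr M borel ?X)" by (rule prob_space_distr) (rule X)
    show "AE z in distr M borel ?X. z \<in> two_circles r"
    proof (subst AE_distr_iff)
      show "{z \<in> space borel. z \<in> two_circles r} \<in> sets borel"
        using compact_imp_closed[OF compact_two_circles[of r]] by simp
      show "AE \<omega> in M. ?X \<omega> \<in> two_circles r"
        using exit_point_AE_frontier[OF open_annulus bounded_annulus aU]
      proof eventually_elim
        case (elim \<omega>)
        then show ?case
          unfolding frontier_annulus[OF r] by (auto simp: two_circles_def path_image_circlepath_nonneg)
      qed
    qed (rule X)
    show "(\<integral>z. Re (c * z powi n) \<partial>distr M borel ?X) = Re (c * exp (of_real x) powi n)" for c n
      using annulus_exit_expectation[OF aU _ cutoff_power, of c n]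
      by (simp add: integral_distr ax exp_of_real)
    show "(\<integral>z. ln (norm z) \<partial>distr M borel ?X) = x"
      using annulus_exit_expectation[OF aU _ cutoff_ln]
      by (simp add: integral_distr ax)
  qed simp
  have "distr M borel ?X = density (arclength ?\<Gamma>) (\<lambda>z. ennreal (S.exit_density z))"
    by (rule harmonic_measure_two_circles.measure_eq[OF H])
      (simp_all add: S.emeasure_exit_density harmonic_measure_two_circles.side_def[OF H])
  moreover have "distr M (arclength ?\<Gamma>) ?X = distr M borel ?X"
    by (rule distr_cong) simp_all
  moreover have "S.exit_density \<in> borel_measurable (arclength ?\<Gamma>)" "?X \<in> measurable M (arclength ?\<Gamma>)"
    by measurable
  ultimately have "distributed M (arclength ?\<Gamma>) ?X (\<lambda>z. ennreal (S.exit_density z))"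
    unfolding distributed_def by simp
  then have dens: "has_exit_density M B (annulus r) ?\<Gamma> S.exit_density"
    by (simp add: has_exit_density_def S.exit_density_nonneg)
  show ?thesis
  proof (intro exI[of _ S.exit_density] conjI dens ballI allI)
    fix \<sigma> \<theta> :: real assume "\<sigma> \<in> {1, - 1}"
    then have s: "\<sigma> = 1 \<or> \<sigma> = - 1" and s1: "\<bar>\<sigma>\<bar> = 1" by auto
    have f: "sech (pi / 2 * u \<theta> k) * (1 - t\<^sup>2) /
        (4 * ((1 - \<sigma> * t * ((1 - (tanh (pi / 4 * u \<theta> k))\<^sup>2) / (1 + (tanh (pi / 4 * u \<theta> k))\<^sup>2)))\<^sup>2
            + (t * (2 * tanh (pi / 4 * u \<theta> k) / (1 + (tanh (pi / 4 * u \<theta> k))\<^sup>2)))\<^sup>2))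
        = r * strip_kernel r x \<sigma> (\<theta> + 2 * pi * of_int k)" for k
      by (rule strip_kernel_half_angle[OF r x s]) (simp_all add: t x_def u)
    note summ = S.wrapped_kernel_summable[OF s1, of \<theta>]
    show "let f = (\<lambda>k::int.
             sech (pi / 2 * u \<theta> k) * (1 - t\<^sup>2) /
             (4 * ((1 - \<sigma> * t * ((1 - (tanh (pi / 4 * u \<theta> k))\<^sup>2) / (1 + (tanh (pi / 4 * u \<theta> k))\<^sup>2)))\<^sup>2
                 + (t * (2 * tanh (pi / 4 * u \<theta> k) / (1 + (tanh (pi / 4 * u \<theta> k))\<^sup>2)))\<^sup>2)))
       in f summable_on UNIV \<and>
          S.exit_density (of_real (exp (\<sigma> * r)) * exp (\<i> * of_real \<theta>)) = 1 / (r * exp (\<sigma> * r)) * (\<Sum>\<^sub>\<infinity>k\<in>UNIV. f k)"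
      unfolding Let_def f S.exit_density_polar[OF s] S.wrapped_kernel_def infsum_cmult_right'
      using summ r by (auto simp: exp_minus field_simps intro: summable_on_cmult_right)
  qed
qed

end
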